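(* Every analytic $\sigma\pi$-ODE is globally exactly quadratizable. That is: let $\dot x=f(x,t)$ be an analytic $\sigma\pi$-ODE in $n$ indeterminates with domain $\mathcal S=\mathcal D\times\mathcal T\subset\mathbb R^{n+1}$. Then the system $\mathcal S$ can be partitioned into a finite collection $\mathcal S_1,\dots,\mathcal S_L$ of disjoint sub-systems, and there exist maps $\Phi^1,\dots,\Phi^L$ with $\mathrm{Dom}\{\Phi^i\}\cap\mathcal S_i\neq\emptyset$, such that for every $i=1,\dots,L$ the sub-system $\mathcal S_i$ is quadratizable under the map $\Phi^i$.
   Context: **$\sigma\pi$-ODE.** An analytic $\sigma\pi$-ODE in $n$ indeterminates is an ODE $\dot x_i=f_i(x,t)=\sum_{l=1}^{\nu_i}v_{i,l}(t)X_{i,l}(x)$, $X_{i,l}(x)=\prod_{j=1}^n x_j^{p^l_{i,j}}$, $i=1,\dots,n$, where $\nu_i\ge 0$ are integers ($f_i=0$ if $\nu_i=0$), $p^l_{i,j}$ are arbitrary real exponents, and $v_{i,l}$ are real analytic functions on an open interval $\mathcal T\subset\mathbb R$. Real powers have their usual real meaning ($z^0\equiv1$; $z^p$ with $p$ rational with odd reduced denominator is also defined for $z<0$; otherwise it requires $z>0$, or $z\geq 0$ if $p>0$). Its domain is $\mathcal S=\mathcal D\times\mathcal T$, where $\mathcal D\subset\mathbb R^n$ is the maximal open set on which all $X_{i,l}$ are well defined and $C^\infty$. The zero system $\dot x=0$ is given the domain $\mathbb R^n$ by convention. **Solutions, systems.** For an ODE $\dot x=f(x,t)$ with $f$ locally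 Lipschitz on an open set $\mathcal A\subset\mathbb R^{n+1}$, the point $(x,t)\in\mathcal A$ is identified with the unique maximal solution $s\mapsto x(s)$ with $x(t)=x$, defined on the open interval $\mathbf I_{x,t}$. A set $\mathcal S\subset\mathcal A$ (not necessarily open) is a domain (invariant set) if $(x,t)\in\mathcal S$ implies $(x(s),s)\in\mathcal S$ for all $s\in\mathbf I_{x,t}$; the system $\mathcal S$ is the set of all solutions $(x,t)\in\mathcal S$. Sub-systems are disjoint if they have no solutions in common. A partition into disjoint sub-systems is a decomposition of $\mathcal S$ into a disjoint union of domains. **Sub-solutions.** A solution $(x,t)$ of an $n$-dimensional ODE is a local sub-solution of an $m$-dimensional ODE, $m\ge n$, if on some open sub-interval of $\mathbf I_{x,t}$ it coincides pointwise with $n$ out of the $m$ components of a solution of the second ODE. **Quadratization.** A quadratic ODE is an ODE $\dot z_i=\sum_{j=1}^m w_{i,j}(t)z_iz_j$, $i=1,\dots,m$, with locally Lipschitz $w_{i,j}:\mathcal T\to\mathbb R$. A map $\Phi:\mathrm{Dom}\{\Phi\}\to\mathbb R^m$, with $\mathrm{Dom}\{\Phi\}\subset\mathcal A$ open, is locally compatible with the ODE $\dot x=f(x,t)$ and a quadratic ODE if every $(x,t)\in\mathrm{Dom}\{\Phi\}$ has an open neighborhood $U\subset\mathrm{Dom}\{\Phi\}$ such that, for each $(x',t')\in U$ on the graph of the solution $(x,t)$, the point $(\Phi(x',t'),t')$ lies on the graph of the solution $(\Phi(x,t),t)$ of the quadratic ODE. A system $\mathcal S$ of the ODE is quadratizable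 under $\Phi$ if there is a quadratic ODE such that $\Phi$ is locally compatible with the two ODEs and every solution in $\mathcal S$ is a local sub-solution of a solution of that quadratic ODE of the form $(\Phi(x^*,t^* ),t^* )$ with $(x^*,t^* )\in\mathrm{Dom}\{\Phi\}$. **Identification of projected systems.** A sub-system consisting of solutions with $x_i\equiv0$ for all $i$ in an index set $J$ is identified with the corresponding system, in the remaining $n-|J|$ indeterminates, of the ODE obtained by removing the equations with index in $J$ and setting $x_i=0$ for $i\in J$ in the others; the map $\Phi$ for such a sub-system is then a map on an open subset of the domain of this reduced ODE. The zero system (consisting of the zero solution only) is regarded as trivially quadratizable under the identity map. *)

theory Defs
  imports "HOL-Analysis.Analysis"
begin

text \<open>
  The dimensions vary inside the statement (the dimension \<open>m\<close> of the quadratic ODE is existential,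
  and sub-systems live in fewer indeterminates), so a vector with components indexed by a
  finite set \<open>I\<close> of naturals is a function that vanishes outside \<open>I\<close>. The space $\mathbb{R}^n$ is
  \<open>coord_space {..<n}\<close>; indices run from 0 to \<open>n - 1\<close>. Removing the components in \<open>J\<close> from
  a vector with \<open>x\<^sub>j = 0\<close> for \<open>j \<in> J\<close> does not change the function representing it.
\<close>

type_synonym rvec = "nat \<Rightarrow> real"

definition coord_space :: "nat set \<Rightarrow> rvec set" where
  "coord_space I = {x. \<forall>i. i \<notin> I \<longrightarrow> x i = 0}"

lemma top_of_set_coord_space: "top_of_set (coord_space {..<n}) = Euclidean_space n"
  unfolding coord_space_def Euclidean_space_def euclidean_product_topology
  by (simp add: not_less)


section \<open>Solutions of ordinary differential equations\<close>

text \<open>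
  An ODE in the indeterminates \<open>I\<close> is given by a right-hand side \<open>f x t i\<close> (used for \<open>i \<in> I\<close> only)
  and a set \<open>A \<subseteq> coord_space I \<times> UNIV\<close>, open in that space, on which it is considered.
\<close>

type_synonym rhs = "rvec \<Rightarrow> real \<Rightarrow> rvec"

definition ode_solution ::
    "nat set \<Rightarrow> rhs \<Rightarrow> (rvec \<times> real) set \<Rightarrow> (real \<Rightarrow> rvec) \<Rightarrow> real set \<Rightarrow> bool" where
  "ode_solution I f A u K \<longleftrightarrow> open K \<and> is_interval K \<and>
     (\<forall>s\<in>K. (u s, s) \<in> A \<and>
        (\<forall>i\<in>I. ((\<lambda>r. u r i) has_real_derivative f (u s) s i) (at s)))"

text \<open>
  For locally Lipschitz \<open>f\<close> any two solutions through \<open>(x, t)\<close> agree where both are defined, so all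
  of them together form the maximal one; \<open>max_solution\<close> is meaningful on \<open>max_interval\<close> only.
\<close>

definition max_interval ::
    "nat set \<Rightarrow> rhs \<Rightarrow> (rvec \<times> real) set \<Rightarrow> rvec \<Rightarrow> real \<Rightarrow> real set" where
  "max_interval I f A x t = \<Union>{K. t \<in> K \<and> (\<exists>u. ode_solution I f A u K \<and> u t = x)}"

definition max_solution ::
    "nat set \<Rightarrow> rhs \<Rightarrow> (rvec \<times> real) set \<Rightarrow> rvec \<Rightarrow> real \<Rightarrow> real \<Rightarrow> rvec" where
  "max_solution I f A x t s =
     (THE y. \<exists>u K. ode_solution I f A u K \<and> t \<in> K \<and> u t = x \<and> s \<in> K \<and> y = u s)"

definition solution_graph ::
    "nat set \<Rightarrow> rhs \<Rightarrow> (rvec \<times> real) set \<Rightarrow> rvec \<Rightarrow> real \<Rightarrow> (rvec \<times> real) set" where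
  "solution_graph I f A x t = (\<lambda>s. (max_solution I f A x t s, s)) ` max_interval I f A x t"

text \<open>An invariant subset of \<open>A\<close>, not necessarily open.\<close>

definition ode_domain ::
    "nat set \<Rightarrow> rhs \<Rightarrow> (rvec \<times> real) set \<Rightarrow> (rvec \<times> real) set \<Rightarrow> bool" where
  "ode_domain I f A S \<longleftrightarrow> S \<subseteq> A \<and> (\<forall>(x, t)\<in>S. solution_graph I f A x t \<subseteq> S)"

text \<open>
  The solution \<open>(x, t)\<close> of the ODE \<open>(I, f, A)\<close> coincides, on some open interval, with the
  components \<open>\<sigma> i\<close>, \<open>i \<in> I\<close>, of the solution \<open>(z, \<tau>)\<close> of the ODE \<open>(M, g, B)\<close>. The injectivity of \<open>\<sigma>\<close>
  forces \<open>card I \<le> card M\<close> for finite \<open>M\<close>.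
\<close>

definition local_sub_solution ::
    "nat set \<Rightarrow> rhs \<Rightarrow> (rvec \<times> real) set \<Rightarrow> rvec \<Rightarrow> real \<Rightarrow>
     nat set \<Rightarrow> rhs \<Rightarrow> (rvec \<times> real) set \<Rightarrow> rvec \<Rightarrow> real \<Rightarrow> bool" where
  "local_sub_solution I f A x t M g B z \<tau> \<longleftrightarrow>
     (\<exists>K \<sigma>. open K \<and> is_interval K \<and> K \<noteq> {} \<and>
        K \<subseteq> max_interval I f A x t \<and> K \<subseteq> max_interval M g B z \<tau> \<and>
        inj_on \<sigma> I \<and> \<sigma> ` I \<subseteq> M \<and>
        (\<forall>s\<in>K. \<forall>i\<in>I. max_solution I f A x t s i = max_solution M g B z \<tau> s (\<sigma> i)))"


section \<open>Quadratization\<close>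

definition quadratic_rhs :: "nat \<Rightarrow> (nat \<Rightarrow> nat \<Rightarrow> real \<Rightarrow> real) \<Rightarrow> rhs" where
  "quadratic_rhs m w z t i = (\<Sum>j<m. w i j t * z i * z j)"

text \<open>A partial map \<open>\<Phi>\<close> is given by its domain \<open>Dom\<close> together with a total function.\<close>

definition locally_compatible ::
    "nat set \<Rightarrow> rhs \<Rightarrow> (rvec \<times> real) set \<Rightarrow> nat set \<Rightarrow> rhs \<Rightarrow> (rvec \<times> real) set \<Rightarrow>
     (rvec \<times> real) set \<Rightarrow> (rvec \<times> real \<Rightarrow> rvec) \<Rightarrow> bool" where
  "locally_compatible I f A M g B Dom \<Phi> \<longleftrightarrow>
     (\<forall>(x, t)\<in>Dom. \<exists>U. openin (top_of_set (coord_space I \<times> UNIV)) U \<and> (x, t) \<in> U \<and> U \<subseteq> Dom \<and>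
        (\<forall>(x', t')\<in>U. (x', t') \<in> solution_graph I f A x t \<longrightarrow>
           (\<Phi> (x', t'), t') \<in> solution_graph M g B (\<Phi> (x, t)) t))"

text \<open>
  The library's \<open>local_lipschitz\<close> speaks about functions of two arguments that are locally Lipschitz
  in the second one; the first argument is a dummy here.
\<close>

definition quadratizable ::
    "nat set \<Rightarrow> rhs \<Rightarrow> (rvec \<times> real) set \<Rightarrow> real set \<Rightarrow> (rvec \<times> real) set \<Rightarrow>
     (rvec \<times> real) set \<Rightarrow> (rvec \<times> real \<Rightarrow> rvec) \<Rightarrow> bool" where
  "quadratizable I f A T S Dom \<Phi> \<longleftrightarrow>
     openin (top_of_set (coord_space I \<times> UNIV)) Dom \<and> Dom \<subseteq> A \<and>
     (\<exists>m w. (\<forall>i<m. \<forall>j<m. local_lipschitz (UNIV :: real set) T (\<lambda>_. w i j)) \<and>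
        \<Phi> ` Dom \<subseteq> coord_space {..<m} \<and>
        locally_compatible I f A {..<m} (quadratic_rhs m w) (coord_space {..<m} \<times> T) Dom \<Phi> \<and>
        (\<forall>(x, t)\<in>S. \<exists>(x', t')\<in>Dom.
           local_sub_solution I f A x t
             {..<m} (quadratic_rhs m w) (coord_space {..<m} \<times> T) (\<Phi> (x', t')) t'))"

text \<open>
  Quadratizability of a sub-system up to the identification of projected systems. The ODE obtained
  by removing the equations with index in \<open>J\<close> and setting \<open>x\<^sub>j = 0\<close> for \<open>j \<in> J\<close> in the others has the
  indeterminates \<open>{..<n} - J\<close> and lives on the section \<open>x\<^sub>J = 0\<close> of \<open>A\<close>; since removed components are
  represented by 0, its right-hand side is \<open>f\<close> again. The case \<open>J = {}\<close> is plain
  quadratizability. For \<open>J = {..<n}\<close> the reduced ODE has no indeterminates, and the zero system is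
  quadratizable under the identity of \<open>coord_space {}\<close> (with \<open>m = 0\<close>).
\<close>

definition sub_system_quadratizable ::
    "nat \<Rightarrow> rhs \<Rightarrow> (rvec \<times> real) set \<Rightarrow> real set \<Rightarrow> (rvec \<times> real) set \<Rightarrow>
     (rvec \<times> real) set \<Rightarrow> (rvec \<times> real \<Rightarrow> rvec) \<Rightarrow> bool" where
  "sub_system_quadratizable n f A T S Dom \<Phi> \<longleftrightarrow>
     (\<exists>J \<subseteq> {..<n}.
        (\<forall>(x, t)\<in>S. \<forall>s\<in>max_interval {..<n} f A x t. \<forall>j\<in>J.
           max_solution {..<n} f A x t s j = 0) \<and>
        quadratizable ({..<n} - J) f {(x, t) \<in> A. \<forall>j\<in>J. x j = 0} T S Dom \<Phi>)"


section \<open>Analytic sigma-pi ODEs\<close>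

definition real_analytic_on :: "(real \<Rightarrow> real) \<Rightarrow> real set \<Rightarrow> bool" where
  "real_analytic_on v T \<longleftrightarrow>
     (\<forall>t\<^sub>0\<in>T. \<exists>a. \<exists>e>0. \<forall>t. \<bar>t - t\<^sub>0\<bar> < e \<longrightarrow> (\<lambda>k. a k * (t - t\<^sub>0) ^ k) sums v t)"

definition reduced_fraction :: "real \<Rightarrow> int \<Rightarrow> nat \<Rightarrow> bool" where
  "reduced_fraction p a b \<longleftrightarrow> 0 < b \<and> coprime a (int b) \<and> p = of_int a / of_nat b"

definition rpow_defined :: "real \<Rightarrow> real \<Rightarrow> bool" where
  "rpow_defined z p \<longleftrightarrow>
     p = 0 \<or> z > 0 \<or> (z = 0 \<and> p > 0) \<or> (z < 0 \<and> (\<exists>a b. reduced_fraction p a b \<and> odd b))"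

text \<open>
  Only meaningful where \<open>rpow_defined\<close> holds. For \<open>z < 0\<close> and \<open>p = a / b\<close> in lowest terms with odd \<open>b\<close>
  the value is the \<open>a\<close>-th power of the real \<open>b\<close>-th root; the library's \<open>powr\<close> does not give this.
\<close>

definition rpow :: "real \<Rightarrow> real \<Rightarrow> real" where
  "rpow z p =
     (if p = 0 then 1
      else if z \<ge> 0 then z powr p
      else (THE y. \<exists>a b. reduced_fraction p a b \<and> odd b \<and> y = root b z powi a))"

definition monomial_fun :: "nat \<Rightarrow> (nat \<Rightarrow> real) \<Rightarrow> rvec \<Rightarrow> real" where
  "monomial_fun n q x = (\<Prod>j<n. rpow (x j) (q j))"

text \<open>Here \<open>p i l j\<close> is the exponent of \<open>x\<^sub>j\<close> in the \<open>l\<close>-th monomial of the \<open>i\<close>-th equation.\<close>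

definition sigma_pi_rhs ::
    "nat \<Rightarrow> (nat \<Rightarrow> nat) \<Rightarrow> (nat \<Rightarrow> nat \<Rightarrow> real \<Rightarrow> real) \<Rightarrow> (nat \<Rightarrow> nat \<Rightarrow> nat \<Rightarrow> real) \<Rightarrow> rhs" where
  "sigma_pi_rhs n \<nu> v p x t i = (\<Sum>l<\<nu> i. v i l t * monomial_fun n (p i l) x)"

text \<open>
  \<open>C\<^sup>k\<close> through continuous iterated partial derivatives, for \<open>U\<close> open in \<open>coord_space I\<close>.
\<close>

primrec Ck_on :: "nat set \<Rightarrow> nat \<Rightarrow> (rvec \<Rightarrow> real) \<Rightarrow> rvec set \<Rightarrow> bool" where
  "Ck_on I 0 g U \<longleftrightarrow> continuous_on U g"
| "Ck_on I (Suc k) g U \<longleftrightarrow> continuous_on U g \<and>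
     (\<forall>i\<in>I. \<exists>h. (\<forall>x\<in>U. ((\<lambda>r. g (x(i := r))) has_real_derivative h x) (at (x i))) \<and> Ck_on I k h U)"

definition smooth_on :: "nat set \<Rightarrow> (rvec \<Rightarrow> real) \<Rightarrow> rvec set \<Rightarrow> bool" where
  "smooth_on I g U \<longleftrightarrow> (\<forall>k. Ck_on I k g U)"

text \<open>
  The largest open set on which all monomials are well defined and smooth. If there are no
  monomials at all (the zero system), this is the whole space.
\<close>

definition sigma_pi_dom ::
    "nat \<Rightarrow> (nat \<Rightarrow> nat) \<Rightarrow> (nat \<Rightarrow> nat \<Rightarrow> nat \<Rightarrow> real) \<Rightarrow> rvec set" where
  "sigma_pi_dom n \<nu> p =
     \<Union>{U. openin (top_of_set (coord_space {..<n})) U \<and>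
          (\<forall>i<n. \<forall>l<\<nu> i.
             (\<forall>x\<in>U. \<forall>j<n. rpow_defined (x j) (p i l j)) \<and>
             smooth_on {..<n} (monomial_fun n (p i l)) U)}"

end

theory Submission
  imports Defs "HOL-Complex_Analysis.Conformal_Mappings"
begin

text \<open>
  Dividing the monomials of the \<open>i\<close>-th equation by \<open>x\<^sub>i\<close> gives the ratios \<open>Y\<^sub>i\<^sub>l = X\<^sub>i\<^sub>l / x\<^sub>i\<close>. Where no
  coordinate vanishes, the equation reads \<open>x\<^sub>i' = x\<^sub>i R\<^sub>i\<close> with \<open>R\<^sub>i\<close> the sum of the \<open>v\<^sub>i\<^sub>l Y\<^sub>i\<^sub>l\<close>, so the
  logarithmic derivative of every product of real powers of the coordinates is a linear combination
  of \<open>R\<^sub>0, ..., R\<^sub>n\<^sub>-\<^sub>1\<close> with the exponents as coefficients. Coordinates and ratios are such products;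
  together they satisfy a Lotka-Volterra equation, which is quadratic and has the analytic
  coefficients \<open>v\<^sub>i\<^sub>l\<close> up to constant factors (\<open>lift_is_solution\<close>).

  This needs points without vanishing coordinates. The solutions are therefore sorted by the set \<open>J\<close>
  of their identically vanishing components, which gives at most \<open>2\<^sup>n\<close> disjoint invariant sets. On
  the class of \<open>J\<close> the components in \<open>J\<close> are dropped. Each remaining component is an analytic
  function on an interval that does not vanish identically, so all of them are nonzero together on
  some subinterval, and there the lift applies (\<open>sub_system_regular_interval\<close>). One formula for the
  lift and one quadratic equation serve all classes: with \<open>x / 0 = 0\<close> the ratios of the dropped
  equations are zero, and a Lotka-Volterra equation has solutions with any set of components zero.

  Analyticity in time cannot be weakened to smoothness in this argument, since smooth components may
  vanish alternately. It comes from solving the equation over the complex numbers. Near each point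
  of the domain the right-hand side is the restriction of a function that is holomorphic along
  holomorphic curves and Lipschitz in space (\<open>sigma_pi_complexifiable\<close>); for this one has to know
  that a vanishing coordinate occurs only with natural exponents, which follows from the smoothness
  of the monomials (\<open>sigma_pi_dom_regular\<close>). Picard iteration with such a right-hand side converges
  to a holomorphic solution that is real on the real axis (\<open>holomorphic_solution_exists\<close>).
  Uniqueness by the Lipschitz property identifies it with the maximal solution.
\<close>

section \<open>Open sets of coordinate spaces\<close>

definition coord_ball :: "nat set \<Rightarrow> rvec \<Rightarrow> real \<Rightarrow> rvec set" where
  "coord_ball I x e = {y \<in> coord_space I. \<forall>i\<in>I. \<bar>y i - x i\<bar> < e}"

lemma coord_ball_mono: "d \<le> e \<Longrightarrow> coord_ball I x d \<subseteq> coord_ball I x e"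
  unfolding coord_ball_def by force

text \<open>
  A basic open set of the product topology restricts finitely many coordinates, and on the coordinate
  space of \<open>I\<close> those outside \<open>I\<close> do not move. Hence one radius for the coordinates in \<open>I\<close> is enough.
\<close>

lemma open_fun_contains_coord_ball:
  fixes W :: "rvec set"
  assumes "open W" "x \<in> W" "x \<in> coord_space I"
  obtains e where "0 < e" "coord_ball I x e \<subseteq> W"
proof -
  have "openin (product_topology (\<lambda>i. euclidean) UNIV) W"
    using assms(1) unfolding open_fun_def by auto
  from product_topology_open_contains_basis[OF this assms(2)]
  obtain X where X: "x \<in> (\<Pi>\<^sub>E i\<in>UNIV. X i)" "\<And>i. open (X i)"
    "finite {i. X i \<noteq> UNIV}" "(\<Pi>\<^sub>E i\<in>UNIV. X i) \<subseteq> W"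
    by auto
  define F where "F = {i. X i \<noteq> (UNIV :: real set)}"
  have "\<exists>d>0. \<forall>z. \<bar>z - x i\<bar> < d \<longrightarrow> z \<in> X i" for i
  proof -
    have "x i \<in> X i" using X(1) by auto
    then obtain d where "d > 0" "ball (x i) d \<subseteq> X i"
      using X(2) open_contains_ball by metis
    then show ?thesis
      by (auto simp: subset_iff dist_real_def abs_minus_commute intro!: exI[of _ d])
  qed
  then obtain d where d: "\<And>i. d i > 0" "\<And>i z. \<bar>z - x i\<bar> < d i \<Longrightarrow> z \<in> X i"
    by metis
  define e where "e = Min (insert 1 (d ` F))"
  have fin: "finite F" using X(3) F_def by simp
  have e: "0 < e" "\<And>i. i \<in> F \<Longrightarrow> e \<le> d i"
    using d(1) fin by (auto simp: e_def)
  have "y \<in> W" if "y \<in> coord_ball I x e" for y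
  proof -
    have "y i \<in> X i" for i
    proof (cases "i \<in> F")
      case True
      have "\<bar>y i - x i\<bar> < e"
        using that assms(3) e(1) unfolding coord_ball_def coord_space_def
        by (cases "i \<in> I") auto
      then show ?thesis using e(2)[OF True] d(2) by force
    next
      case False
      then show ?thesis by (simp add: F_def)
    qed
    then show ?thesis using X(4) by blast
  qed
  then show ?thesis using that e(1) by blast
qed

lemma open_coord_conditions:
  fixes x :: rvec
  assumes "finite I"
  shows "open {y. \<forall>i\<in>I. \<bar>y i - x i\<bar> < e}"
proof -
  have "open {y :: rvec. \<bar>y i - x i\<bar> < e}" for i
    by (intro open_Collect_less continuous_intros continuous_on_product_coordinates)
  then have "open (\<Inter>i\<in>I. {y :: rvec. \<bar>y i - x i\<bar> < e})"
    using assms by blast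
  also have "(\<Inter>i\<in>I. {y :: rvec. \<bar>y i - x i\<bar> < e}) = {y. \<forall>i\<in>I. \<bar>y i - x i\<bar> < e}"
    by auto
  finally show ?thesis .
qed

lemma openin_coord_space_contains_coord_ball:
  assumes "openin (top_of_set (coord_space I)) U" "x \<in> U"
  obtains e where "0 < e" "coord_ball I x e \<subseteq> U"
proof -
  obtain W where W: "open W" "U = coord_space I \<inter> W"
    using assms(1) openin_open by metis
  then obtain e where "0 < e" "coord_ball I x e \<subseteq> W"
    using assms(2) open_fun_contains_coord_ball[of W x I] by blast
  then show ?thesis
    using that W(2) unfolding coord_ball_def by blast
qed

text \<open>
  Openness in space and time is used in this metric form only: it makes the passage between the full
  equation and its reductions to fewer indeterminates a matter of coordinates.
\<close>

lemma openin_coord_space_time_iff: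
  assumes "finite I"
  shows "openin (top_of_set (coord_space I \<times> UNIV)) A \<longleftrightarrow> A \<subseteq> coord_space I \<times> UNIV \<and>
    (\<forall>(x, t)\<in>A. \<exists>e>0. coord_ball I x e \<times> {t-e<..<t+e::real} \<subseteq> A)"
    (is "_ = (_ \<and> ?R)")
proof
  assume "openin (top_of_set (coord_space I \<times> UNIV)) A"
  then obtain W where W: "open W" "A = (coord_space I \<times> UNIV) \<inter> W"
    using openin_open by metis
  have ?R
  proof safe
    fix x t assume xt: "(x, t) \<in> A"
    then obtain P Q where PQ: "open P" "open Q" "x \<in> P" "t \<in> Q" "P \<times> Q \<subseteq> W"
      using W open_prod_elim[of W "(x, t)"] by (metis Int_iff mem_Sigma_iff)
    obtain a where a: "0 < a" "coord_ball I x a \<subseteq> P"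
      using open_fun_contains_coord_ball[OF PQ(1,3), of I] xt W by blast
    obtain b where b: "0 < b" "ball t b \<subseteq> Q"
      using PQ(2,4) open_contains_ball by metis
    have "coord_ball I x (min a b) \<subseteq> P"
      using a coord_ball_mono[of "min a b" a I x] by simp
    moreover have "{t - min a b<..<t + min a b} \<subseteq> Q"
      using b subset_ball[of "min a b" b t] unfolding ball_eq_greaterThanLessThan by simp
    ultimately show "\<exists>e>0. coord_ball I x e \<times> {t-e<..<t+e} \<subseteq> A"
      using PQ(5) W(2) a(1) b(1) unfolding coord_ball_def
      by (intro exI[of _ "min a b"]) auto
  qed
  then show "A \<subseteq> coord_space I \<times> UNIV \<and> ?R" using W by blast
next
  assume A: "A \<subseteq> coord_space I \<times> UNIV \<and> ?R"
  define W where "W = \<Union>{V. open V \<and> (coord_space I \<times> UNIV) \<inter> V \<subseteq> A}"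
  have "(x, t) \<in> W" if xt: "(x, t) \<in> A" for x t
  proof -
    obtain e where e: "0 < e" "coord_ball I x e \<times> {t-e<..<t+e} \<subseteq> A"
      using A xt by fast
    define V where "V = {y. \<forall>i\<in>I. \<bar>y i - x i\<bar> < e} \<times> {t-e<..<t+e}"
    have "open V" unfolding V_def by (intro open_Times open_coord_conditions assms) auto
    moreover have "(coord_space I \<times> UNIV) \<inter> V \<subseteq> A"
      using e(2) unfolding V_def coord_ball_def by blast
    moreover have "(x, t) \<in> V" unfolding V_def using e(1) by simp
    ultimately show ?thesis unfolding W_def by blast
  qed
  then have "A = (coord_space I \<times> UNIV) \<inter> W"
    using A unfolding W_def by blast
  moreover have "open W" unfolding W_def by blast
  ultimately show "openin (top_of_set (coord_space I \<times> UNIV)) A"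
    using openin_open by blast
qed

section \<open>Uniqueness and maximal solutions\<close>

lemma ode_solution_deriv:
  "ode_solution I f A u K \<Longrightarrow> s \<in> K \<Longrightarrow> i \<in> I \<Longrightarrow>
    ((\<lambda>r. u r i) has_real_derivative f (u s) s i) (at s)"
  unfolding ode_solution_def by blast

lemma ode_solution_in: "ode_solution I f A u K \<Longrightarrow> s \<in> K \<Longrightarrow> (u s, s) \<in> A"
  unfolding ode_solution_def by blast

lemma ode_solution_open: "ode_solution I f A u K \<Longrightarrow> open K"
  unfolding ode_solution_def by blast

lemma ode_solution_interval: "ode_solution I f A u K \<Longrightarrow> is_interval K"
  unfolding ode_solution_def by blast

lemma ode_solution_subset:
  "ode_solution I f A u K \<Longrightarrow> open K' \<Longrightarrow> is_interval K' \<Longrightarrow> K' \<subseteq> K \<Longrightarrow> ode_solution I f A u K'"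
  unfolding ode_solution_def by blast

lemma ode_solution_continuous:
  "ode_solution I f A u K \<Longrightarrow> i \<in> I \<Longrightarrow> continuous_on K (\<lambda>s. u s i)"
  by (rule continuous_at_imp_continuous_on) (blast intro: DERIV_isCont dest: ode_solution_deriv)

lemma ode_solution_stays_in_coord_ball:
  assumes "ode_solution I f A u K" "finite I" "A \<subseteq> coord_space I \<times> UNIV" "s \<in> K" "0 < e"
  obtains d where "0 < d" "{s-d<..<s+d} \<subseteq> K" "\<And>r. r \<in> {s-d<..<s+d} \<Longrightarrow> u r \<in> coord_ball I (u s) e"
proof -
  have "eventually (\<lambda>r. \<bar>u r i - u s i\<bar> < e) (nhds s)" if "i \<in> I" for i
  proof -
    have "isCont (\<lambda>r. u r i) s"
      using ode_solution_deriv[OF assms(1,4) that] DERIV_isCont by blast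
    then have "((\<lambda>r. u r i) \<longlongrightarrow> u s i) (nhds s)"
      unfolding isCont_def using tendsto_at_iff_tendsto_nhds[of "\<lambda>r. u r i" s] by blast
    from tendstoD[OF this assms(5)] show ?thesis by (simp add: dist_real_def)
  qed
  then have "eventually (\<lambda>r. \<forall>i\<in>I. \<bar>u r i - u s i\<bar> < e) (nhds s)"
    using assms(2) by (simp add: eventually_ball_finite)
  moreover have "eventually (\<lambda>r. r \<in> K) (nhds s)"
    using ode_solution_open[OF assms(1)] assms(4) eventually_nhds_in_open by blast
  ultimately have "eventually (\<lambda>r. r \<in> K \<and> (\<forall>i\<in>I. \<bar>u r i - u s i\<bar> < e)) (nhds s)"
    by eventually_elim auto
  then obtain d where d: "d > 0" "\<And>r. dist r s < d \<Longrightarrow> r \<in> K \<and> (\<forall>i\<in>I. \<bar>u r i - u s i\<bar> < e)"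
    unfolding eventually_nhds_metric by blast
  have "r \<in> K \<and> u r \<in> coord_ball I (u s) e" if "r \<in> {s-d<..<s+d}" for r
    using that d(2)[of r] ode_solution_in[OF assms(1), of r] assms(3)
    unfolding coord_ball_def by (auto simp: dist_real_def abs_less_iff)
  then show ?thesis using that d(1) by blast
qed

locale lipschitz_ode =
  fixes I :: "nat set" and f :: rhs and A :: "(rvec \<times> real) set"
  assumes finite_indeterminates: "finite I"
    and domain_in_space: "A \<subseteq> coord_space I \<times> UNIV"
    and lipschitz_rhs: "\<And>x\<^sub>0 t\<^sub>0. (x\<^sub>0, t\<^sub>0) \<in> A \<Longrightarrow> \<exists>e>0. \<exists>L. \<forall>x\<in>coord_ball I x\<^sub>0 e. \<forall>y\<in>coord_ball I x\<^sub>0 e.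
      \<forall>t\<in>{t\<^sub>0-e<..<t\<^sub>0+e}. \<forall>i\<in>I. \<bar>f x t i - f y t i\<bar> \<le> L * (\<Sum>j\<in>I. \<bar>x j - y j\<bar>)"
begin

text \<open>
  On a short interval around the common point, the mean value theorem bounds the largest distance of
  the two solutions by half of itself.
\<close>

lemma solutions_agree_near:
  assumes u: "ode_solution I f A u K" and w: "ode_solution I f A w K'"
    and s: "s \<in> K" "s \<in> K'" "u s = w s"
  obtains d where "0 < d" "\<And>r. r \<in> {s-d<..<s+d} \<Longrightarrow> u r = w r"
proof -
  have "(u s, s) \<in> A" using u s ode_solution_in by blast
  then obtain e L where e: "e > 0" and L: "\<And>x y t i. x \<in> coord_ball I (u s) e \<Longrightarrow>
      y \<in> coord_ball I (u s) e \<Longrightarrow> t \<in> {s-e<..<s+e} \<Longrightarrow> i \<in> I \<Longrightarrow>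
      \<bar>f x t i - f y t i\<bar> \<le> L * (\<Sum>j\<in>I. \<bar>x j - y j\<bar>)"
    using lipschitz_rhs by meson
  obtain a where a: "0 < a" "{s-a<..<s+a} \<subseteq> K" "\<And>r. r \<in> {s-a<..<s+a} \<Longrightarrow> u r \<in> coord_ball I (u s) e"
    using ode_solution_stays_in_coord_ball[OF u finite_indeterminates domain_in_space s(1) e] by metis
  obtain b where b: "0 < b" "{s-b<..<s+b} \<subseteq> K'" "\<And>r. r \<in> {s-b<..<s+b} \<Longrightarrow> w r \<in> coord_ball I (u s) e"
    using ode_solution_stays_in_coord_ball[OF w finite_indeterminates domain_in_space s(2) e] s(3) by metis
  define c where "c = \<bar>L\<bar> * real (card I) + 1"
  have c: "c > 0" unfolding c_def by (intro add_nonneg_pos mult_nonneg_nonneg) auto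
  \<comment> \<open>On so short an interval the Lipschitz bound makes the distance of the two solutions at most
    half its own maximum.\<close>
  define d where "d = min (min (a/2) (b/2)) (min (e/2) (1/(2*c)))"
  have d: "d > 0" "d < a" "d < b" "d < e" "d * c \<le> 1/2"
  proof -
    have "d * c \<le> 1/(2*c) * c" using c unfolding d_def by (intro mult_right_mono) auto
    then show "d * c \<le> 1/2" using c by simp
  qed (use a(1) b(1) e c in \<open>auto simp: d_def\<close>)
  define E where "E r = (\<Sum>j\<in>I. \<bar>u r j - w r j\<bar>)" for r
  have sub: "{s-d..s+d} \<subseteq> {s-a<..<s+a}" "{s-d..s+d} \<subseteq> {s-b<..<s+b}" "{s-d..s+d} \<subseteq> {s-e<..<s+e}"
    using d by auto
  have "continuous_on {s-d..s+d} E"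
    unfolding E_def
    by (intro continuous_intros continuous_on_subset[OF ode_solution_continuous[OF u]]
        continuous_on_subset[OF ode_solution_continuous[OF w]] subset_trans[OF sub(1) a(2)]
        subset_trans[OF sub(2) b(2)])
  moreover have "{s-d..s+d} \<noteq> {}" "compact {s-d..s+d}" using d by auto
  ultimately obtain r0 where r0: "r0 \<in> {s-d..s+d}" "\<And>r. r \<in> {s-d..s+d} \<Longrightarrow> E r \<le> E r0"
    using continuous_attains_sup[of "{s-d..s+d}" E] by metis
  have Epos: "0 \<le> E r" for r unfolding E_def by (simp add: sum_nonneg)
  have comp: "\<bar>u r0 i - w r0 i\<bar> \<le> \<bar>L\<bar> * E r0 * d" if i: "i \<in> I" for i
  proof -
    define D where "D r = u r i - w r i" for r
    have "norm (D r0 - D s) \<le> \<bar>L\<bar> * E r0 * norm (r0 - s)"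
    proof (rule field_differentiable_bound[where S="{s-d..s+d}"])
      fix r assume r: "r \<in> {s-d..s+d}"
      show "(D has_field_derivative f (u r) r i - f (w r) r i) (at r within {s-d..s+d})"
        unfolding D_def
        using ode_solution_deriv[OF u _ i, of r] ode_solution_deriv[OF w _ i, of r] r sub a(2) b(2)
        by (intro DERIV_diff) (meson DERIV_subset subset_UNIV subset_trans subsetD)+
      have "\<bar>f (u r) r i - f (w r) r i\<bar> \<le> L * E r"
        unfolding E_def using r sub a(3) b(3) by (intro L i) auto
      also have "\<dots> \<le> \<bar>L\<bar> * E r0"
        using r0(2)[OF r] Epos by (intro mult_mono) auto
      finally show "norm (f (u r) r i - f (w r) r i) \<le> \<bar>L\<bar> * E r0" by simp
    qed (use r0 d in auto)
    moreover have "norm (r0 - s) \<le> d" using r0(1) by auto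
    ultimately show ?thesis using s(3) Epos unfolding D_def
      using mult_left_mono[of "norm (r0 - s)" d "\<bar>L\<bar> * E r0"] by simp
  qed
  have "E r0 \<le> (\<Sum>j\<in>I. \<bar>L\<bar> * E r0 * d)" unfolding E_def[of r0]
    using comp by (intro sum_mono) (simp add: E_def)
  also have "\<dots> = E r0 * (d * (\<bar>L\<bar> * real (card I)))" by simp
  also have "\<dots> \<le> E r0 * (1/2)"
  proof (intro mult_left_mono Epos)
    have "d * (\<bar>L\<bar> * real (card I)) \<le> d * c" using d(1) unfolding c_def by (intro mult_left_mono) auto
    then show "d * (\<bar>L\<bar> * real (card I)) \<le> 1/2" using d(5) by linarith
  qed
  finally have "E r0 = 0" using Epos[of r0] by linarith
  then have E0: "E r = 0" if "r \<in> {s-d..s+d}" for r using r0(2)[OF that] Epos[of r] by linarith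
  have "u r = w r" if r: "r \<in> {s-d<..<s+d}" for r
  proof
    fix j
    have "(u r, r) \<in> A" "(w r, r) \<in> A"
      using r d a(2) b(2) u w ode_solution_in sub by (auto simp: subset_iff)
    then have "u r \<in> coord_space I" "w r \<in> coord_space I" using domain_in_space by auto
    moreover have "\<forall>j\<in>I. u r j = w r j"
      using E0[of r] r finite_indeterminates unfolding E_def by (auto simp: sum_nonneg_eq_0_iff)
    ultimately show "u r j = w r j" unfolding coord_space_def by (cases "j \<in> I") auto
  qed
  then show ?thesis using that d(1) by blast
qed

lemma solution_unique:
  assumes u: "ode_solution I f A u K" and w: "ode_solution I f A w K'"
    and t: "t \<in> K" "t \<in> K'" "u t = w t" and s: "s \<in> K" "s \<in> K'"
  shows "u s = w s"
proof -
  define C where "C = K \<inter> K'"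
  define P where "P = {r \<in> C. u r = w r}"
  have C: "open C" "connected C"
    unfolding C_def using u w ode_solution_open ode_solution_interval
    by (auto simp: is_interval_connected_1[symmetric] is_interval_Int)
  have "openin (top_of_set C) P"
  proof -
    have "open P"
      unfolding open_contains_ball
    proof
      fix r assume r: "r \<in> P"
      then obtain d where d: "0 < d" "\<And>q. q \<in> {r-d<..<r+d} \<Longrightarrow> u q = w q"
        using solutions_agree_near[OF u w, of r] unfolding P_def C_def by blast
      obtain e where e: "0 < e" "ball r e \<subseteq> C"
        using C(1) r open_contains_ball unfolding P_def by blast
      have "ball r (min d e) \<subseteq> P"
        using d e unfolding P_def by (auto simp: dist_real_def subset_iff abs_less_iff)
      then show "\<exists>e>0. ball r e \<subseteq> P" using d e by (intro exI[of _ "min d e"]) auto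
    qed
    then show ?thesis by (simp add: P_def open_subset subset_iff)
  qed
  moreover have "closedin (top_of_set C) P"
  proof -
    have eq: "P = (\<Inter>i\<in>I. {r \<in> C. u r i = w r i}) \<inter> C"
    proof
      show "P \<subseteq> (\<Inter>i\<in>I. {r \<in> C. u r i = w r i}) \<inter> C" unfolding P_def by auto
      show "(\<Inter>i\<in>I. {r \<in> C. u r i = w r i}) \<inter> C \<subseteq> P"
      proof
        fix r assume r: "r \<in> (\<Inter>i\<in>I. {r \<in> C. u r i = w r i}) \<inter> C"
        have "u r j = w r j" for j
        proof (cases "j \<in> I")
          case False
          have "(u r, r) \<in> A" "(w r, r) \<in> A" using r u w ode_solution_in unfolding C_def by auto
          then have "u r \<in> coord_space I" "w r \<in> coord_space I" using domain_in_space by auto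
          then show ?thesis using False unfolding coord_space_def by simp
        qed (use r in auto)
        then show "r \<in> P" using r unfolding P_def by auto
      qed
    qed
    have "closedin (top_of_set C) {r \<in> C. u r i = w r i}" if "i \<in> I" for i
    proof -
      have "continuous_on C (\<lambda>r. u r i - w r i)"
        using ode_solution_continuous[OF u that] ode_solution_continuous[OF w that]
        unfolding C_def by (intro continuous_intros) (auto intro: continuous_on_subset)
      from continuous_closedin_preimage_constant[OF this, of 0] show ?thesis by simp
    qed
    then have "closedin (top_of_set C) ((\<Inter>i\<in>I. {r \<in> C. u r i = w r i}) \<inter> C)"
      by (cases "I = {}") (auto intro!: closedin_Int closedin_INT)
    then show ?thesis using eq by simp
  qed
  ultimately have "P = {} \<or> P = C"
    using C(2) connected_clopen by blast
  then show ?thesis using t s unfolding P_def C_def by blast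
qed

lemma max_solution_eq:
  assumes "ode_solution I f A u K" "t \<in> K" "u t = x" "s \<in> K"
  shows "max_solution I f A x t s = u s"
  unfolding max_solution_def
proof (rule the_equality)
  show "\<exists>ua Ka. ode_solution I f A ua Ka \<and> t \<in> Ka \<and> ua t = x \<and> s \<in> Ka \<and> u s = ua s"
    by (intro exI[of _ u] exI[of _ K]) (simp add: assms)
  fix y assume "\<exists>u K. ode_solution I f A u K \<and> t \<in> K \<and> u t = x \<and> s \<in> K \<and> y = u s"
  then obtain w K' where "ode_solution I f A w K'" "t \<in> K'" "w t = x" "s \<in> K'" "y = w s" by blast
  then show "y = u s" using solution_unique[OF assms(1) _ assms(2) _ _ assms(4), of w K'] assms(3) by simp
qed

lemma subset_max_interval:
  "ode_solution I f A u K \<Longrightarrow> t \<in> K \<Longrightarrow> u t = x \<Longrightarrow> K \<subseteq> max_interval I f A x t"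
  unfolding max_interval_def by blast

lemma max_intervalE:
  assumes "s \<in> max_interval I f A x t"
  obtains u K where "ode_solution I f A u K" "t \<in> K" "u t = x" "s \<in> K"
    "\<forall>r\<in>K. max_solution I f A x t r = u r"
proof -
  obtain u K where u: "ode_solution I f A u K" "t \<in> K" "u t = x" "s \<in> K"
    using assms unfolding max_interval_def by blast
  then show ?thesis using that max_solution_eq[OF u(1-3)] by blast
qed

lemma max_solution_is_solution:
  "ode_solution I f A (max_solution I f A x t) (max_interval I f A x t)"
  unfolding ode_solution_def
proof (intro conjI ballI)
  show "open (max_interval I f A x t)"
    unfolding max_interval_def by (intro open_Union) (auto dest: ode_solution_open)
  have "connected (max_interval I f A x t)"
    unfolding max_interval_def
    by (intro connected_Union) (auto dest: ode_solution_interval simp: is_interval_connected_1)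
  then show "is_interval (max_interval I f A x t)" by (simp add: is_interval_connected_1)
next
  fix s assume "s \<in> max_interval I f A x t"
  then obtain u K where u: "ode_solution I f A u K" "t \<in> K" "u t = x" "s \<in> K"
    "\<forall>r\<in>K. max_solution I f A x t r = u r"
    by (rule max_intervalE)
  show "(max_solution I f A x t s, s) \<in> A" using u ode_solution_in by simp
  fix i assume i: "i \<in> I"
  have "((\<lambda>r. u r i) has_real_derivative f (max_solution I f A x t s) s i) (at s)"
    using ode_solution_deriv[OF u(1,4) i] u(4,5) by simp
  then show "((\<lambda>r. max_solution I f A x t r i) has_real_derivative f (max_solution I f A x t s) s i) (at s)"
    by (rule has_field_derivative_transform_within_open[OF _ ode_solution_open[OF u(1)] u(4)])
      (simp add: u(5))
qed

lemma max_solution_start: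
  assumes "s \<in> max_interval I f A x t"
  shows "t \<in> max_interval I f A x t" "max_solution I f A x t t = x"
proof -
  obtain u K where u: "ode_solution I f A u K" "t \<in> K" "u t = x" "s \<in> K"
    "\<forall>r\<in>K. max_solution I f A x t r = u r"
    using assms by (rule max_intervalE)
  show "t \<in> max_interval I f A x t" using subset_max_interval[OF u(1-3)] u(2) by blast
  show "max_solution I f A x t t = x" using u by simp
qed

text \<open>
  Starting again from any point of a solution gives the same solution with the same maximal interval;
  this is what makes properties of whole solutions invariant.
\<close>

lemma max_solution_restart:
  assumes s: "s \<in> max_interval I f A x t" and y: "y = max_solution I f A x t s"
  shows "max_interval I f A y s = max_interval I f A x t"
    and "r \<in> max_interval I f A x t \<Longrightarrow> max_solution I f A y s r = max_solution I f A x t r"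
proof -
  note sol = max_solution_is_solution[of x t]
  have 1: "max_interval I f A x t \<subseteq> max_interval I f A y s"
    using subset_max_interval[OF sol s] y by simp
  have 2: "max_solution I f A y s q = max_solution I f A x t q" if "q \<in> max_interval I f A x t" for q
    using max_solution_eq[OF sol s _ that] y by simp
  have "max_interval I f A y s \<subseteq> max_interval I f A x t"
    using subset_max_interval[OF max_solution_is_solution[of y s], of t x] 1 2
      max_solution_start[OF s] by auto
  then show "max_interval I f A y s = max_interval I f A x t" using 1 by blast
  show "r \<in> max_interval I f A x t \<Longrightarrow> max_solution I f A y s r = max_solution I f A x t r"
    using 2 by simp
qed

end

section \<open>Complex extensions of right-hand sides\<close>

definition extends_holomorphically :: "(real \<Rightarrow> real) \<Rightarrow> real \<Rightarrow> bool" where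
  "extends_holomorphically h s \<longleftrightarrow> (\<exists>e>0. \<exists>g. g holomorphic_on ball (of_real s) e \<and>
     (\<forall>r. \<bar>r - s\<bar> < e \<longrightarrow> g (of_real r) = of_real (h r)))"

lemma extends_holomorphicallyI:
  "0 < e \<Longrightarrow> g holomorphic_on ball (of_real s) e \<Longrightarrow>
    (\<And>r. \<bar>r - s\<bar> < e \<Longrightarrow> g (of_real r) = of_real (h r)) \<Longrightarrow> extends_holomorphically h s"
  unfolding extends_holomorphically_def by blast

lemma extends_holomorphicallyE:
  assumes "extends_holomorphically h s"
  obtains e g where "0 < e" "g holomorphic_on ball (of_real s) e"
    "\<And>r. \<bar>r - s\<bar> < e \<Longrightarrow> g (of_real r) = of_real (h r)"
  using assms unfolding extends_holomorphically_def by blast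

definition polydisc :: "nat \<Rightarrow> rvec \<Rightarrow> real \<Rightarrow> (nat \<Rightarrow> complex) set" where
  "polydisc n x e = {z. \<forall>j<n. cmod (z j - of_real (x j)) < e}"

text \<open>
  What Picard iteration needs of a complex extension \<open>G\<close> of \<open>\<phi>\<close> on a complex neighbourhood of
  \<open>(x\<^sub>0, t\<^sub>0)\<close>. Holomorphy in several variables is replaced by its consequence for holomorphic curves
  \<open>u\<close>. A single constant \<open>C\<close> serves as bound and as Lipschitz constant, so that restricting to a
  smaller neighbourhood and increasing \<open>C\<close> brings finitely many extensions to common parameters.
\<close>

definition complex_extension ::
    "nat \<Rightarrow> rvec \<Rightarrow> real \<Rightarrow> real \<Rightarrow> real \<Rightarrow> (rvec \<Rightarrow> real \<Rightarrow> real) \<Rightarrow>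
     ((nat \<Rightarrow> complex) \<Rightarrow> complex \<Rightarrow> complex) \<Rightarrow> bool" where
  "complex_extension n x\<^sub>0 t\<^sub>0 e C \<phi> G \<longleftrightarrow>
     (\<forall>z\<in>polydisc n x\<^sub>0 e. \<forall>\<tau>\<in>ball (of_real t\<^sub>0) e. cmod (G z \<tau>) \<le> C) \<and>
     (\<forall>z\<in>polydisc n x\<^sub>0 e. \<forall>w\<in>polydisc n x\<^sub>0 e. \<forall>\<tau>\<in>ball (of_real t\<^sub>0) e.
        cmod (G z \<tau> - G w \<tau>) \<le> C * (\<Sum>j<n. cmod (z j - w j))) \<and>
     (\<forall>B u. B \<subseteq> ball (of_real t\<^sub>0) e \<longrightarrow> (\<forall>j<n. u j holomorphic_on B) \<longrightarrow>
        (\<forall>\<tau>\<in>B. (\<lambda>j. u j \<tau>) \<in> polydisc n x\<^sub>0 e) \<longrightarrow> (\<lambda>\<tau>. G (\<lambda>j. u j \<tau>) \<tau>) holomorphic_on B) \<and>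
     (\<forall>x t. (\<forall>j<n. \<bar>x j - x\<^sub>0 j\<bar> < e) \<longrightarrow> \<bar>t - t\<^sub>0\<bar> < e \<longrightarrow>
        G (\<lambda>j. of_real (x j)) (of_real t) = of_real (\<phi> x t))"

definition complexifiable :: "nat \<Rightarrow> rvec \<Rightarrow> real \<Rightarrow> (rvec \<Rightarrow> real \<Rightarrow> real) \<Rightarrow> bool" where
  "complexifiable n x\<^sub>0 t\<^sub>0 \<phi> \<longleftrightarrow> (\<exists>e>0. \<exists>C G. complex_extension n x\<^sub>0 t\<^sub>0 e C \<phi> G)"

lemma complexifiableI: "0 < e \<Longrightarrow> complex_extension n x\<^sub>0 t\<^sub>0 e C \<phi> G \<Longrightarrow> complexifiable n x\<^sub>0 t\<^sub>0 \<phi>"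
  unfolding complexifiable_def by (intro exI conjI)

lemma complexifiableE:
  assumes "complexifiable n x\<^sub>0 t\<^sub>0 \<phi>"
  obtains e C G where "0 < e" "complex_extension n x\<^sub>0 t\<^sub>0 e C \<phi> G"
  using assms unfolding complexifiable_def by (elim exE conjE)

lemma polydisc_mono: "d \<le> e \<Longrightarrow> polydisc n x d \<subseteq> polydisc n x e"
  unfolding polydisc_def by force

context
  fixes n x\<^sub>0 t\<^sub>0 e C \<phi> G
  assumes ext: "complex_extension n x\<^sub>0 t\<^sub>0 e C \<phi> G"
begin

lemma complex_extension_bound:
  "z \<in> polydisc n x\<^sub>0 e \<Longrightarrow> \<tau> \<in> ball (of_real t\<^sub>0) e \<Longrightarrow> cmod (G z \<tau>) \<le> C"
  using ext[unfolded complex_extension_def, THEN conjunct1] by simp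

lemma complex_extension_lipschitz:
  "z \<in> polydisc n x\<^sub>0 e \<Longrightarrow> w \<in> polydisc n x\<^sub>0 e \<Longrightarrow>
    \<tau> \<in> ball (of_real t\<^sub>0) e \<Longrightarrow> cmod (G z \<tau> - G w \<tau>) \<le> C * (\<Sum>j<n. cmod (z j - w j))"
  using ext[unfolded complex_extension_def, THEN conjunct2, THEN conjunct1] by simp

lemma complex_extension_holomorphic:
  assumes "B \<subseteq> ball (of_real t\<^sub>0) e" "\<And>j. j < n \<Longrightarrow> u j holomorphic_on B"
    "\<And>\<tau>. \<tau> \<in> B \<Longrightarrow> (\<lambda>j. u j \<tau>) \<in> polydisc n x\<^sub>0 e"
  shows "(\<lambda>\<tau>. G (\<lambda>j. u j \<tau>) \<tau>) holomorphic_on B"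
proof -
  have "B \<subseteq> ball (of_real t\<^sub>0) e \<longrightarrow> (\<forall>j<n. u j holomorphic_on B) \<longrightarrow>
        (\<forall>\<tau>\<in>B. (\<lambda>j. u j \<tau>) \<in> polydisc n x\<^sub>0 e) \<longrightarrow> (\<lambda>\<tau>. G (\<lambda>j. u j \<tau>) \<tau>) holomorphic_on B"
    using ext[unfolded complex_extension_def, THEN conjunct2, THEN conjunct2, THEN conjunct1]
    by (elim allE[of _ B] allE[of _ u])
  then show ?thesis using assms by simp
qed

lemma complex_extension_real:
  assumes "\<And>j. j < n \<Longrightarrow> \<bar>x j - x\<^sub>0 j\<bar> < e" "\<bar>t - t\<^sub>0\<bar> < e"
  shows "G (\<lambda>j. of_real (x j)) (of_real t) = of_real (\<phi> x t)"
proof -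
  have "(\<forall>j<n. \<bar>x j - x\<^sub>0 j\<bar> < e) \<longrightarrow> \<bar>t - t\<^sub>0\<bar> < e \<longrightarrow> 
        G (\<lambda>j. of_real (x j)) (of_real t) = of_real (\<phi> x t)"
    using ext[unfolded complex_extension_def, THEN conjunct2, THEN conjunct2, THEN conjunct2]
    by (elim allE[of _ x] allE[of _ t])
  then show ?thesis using assms by simp
qed

end

lemma complex_extension_mono:
  assumes "complex_extension n x\<^sub>0 t\<^sub>0 e C \<phi> G" "d \<le> e" "C \<le> C'"
  shows "complex_extension n x\<^sub>0 t\<^sub>0 d C' \<phi> G"
  unfolding complex_extension_def
proof (intro conjI ballI allI impI)
  have P: "z \<in> polydisc n x\<^sub>0 d \<Longrightarrow> z \<in> polydisc n x\<^sub>0 e" for z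
    using polydisc_mono[OF assms(2)] by blast
  have B: "\<tau> \<in> ball (of_real t\<^sub>0) d \<Longrightarrow> \<tau> \<in> ball (of_real t\<^sub>0) e" for \<tau> :: complex
    using assms(2) by simp
  show "cmod (G z \<tau>) \<le> C'" if "z \<in> polydisc n x\<^sub>0 d" "\<tau> \<in> ball (of_real t\<^sub>0) d" for z \<tau>
    using complex_extension_bound[OF assms(1) P[OF that(1)] B[OF that(2)]] assms(3) by linarith
  show "cmod (G z \<tau> - G w \<tau>) \<le> C' * (\<Sum>j<n. cmod (z j - w j))"
    if "z \<in> polydisc n x\<^sub>0 d" "w \<in> polydisc n x\<^sub>0 d" "\<tau> \<in> ball (of_real t\<^sub>0) d" for z w \<tau>
  proof -
    have "cmod (G z \<tau> - G w \<tau>) \<le> C * (\<Sum>j<n. cmod (z j - w j))"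
      using complex_extension_lipschitz[OF assms(1) P[OF that(1)] P[OF that(2)] B[OF that(3)]] .
    also have "\<dots> \<le> C' * (\<Sum>j<n. cmod (z j - w j))"
      using assms(3) by (intro mult_right_mono sum_nonneg) auto
    finally show ?thesis .
  qed
next
  fix B u
  assume B: "B \<subseteq> ball (complex_of_real t\<^sub>0) d" and u: "\<forall>j<n. u j holomorphic_on B"
    and P: "\<forall>\<tau>\<in>B. (\<lambda>j. u j \<tau>) \<in> polydisc n x\<^sub>0 d"
  show "(\<lambda>\<tau>. G (\<lambda>j. u j \<tau>) \<tau>) holomorphic_on B"
  proof (rule complex_extension_holomorphic[OF assms(1)])
    show "B \<subseteq> ball (of_real t\<^sub>0) e" using B subset_ball[OF assms(2)] by (rule subset_trans)
    show "u j holomorphic_on B" if "j < n" for j using u that by simp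
    show "(\<lambda>j. u j \<tau>) \<in> polydisc n x\<^sub>0 e" if "\<tau> \<in> B" for \<tau>
      using P that polydisc_mono[OF assms(2)] by blast
  qed
next
  fix x t assume x: "\<forall>j<n. \<bar>x j - x\<^sub>0 j\<bar> < d" and t: "\<bar>t - t\<^sub>0\<bar> < d"
  have "\<bar>x j - x\<^sub>0 j\<bar> < e" if "j < n" for j using x that assms(2) by fastforce
  moreover have "\<bar>t - t\<^sub>0\<bar> < e" using t assms(2) by linarith
  ultimately show "G (\<lambda>j. of_real (x j)) (of_real t) = of_real (\<phi> x t)"
    by (rule complex_extension_real[OF assms(1)])
qed

lemma complexifiable_const: "complexifiable n x\<^sub>0 t\<^sub>0 (\<lambda>x t. c)"
proof -
  have "complex_extension n x\<^sub>0 t\<^sub>0 1 \<bar>c\<bar> (\<lambda>x t. c) (\<lambda>z \<tau>. of_real c)"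
    unfolding complex_extension_def by (simp add: mult_nonneg_nonneg sum_nonneg)
  then show ?thesis by (rule complexifiableI[OF zero_less_one])
qed

lemma complexifiable_common:
  assumes "complexifiable n x\<^sub>0 t\<^sub>0 \<phi>" "complexifiable n x\<^sub>0 t\<^sub>0 \<psi>"
  obtains e C G H where "0 < e" "1 \<le> C"
    "complex_extension n x\<^sub>0 t\<^sub>0 e C \<phi> G" "complex_extension n x\<^sub>0 t\<^sub>0 e C \<psi> H"
proof -
  obtain a A G where G: "0 < a" "complex_extension n x\<^sub>0 t\<^sub>0 a A \<phi> G"
    using assms(1) by (rule complexifiableE)
  obtain b B H where H: "0 < b" "complex_extension n x\<^sub>0 t\<^sub>0 b B \<psi> H"
    using assms(2) by (rule complexifiableE)
  have "complex_extension n x\<^sub>0 t\<^sub>0 (min a b) (max 1 (max A B)) \<phi> G"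
    by (rule complex_extension_mono[OF G(2)]) auto
  moreover have "complex_extension n x\<^sub>0 t\<^sub>0 (min a b) (max 1 (max A B)) \<psi> H"
    by (rule complex_extension_mono[OF H(2)]) auto
  ultimately show ?thesis
    using that[of "min a b" "max 1 (max A B)" G H] G(1) H(1) by simp
qed

lemma complexifiable_add:
  assumes "complexifiable n x\<^sub>0 t\<^sub>0 \<phi>" "complexifiable n x\<^sub>0 t\<^sub>0 \<psi>"
  shows "complexifiable n x\<^sub>0 t\<^sub>0 (\<lambda>x t. \<phi> x t + \<psi> x t)"
proof -
  obtain e C G H where e: "0 < e" and C: "1 \<le> C" and
    G: "complex_extension n x\<^sub>0 t\<^sub>0 e C \<phi> G" and H: "complex_extension n x\<^sub>0 t\<^sub>0 e C \<psi> H"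
    using complexifiable_common[OF assms] .
  have "complex_extension n x\<^sub>0 t\<^sub>0 e (2 * C) (\<lambda>x t. \<phi> x t + \<psi> x t) (\<lambda>z \<tau>. G z \<tau> + H z \<tau>)"
    unfolding complex_extension_def
  proof (intro conjI ballI allI impI)
    show "cmod (G z \<tau> + H z \<tau>) \<le> 2 * C" if "z \<in> polydisc n x\<^sub>0 e" "\<tau> \<in> ball (of_real t\<^sub>0) e" for z \<tau>
      using complex_extension_bound[OF G that] complex_extension_bound[OF H that]
        norm_triangle_ineq[of "G z \<tau>" "H z \<tau>"] by linarith
    show "cmod (G z \<tau> + H z \<tau> - (G w \<tau> + H w \<tau>)) \<le> 2 * C * (\<Sum>j<n. cmod (z j - w j))"
      if "z \<in> polydisc n x\<^sub>0 e" "w \<in> polydisc n x\<^sub>0 e" "\<tau> \<in> ball (of_real t\<^sub>0) e" for z w \<tau>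
      using complex_extension_lipschitz[OF G that] complex_extension_lipschitz[OF H that]
        norm_triangle_ineq[of "G z \<tau> - G w \<tau>" "H z \<tau> - H w \<tau>"] by (simp add: algebra_simps)
    show "(\<lambda>\<tau>. G (\<lambda>j. u j \<tau>) \<tau> + H (\<lambda>j. u j \<tau>) \<tau>) holomorphic_on B"
      if "B \<subseteq> ball (of_real t\<^sub>0) e" "\<forall>j<n. u j holomorphic_on B" "\<forall>\<tau>\<in>B. (\<lambda>j. u j \<tau>) \<in> polydisc n x\<^sub>0 e" for B u
      using that by (intro holomorphic_on_add complex_extension_holomorphic[OF G] complex_extension_holomorphic[OF H]) auto
    show "G (\<lambda>j. of_real (x j)) (of_real t) + H (\<lambda>j. of_real (x j)) (of_real t) = of_real (\<phi> x t + \<psi> x t)"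
      if "\<forall>j<n. \<bar>x j - x\<^sub>0 j\<bar> < e" "\<bar>t - t\<^sub>0\<bar> < e" for x t
      using complex_extension_real[OF G, of x t] complex_extension_real[OF H, of x t] that by simp
  qed
  then show ?thesis by (rule complexifiableI[OF e])
qed

lemma complexifiable_mult:
  assumes "complexifiable n x\<^sub>0 t\<^sub>0 \<phi>" "complexifiable n x\<^sub>0 t\<^sub>0 \<psi>"
  shows "complexifiable n x\<^sub>0 t\<^sub>0 (\<lambda>x t. \<phi> x t * \<psi> x t)"
proof -
  obtain e C G H where e: "0 < e" and C: "1 \<le> C" and
    G: "complex_extension n x\<^sub>0 t\<^sub>0 e C \<phi> G" and H: "complex_extension n x\<^sub>0 t\<^sub>0 e C \<psi> H"
    using complexifiable_common[OF assms] .
  have "complex_extension n x\<^sub>0 t\<^sub>0 e (2 * C * C) (\<lambda>x t. \<phi> x t * \<psi> x t) (\<lambda>z \<tau>. G z \<tau> * H z \<tau>)"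
    unfolding complex_extension_def
  proof (intro conjI ballI allI impI)
    show "cmod (G z \<tau> * H z \<tau>) \<le> 2 * C * C" if "z \<in> polydisc n x\<^sub>0 e" "\<tau> \<in> ball (of_real t\<^sub>0) e" for z \<tau>
    proof -
      have "cmod (G z \<tau> * H z \<tau>) \<le> C * C"
        unfolding norm_mult using C
        by (intro mult_mono complex_extension_bound[OF G that] complex_extension_bound[OF H that]) auto
      also have "\<dots> \<le> 2 * C * C" using C by (simp add: mult_mono)
      finally show ?thesis .
    qed
    show "cmod (G z \<tau> * H z \<tau> - G w \<tau> * H w \<tau>) \<le> 2 * C * C * (\<Sum>j<n. cmod (z j - w j))"
      if "z \<in> polydisc n x\<^sub>0 e" "w \<in> polydisc n x\<^sub>0 e" "\<tau> \<in> ball (of_real t\<^sub>0) e" for z w \<tau>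
    proof -
      let ?S = "\<Sum>j<n. cmod (z j - w j)"
      have "cmod (G z \<tau> * H z \<tau> - G w \<tau> * H w \<tau>)
          = cmod (G z \<tau> * (H z \<tau> - H w \<tau>) + (G z \<tau> - G w \<tau>) * H w \<tau>)"
        by (simp add: algebra_simps)
      also have "\<dots> \<le> cmod (G z \<tau>) * cmod (H z \<tau> - H w \<tau>) + cmod (G z \<tau> - G w \<tau>) * cmod (H w \<tau>)"
        by (metis norm_mult norm_triangle_ineq)
      also have "\<dots> \<le> C * (C * ?S) + (C * ?S) * C"
        using C by (intro add_mono mult_mono complex_extension_bound[OF G that(1,3)]
            complex_extension_bound[OF H that(2,3)] complex_extension_lipschitz[OF G that]
            complex_extension_lipschitz[OF H that] mult_nonneg_nonneg sum_nonneg) auto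
      finally show ?thesis by (simp add: algebra_simps)
    qed
    show "(\<lambda>\<tau>. G (\<lambda>j. u j \<tau>) \<tau> * H (\<lambda>j. u j \<tau>) \<tau>) holomorphic_on B"
      if "B \<subseteq> ball (of_real t\<^sub>0) e" "\<forall>j<n. u j holomorphic_on B" "\<forall>\<tau>\<in>B. (\<lambda>j. u j \<tau>) \<in> polydisc n x\<^sub>0 e" for B u
      using that by (intro holomorphic_on_mult complex_extension_holomorphic[OF G] complex_extension_holomorphic[OF H]) auto
    show "G (\<lambda>j. of_real (x j)) (of_real t) * H (\<lambda>j. of_real (x j)) (of_real t) = of_real (\<phi> x t * \<psi> x t)"
      if "\<forall>j<n. \<bar>x j - x\<^sub>0 j\<bar> < e" "\<bar>t - t\<^sub>0\<bar> < e" for x t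
      using complex_extension_real[OF G, of x t] complex_extension_real[OF H, of x t] that by simp
  qed
  then show ?thesis by (rule complexifiableI[OF e])
qed

lemma complexifiable_sum:
  assumes "finite K" "\<And>k. k \<in> K \<Longrightarrow> complexifiable n x\<^sub>0 t\<^sub>0 (\<phi> k)"
  shows "complexifiable n x\<^sub>0 t\<^sub>0 (\<lambda>x t. \<Sum>k\<in>K. \<phi> k x t)"
  using assms
proof (induction K rule: finite_induct)
  case empty
  show ?case unfolding sum.empty by (rule complexifiable_const)
next
  case (insert k K)
  have "complexifiable n x\<^sub>0 t\<^sub>0 (\<phi> k)" "complexifiable n x\<^sub>0 t\<^sub>0 (\<lambda>x t. \<Sum>k\<in>K. \<phi> k x t)"
    using insert by simp_all
  from complexifiable_add[OF this] show ?case using insert(1,2) by simp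
qed

lemma complexifiable_prod:
  assumes "finite K" "\<And>k. k \<in> K \<Longrightarrow> complexifiable n x\<^sub>0 t\<^sub>0 (\<phi> k)"
  shows "complexifiable n x\<^sub>0 t\<^sub>0 (\<lambda>x t. \<Prod>k\<in>K. \<phi> k x t)"
  using assms
proof (induction K rule: finite_induct)
  case empty
  show ?case unfolding prod.empty by (rule complexifiable_const)
next
  case (insert k K)
  have "complexifiable n x\<^sub>0 t\<^sub>0 (\<phi> k)" "complexifiable n x\<^sub>0 t\<^sub>0 (\<lambda>x t. \<Prod>k\<in>K. \<phi> k x t)"
    using insert by simp_all
  from complexifiable_mult[OF this] show ?case using insert(1,2) by simp
qed

lemma holomorphic_lipschitz_near:
  fixes g :: "complex \<Rightarrow> complex"
  assumes "g holomorphic_on ball c e" "0 < e"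
  obtains d C where "0 < d" "d \<le> e" "0 \<le> C" "\<And>z. z \<in> ball c d \<Longrightarrow> cmod (g z) \<le> C"
    "\<And>z w. z \<in> ball c d \<Longrightarrow> w \<in> ball c d \<Longrightarrow> cmod (g z - g w) \<le> C * cmod (z - w)"
proof -
  let ?d = "e / 2"
  have sub: "cball c ?d \<subseteq> ball c e" using assms(2) by (auto simp: subset_iff)
  have "continuous_on (cball c ?d) g" "continuous_on (cball c ?d) (deriv g)"
    using assms(1) sub holomorphic_on_imp_continuous_on holomorphic_deriv[OF assms(1)] continuous_on_subset
    by blast+
  then have "bounded (g ` cball c ?d)" "bounded (deriv g ` cball c ?d)"
    by (auto intro!: compact_imp_bounded compact_continuous_image)
  then obtain A B where AB: "\<And>z. z \<in> cball c ?d \<Longrightarrow> cmod (g z) \<le> A" "\<And>z. z \<in> cball c ?d \<Longrightarrow> cmod (deriv g z) \<le> B"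
    unfolding bounded_iff by (metis imageI)
  show ?thesis
  proof (rule that[of ?d "max 0 (max A B)"])
    show "cmod (g z) \<le> max 0 (max A B)" if "z \<in> ball c ?d" for z
      using AB(1)[of z] that by auto
    show "cmod (g z - g w) \<le> max 0 (max A B) * cmod (z - w)" if "z \<in> ball c ?d" "w \<in> ball c ?d" for z w
    proof (rule field_differentiable_bound[where S = "ball c ?d"])
      fix z assume z: "z \<in> ball c ?d"
      then show "(g has_field_derivative deriv g z) (at z within ball c ?d)"
        using subsetD[OF sub, of z]
        by (intro has_field_derivative_at_within[OF holomorphic_derivI[OF assms(1) open_ball]]) auto
      show "cmod (deriv g z) \<le> max 0 (max A B)" using AB(2)[of z] z by auto
    qed (use that in auto)
  qed (use assms in auto)
qed

lemma complexifiable_coordinate: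
  assumes "extends_holomorphically h (x\<^sub>0 j)" and j: "j < n"
  shows "complexifiable n x\<^sub>0 t\<^sub>0 (\<lambda>x t. h (x j))"
proof -
  obtain e g where e: "0 < e" and g: "g holomorphic_on ball (of_real (x\<^sub>0 j)) e"
    and h: "\<And>r. \<bar>r - x\<^sub>0 j\<bar> < e \<Longrightarrow> g (of_real r) = of_real (h r)"
    using assms(1) by (rule extends_holomorphicallyE) blast
  obtain d C where d: "0 < d" "d \<le> e" and C: "0 \<le> C" "\<And>z. z \<in> ball (of_real (x\<^sub>0 j)) d \<Longrightarrow> cmod (g z) \<le> C"
    "\<And>z w. z \<in> ball (of_real (x\<^sub>0 j)) d \<Longrightarrow> w \<in> ball (of_real (x\<^sub>0 j)) d \<Longrightarrow> cmod (g z - g w) \<le> C * cmod (z - w)"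
    using holomorphic_lipschitz_near[OF g e] by metis
  have ball: "z j \<in> ball (of_real (x\<^sub>0 j)) d" if "z \<in> polydisc n x\<^sub>0 d" for z
    using that j unfolding polydisc_def by (simp add: dist_norm norm_minus_commute)
  have "complex_extension n x\<^sub>0 t\<^sub>0 d C (\<lambda>x t. h (x j)) (\<lambda>z \<tau>. g (z j))"
    unfolding complex_extension_def
  proof (intro conjI ballI allI impI)
    show "cmod (g (z j)) \<le> C" if "z \<in> polydisc n x\<^sub>0 d" "\<tau> \<in> ball (of_real t\<^sub>0) d" for z and \<tau> :: complex
      using C(2)[OF ball[OF that(1)]] .
    show "cmod (g (z j) - g (w j)) \<le> C * (\<Sum>j<n. cmod (z j - w j))"
      if "z \<in> polydisc n x\<^sub>0 d" "w \<in> polydisc n x\<^sub>0 d" "\<tau> \<in> ball (of_real t\<^sub>0) d" for z w and \<tau> :: complex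
    proof -
      have "cmod (z j - w j) \<le> (\<Sum>j<n. cmod (z j - w j))"
        using j by (intro member_le_sum) auto
      then show ?thesis
        using C(3)[OF ball[OF that(1)] ball[OF that(2)]] mult_left_mono[OF _ C(1)] by (meson order_trans)
    qed
    show "(\<lambda>\<tau>. g (u j \<tau>)) holomorphic_on B"
      if "B \<subseteq> ball (of_real t\<^sub>0) d" "\<forall>j<n. u j holomorphic_on B" "\<forall>\<tau>\<in>B. (\<lambda>j. u j \<tau>) \<in> polydisc n x\<^sub>0 d"
      for B and u :: "nat \<Rightarrow> complex \<Rightarrow> complex"
    proof (rule holomorphic_on_compose_gen[of "u j" B g, unfolded o_def])
      show "u j holomorphic_on B" using that(2) j by simp
      show "g holomorphic_on ball (of_real (x\<^sub>0 j)) e" by (rule g)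
      show "u j ` B \<subseteq> ball (of_real (x\<^sub>0 j)) e" 
      proof
        fix y assume "y \<in> u j ` B"
        then obtain \<tau> where "\<tau> \<in> B" "y = u j \<tau>" by blast
        then have "y \<in> ball (of_real (x\<^sub>0 j)) d" using ball[of "\<lambda>j. u j \<tau>"] that(3) by simp
        then show "y \<in> ball (of_real (x\<^sub>0 j)) e" using d(2) by simp
      qed
    qed
    show "g (of_real (x j)) = of_real (h (x j))"
      if "\<forall>j<n. \<bar>x j - x\<^sub>0 j\<bar> < d" "\<bar>t - t\<^sub>0\<bar> < d" for x t
    proof -
      have "\<bar>x j - x\<^sub>0 j\<bar> < d" using that(1) j by simp
      then show ?thesis using h[of "x j"] d(2) by simp
    qed
  qed
  then show ?thesis by (rule complexifiableI[OF d(1)])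
qed

lemma complexifiable_time:
  assumes "extends_holomorphically h t\<^sub>0"
  shows "complexifiable n x\<^sub>0 t\<^sub>0 (\<lambda>x t. h t)"
proof -
  obtain e g where e: "0 < e" and g: "g holomorphic_on ball (of_real t\<^sub>0) e"
    and h: "\<And>r. \<bar>r - t\<^sub>0\<bar> < e \<Longrightarrow> g (of_real r) = of_real (h r)"
    using assms(1) by (rule extends_holomorphicallyE) blast
  obtain d C where d: "0 < d" "d \<le> e" and C: "0 \<le> C" "\<And>z. z \<in> ball (of_real t\<^sub>0) d \<Longrightarrow> cmod (g z) \<le> C"
    using holomorphic_lipschitz_near[OF g e] by metis
  have "complex_extension n x\<^sub>0 t\<^sub>0 d C (\<lambda>x t. h t) (\<lambda>z \<tau>. g \<tau>)"
    unfolding complex_extension_def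
  proof (intro conjI ballI allI impI)
    show "cmod (g \<tau> - g \<tau>) \<le> C * (\<Sum>j<n. cmod (z j - w j))" for z w :: "nat \<Rightarrow> complex" and \<tau>
      using C(1) by (auto intro!: mult_nonneg_nonneg sum_nonneg)
    show "g holomorphic_on B" if "B \<subseteq> ball (of_real t\<^sub>0) d" for B
      using that d(2) by (intro holomorphic_on_subset[OF g]) auto
    show "g (of_real t) = of_real (h t)" if "\<bar>t - t\<^sub>0\<bar> < d" for t
      using h that d(2) by simp
  qed (use C in auto)
  then show ?thesis by (rule complexifiableI[OF d(1)])
qed

text \<open>
  The components of a right-hand side, extended one by one, have extensions with common parameters.
\<close>

lemma complexifiable_family:
  assumes "finite K" "\<And>k. k \<in> K \<Longrightarrow> complexifiable n x\<^sub>0 t\<^sub>0 (\<phi> k)"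
  obtains e C G where "0 < e" "1 \<le> C" "\<And>k. k \<in> K \<Longrightarrow> complex_extension n x\<^sub>0 t\<^sub>0 e C (\<phi> k) (G k)"
proof -
  have "\<forall>k\<in>K. \<exists>y. 0 < fst y \<and> complex_extension n x\<^sub>0 t\<^sub>0 (fst y) (fst (snd y)) (\<phi> k) (snd (snd y))"
  proof
    fix k assume "k \<in> K"
    then obtain e C G where "0 < e" "complex_extension n x\<^sub>0 t\<^sub>0 e C (\<phi> k) G"
      using assms(2) complexifiableE by metis
    then show "\<exists>y. 0 < fst y \<and> complex_extension n x\<^sub>0 t\<^sub>0 (fst y) (fst (snd y)) (\<phi> k) (snd (snd y))"
      by (intro exI[of _ "(e, C, G)"]) simp
  qed
  from bchoice[OF this] obtain y where y: "\<And>k. k \<in> K \<Longrightarrow> 0 < fst (y k)"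
      "\<And>k. k \<in> K \<Longrightarrow> complex_extension n x\<^sub>0 t\<^sub>0 (fst (y k)) (fst (snd (y k))) (\<phi> k) (snd (snd (y k)))"
    by auto
  let ?e = "Min (insert 1 ((\<lambda>k. fst (y k)) ` K))"
  let ?C = "Max (insert 1 ((\<lambda>k. fst (snd (y k))) ` K))"
  show ?thesis
  proof (rule that[of ?e ?C "\<lambda>k. snd (snd (y k))"])
    show "0 < ?e" using y(1) assms(1) by simp
    show "1 \<le> ?C" using assms(1) by simp
    show "complex_extension n x\<^sub>0 t\<^sub>0 ?e ?C (\<phi> k) (snd (snd (y k)))" if "k \<in> K" for k
      by (rule complex_extension_mono[OF y(2)[OF that]]) (use that assms(1) in auto)
  qed
qed

section \<open>Holomorphic solutions\<close>

lemma primitive_bound: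
  fixes P Q :: "complex \<Rightarrow> complex"
  assumes P: "\<And>\<tau>. \<tau> \<in> ball c d \<Longrightarrow> (P has_field_derivative h \<tau>) (at \<tau>)"
    and Q: "\<And>\<tau>. \<tau> \<in> ball c d \<Longrightarrow> (Q has_field_derivative k \<tau>) (at \<tau>)"
    and eq: "P c = Q c" and bd: "\<And>\<tau>. \<tau> \<in> ball c d \<Longrightarrow> cmod (h \<tau> - k \<tau>) \<le> K" and \<tau>: "\<tau> \<in> ball c d"
  shows "cmod (P \<tau> - Q \<tau>) \<le> K * d"
proof -
  have c: "c \<in> ball c d" using \<tau> le_less_trans[OF zero_le_dist] by (simp del: zero_le_dist) blast
  have K: "0 \<le> K" using bd[OF c] norm_ge_zero order_trans by blast
  have "cmod ((P \<tau> - Q \<tau>) - (P c - Q c)) \<le> K * cmod (\<tau> - c)"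
  proof (rule field_differentiable_bound[where S = "ball c d" and f = "\<lambda>\<tau>. P \<tau> - Q \<tau>"])
    show "((\<lambda>\<tau>. P \<tau> - Q \<tau>) has_field_derivative h z - k z) (at z within ball c d)" if "z \<in> ball c d" for z
      by (intro DERIV_diff has_field_derivative_at_within[OF P[OF that]] has_field_derivative_at_within[OF Q[OF that]])
  qed (use bd \<tau> c in auto)
  also have "\<dots> \<le> K * d"
    using \<tau> K by (intro mult_left_mono) (auto simp: dist_norm norm_minus_commute)
  finally show ?thesis using eq by simp
qed

lemma has_real_derivative_along_reals:
  assumes "(P has_field_derivative D) (at (complex_of_real s))"
  shows "((\<lambda>r. Re (P (of_real r))) has_real_derivative Re D) (at s)"
    "((\<lambda>r. Im (P (of_real r))) has_real_derivative Im D) (at s)"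
proof -
  have "((\<lambda>r. P (of_real r)) has_vector_derivative D) (at s)"
    using has_vector_derivative_real_field[OF assms] .
  then show "((\<lambda>r. Re (P (of_real r))) has_real_derivative Re D) (at s)"
    "((\<lambda>r. Im (P (of_real r))) has_real_derivative Im D) (at s)"
    by (simp_all add: has_field_derivative_Re has_field_derivative_Im)
qed

text \<open>
  Along the real axis the imaginary part of the primitive has derivative zero.
\<close>

lemma primitive_real_on_reals:
  fixes P h :: "complex \<Rightarrow> complex"
  assumes P: "\<And>\<tau>. \<tau> \<in> ball (of_real t) d \<Longrightarrow> (P has_field_derivative h \<tau>) (at \<tau>)"
    and h: "\<And>r. \<bar>r - t\<bar> < d \<Longrightarrow> h (of_real r) \<in> \<real>" and P0: "P (of_real t) \<in> \<real>" and s: "\<bar>s - t\<bar> < d"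
  shows "P (of_real s) \<in> \<real>"
proof -
  have ball: "complex_of_real r \<in> ball (of_real t) d \<longleftrightarrow> \<bar>r - t\<bar> < d" for r
    by (simp add: dist_norm norm_minus_commute flip: of_real_diff) (simp add: abs_minus_commute)
  have "\<exists>c. \<forall>r\<in>{t-d<..<t+d}. Im (P (of_real r)) = c"
  proof (rule has_field_derivative_zero_constant)
    fix r assume "r \<in> {t-d<..<t+d}"
    then have r: "\<bar>r - t\<bar> < d" by auto
    then have "Im (h (of_real r)) = 0" using h complex_is_Real_iff by blast
    then show "((\<lambda>r. Im (P (of_real r))) has_field_derivative 0) (at r within {t-d<..<t+d})"
      using has_real_derivative_along_reals(2)[OF P[of "of_real r"]] ball r
      by (metis has_field_derivative_at_within)
  qed auto
  moreover have "s \<in> {t-d<..<t+d}" "t \<in> {t-d<..<t+d}" using s by auto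
  ultimately have "Im (P (of_real s)) = Im (P (of_real t))" by metis
  then show ?thesis using P0 complex_is_Real_iff by metis
qed

lemma geometric_differences_uniform_limit:
  fixes u :: "nat \<Rightarrow> 'a \<Rightarrow> complex"
  assumes "\<And>k x. x \<in> B \<Longrightarrow> cmod (u (Suc k) x - u k x) \<le> e * (1/2) ^ k"
  obtains U where "uniform_limit B u U sequentially"
proof -
  have "summable (\<lambda>k. e * (1/2::real) ^ k)" by (intro summable_mult summable_geometric) auto
  then have *: "uniform_limit B (\<lambda>N x. \<Sum>k<N. u (Suc k) x - u k x) (\<lambda>x. \<Sum>k. u (Suc k) x - u k x) sequentially"
    using assms by (intro Weierstrass_m_test[where M = "\<lambda>k. e * (1/2) ^ k"]) auto
  have "uniform_limit B (\<lambda>N x. u 0 x + (\<Sum>k<N. u (Suc k) x - u k x)) (\<lambda>x. u 0 x + (\<Sum>k. u (Suc k) x - u k x)) sequentially"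
    by (intro uniform_limit_add uniform_limit_const *)
  moreover have "(\<lambda>N x. u 0 x + (\<Sum>k<N. u (Suc k) x - u k x)) = u"
    by (intro ext) (simp add: sum_lessThan_telescope[of "\<lambda>k. u k _"])
  ultimately show ?thesis using that by simp
qed

text \<open>
  Picard iteration on a disc in complex time. Each iterate is a primitive of a holomorphic function,
  so all iterates are holomorphic, and successive ones differ by at most \<open>e / 2\<^sup>k\<close>. The limit is
  holomorphic by Weierstrass' theorem, which also allows passing to the limit in the differential
  equation. The iterates are real on the real axis because the right-hand side is.
\<close>

theorem holomorphic_solution_exists:
  fixes f :: rhs and x\<^sub>0 :: rvec
  assumes I: "I \<subseteq> {..<n}" and x0: "x\<^sub>0 \<in> coord_space I" and e: "0 < e" and C: "1 \<le> C"
    and G: "\<And>i. i \<in> I \<Longrightarrow> complex_extension n x\<^sub>0 t\<^sub>0 e C (\<lambda>x t. f x t i) (G i)"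
  obtains d U where "0 < d" "d \<le> e"
    "\<And>i \<tau>. i \<in> I \<Longrightarrow> \<tau> \<in> ball (of_real t\<^sub>0) d \<Longrightarrow> (U i has_field_derivative G i (\<lambda>j. U j \<tau>) \<tau>) (at \<tau>)"
    "\<And>i \<tau>. i \<notin> I \<Longrightarrow> \<tau> \<in> ball (of_real t\<^sub>0) d \<Longrightarrow> U i \<tau> = 0"
    "\<And>i. U i (of_real t\<^sub>0) = of_real (x\<^sub>0 i)"
    "\<And>\<tau>. \<tau> \<in> ball (of_real t\<^sub>0) d \<Longrightarrow> (\<lambda>j. U j \<tau>) \<in> polydisc n x\<^sub>0 e"
    "\<And>i s. \<bar>s - t\<^sub>0\<bar> < d \<Longrightarrow> U i (of_real s) \<in> \<real>"
proof -
  \<comment> \<open>The first bound on the radius keeps the iterates inside the polydisc, the second one makes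
    the iteration a contraction by the factor 1/2.\<close>
  define d where "d = min e (min (e / (2 * C)) (1 / (2 * C * (real n + 1))))"
  have d: "0 < d" "d \<le> e" "C * d \<le> e / 2" "C * real n * d \<le> 1 / 2"
  proof -
    show "0 < d" using e C unfolding d_def by (simp add: pos_add_strict)
    show "d \<le> e" unfolding d_def by simp
    have "C * d \<le> C * (e / (2 * C))" using C unfolding d_def by (intro mult_left_mono) auto
    then show "C * d \<le> e / 2" using C by simp
    have "C * real n * d \<le> C * (real n + 1) * (1 / (2 * C * (real n + 1)))"
      using C e unfolding d_def by (intro mult_mono) auto
    also have "\<dots> = 1 / 2"
      using C by (simp add: field_simps add_nonneg_eq_0_iff)
    finally show "C * real n * d \<le> 1 / 2" .
  qed
  define B where "B = ball (complex_of_real t\<^sub>0) d"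
  have B: "open B" "convex B" "of_real t\<^sub>0 \<in> B" "B \<subseteq> ball (of_real t\<^sub>0) e"
    using d unfolding B_def by auto
  have B_real: "complex_of_real s \<in> B \<longleftrightarrow> \<bar>s - t\<^sub>0\<bar> < d" for s
    unfolding B_def by (simp add: dist_norm abs_minus_commute flip: of_real_diff)
  define prim where "prim h = (SOME P. P (of_real t\<^sub>0) = 0 \<and>
    (\<forall>\<tau>\<in>B. (P has_field_derivative h \<tau>) (at \<tau>)))" for h :: "complex \<Rightarrow> complex"
  have prim: "prim h (of_real t\<^sub>0) = 0 \<and> (\<forall>\<tau>\<in>B. (prim h has_field_derivative h \<tau>) (at \<tau>))"
    if h: "h holomorphic_on B" for h
  proof -
    obtain g where g: "\<And>x. x \<in> B \<Longrightarrow> (g has_field_derivative h x) (at x within B)"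
      using holomorphic_convex_primitive'[OF B(2,1) h] by blast
    have g': "(g has_field_derivative h \<tau>) (at \<tau>)" if "\<tau> \<in> B" for \<tau>
      using g[OF that] at_within_open[OF that B(1)] by simp
    have "((\<lambda>\<tau>. g \<tau> - g (of_real t\<^sub>0)) has_field_derivative h \<tau>) (at \<tau>)" if "\<tau> \<in> B" for \<tau>
      using DERIV_diff[OF g'[OF that] DERIV_const[of "g (of_real t\<^sub>0)"]] by simp
    then have "\<exists>P. P (of_real t\<^sub>0) = 0 \<and> (\<forall>\<tau>\<in>B. (P has_field_derivative h \<tau>) (at \<tau>))"
      by (intro exI[of _ "\<lambda>\<tau>. g \<tau> - g (of_real t\<^sub>0)"]) simp
    then show ?thesis unfolding prim_def by (rule someI_ex)
  qed
  define u where "u = rec_nat (\<lambda>i \<tau>. complex_of_real (x\<^sub>0 i))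
    (\<lambda>_ u i \<tau>. if i \<in> I then of_real (x\<^sub>0 i) + prim (\<lambda>\<sigma>. G i (\<lambda>j. u j \<sigma>) \<sigma>) \<tau> else 0)"
  define H where "H k i \<tau> = G i (\<lambda>j. u k j \<tau>) \<tau>" for k i \<tau>
  have u_0: "u 0 = (\<lambda>i \<tau>. of_real (x\<^sub>0 i))" unfolding u_def by simp
  have u_Suc: "u (Suc k) = (\<lambda>i \<tau>. if i \<in> I then of_real (x\<^sub>0 i) + prim (H k i) \<tau> else 0)" for k
    unfolding u_def H_def by simp
  have u_out: "u k i \<tau> = 0" if "i \<notin> I" for k i \<tau>
    using that x0 by (cases k) (auto simp: u_0 u_Suc coord_space_def)
  have near_imp_poly: "(\<lambda>j. w j \<tau>) \<in> polydisc n x\<^sub>0 e"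
    if "\<forall>i. \<forall>\<tau>\<in>B. cmod (w i \<tau> - of_real (x\<^sub>0 i)) \<le> e / 2" "\<tau> \<in> B" for w :: "nat \<Rightarrow> complex \<Rightarrow> complex" and \<tau>
    unfolding polydisc_def
  proof (clarify)
    fix j have "cmod (w j \<tau> - of_real (x\<^sub>0 j)) \<le> e / 2" using that by simp
    then show "cmod (w j \<tau> - of_real (x\<^sub>0 j)) < e" using e by linarith
  qed
  have hol: "H k i holomorphic_on B" if "i \<in> I" "\<forall>i. u k i holomorphic_on B"
    "\<forall>i. \<forall>\<tau>\<in>B. cmod (u k i \<tau> - of_real (x\<^sub>0 i)) \<le> e / 2" for k i
    unfolding H_def
  proof (rule complex_extension_holomorphic[OF G[OF that(1)] B(4)])
    show "u k j holomorphic_on B" for j using that(2) by simp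
    show "(\<lambda>j. u k j \<tau>) \<in> polydisc n x\<^sub>0 e" if "\<tau> \<in> B" for \<tau>
      by (rule near_imp_poly[OF _ that]) fact
  qed
  have inv: "(\<forall>i. u k i holomorphic_on B) \<and> (\<forall>i. \<forall>\<tau>\<in>B. cmod (u k i \<tau> - of_real (x\<^sub>0 i)) \<le> e / 2) \<and>
      (\<forall>i s. \<bar>s - t\<^sub>0\<bar> < d \<longrightarrow> u k i (of_real s) \<in> \<real>) \<and> (\<forall>i. u k i (of_real t\<^sub>0) = of_real (x\<^sub>0 i))" for k
  proof (induction k)
    case 0
    show ?case using e by (simp add: u_0)
  next
    case (Suc k)
    note u_hol = Suc.IH[THEN conjunct1] and u_near = Suc.IH[THEN conjunct2, THEN conjunct1]
      and u_real = Suc.IH[THEN conjunct2, THEN conjunct2, THEN conjunct1]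
    have holH: "H k i holomorphic_on B" if "i \<in> I" for i using hol[OF that u_hol u_near] .
    note P = prim[OF holH, THEN conjunct1] prim[OF holH, THEN conjunct2, rule_format]
    have realH: "H k i (of_real s) \<in> \<real>" if "i \<in> I" "\<bar>s - t\<^sub>0\<bar> < d" for i s
    proof -
      have "u k j (of_real s) = of_real (Re (u k j (of_real s)))" for j
        using u_real that(2) by simp
      then have eq: "(\<lambda>j. u k j (of_real s)) = (\<lambda>j. of_real (Re (u k j (of_real s))))" by (rule ext)
      have "\<bar>Re (u k j (of_real s)) - x\<^sub>0 j\<bar> < e" if "j < n" for j
      proof -
        have "\<bar>Re (u k j (of_real s)) - x\<^sub>0 j\<bar> = \<bar>Re (u k j (of_real s) - of_real (x\<^sub>0 j))\<bar>" by simp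
        also have "\<dots> \<le> cmod (u k j (of_real s) - of_real (x\<^sub>0 j))" by (rule abs_Re_le_cmod)
        also have "\<dots> \<le> e / 2" using u_near B_real \<open>\<bar>s - t\<^sub>0\<bar> < d\<close> by simp
        finally show ?thesis using e by linarith
      qed
      moreover have "\<bar>s - t\<^sub>0\<bar> < e" using that(2) d(2) by linarith
      ultimately have "H k i (of_real s) = of_real (f (\<lambda>j. Re (u k j (of_real s))) s i)"
        unfolding H_def eq by (rule complex_extension_real[OF G[OF that(1)]])
      then show ?thesis by simp
    qed
    have "u (Suc k) i holomorphic_on B" for i
    proof (cases "i \<in> I")
      case True
      have "prim (H k i) holomorphic_on B"
        using P(2)[OF True] B(1) holomorphic_on_open by blast
      then show ?thesis using True by (simp add: u_Suc holomorphic_on_add)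
    qed (simp add: u_Suc)
    moreover have "cmod (u (Suc k) i \<tau> - of_real (x\<^sub>0 i)) \<le> e / 2" if \<tau>: "\<tau> \<in> B" for i \<tau>
    proof (cases "i \<in> I")
      case True
      have "cmod (prim (H k i) \<tau> - 0) \<le> C * d"
      proof (rule primitive_bound[where c = "of_real t\<^sub>0" and P = "prim (H k i)" and h = "H k i" and k = "\<lambda>_. 0" and Q = "\<lambda>_. 0"])
        show "cmod (H k i \<sigma> - 0) \<le> C" if "\<sigma> \<in> ball (of_real t\<^sub>0) d" for \<sigma>
          using complex_extension_bound[OF G[OF True] near_imp_poly[OF u_near], of \<sigma> \<sigma>] that B(4)
          unfolding H_def B_def by auto
      qed (use P[OF True] \<tau> in \<open>auto simp: B_def\<close>)
      then show ?thesis using True d(3) by (simp add: u_Suc)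
    qed (use x0 e in \<open>simp add: u_Suc coord_space_def\<close>)
    moreover have "u (Suc k) i (of_real s) \<in> \<real>" if s: "\<bar>s - t\<^sub>0\<bar> < d" for i s
    proof (cases "i \<in> I")
      case True
      have "prim (H k i) (of_real s) \<in> \<real>"
        by (rule primitive_real_on_reals[where h = "H k i" and t = t\<^sub>0 and d = d])
          (use P[OF True] realH[OF True] s in \<open>auto simp: B_def\<close>)
      then show ?thesis using True by (simp add: u_Suc)
    qed (simp add: u_Suc)
    moreover have "u (Suc k) i (of_real t\<^sub>0) = of_real (x\<^sub>0 i)" for i
      using P(1) x0 by (simp add: u_Suc coord_space_def)
    ultimately show ?case by blast
  qed
  have inH: "H k i holomorphic_on B" if "i \<in> I" for k i
    using hol[OF that] inv by blast
  have near: "cmod (u k i \<tau> - of_real (x\<^sub>0 i)) \<le> e / 2" if "\<tau> \<in> B" for k i \<tau>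
    using inv that by blast
  have poly: "(\<lambda>j. u k j \<tau>) \<in> polydisc n x\<^sub>0 e" if "\<tau> \<in> B" for k \<tau>
    unfolding polydisc_def
  proof clarify
    fix j show "cmod (u k j \<tau> - of_real (x\<^sub>0 j)) < e" using near[OF that, of k j] e by linarith
  qed
  have deriv: "(u (Suc k) i has_field_derivative H k i \<tau>) (at \<tau>)" if "i \<in> I" "\<tau> \<in> B" for k i \<tau>
    using DERIV_add[OF DERIV_const[of "of_real (x\<^sub>0 i)"] prim[OF inH[OF that(1)], THEN conjunct2, rule_format, OF that(2)]] that(1)
    by (simp add: u_Suc)
  have contr: "cmod (u (Suc k) i \<tau> - u k i \<tau>) \<le> e * (1/2) ^ k" if "\<tau> \<in> B" for k i \<tau>
    using that
  proof (induction k arbitrary: i \<tau>)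
    case 0
    have "cmod (u (Suc 0) i \<tau> - u 0 i \<tau>) \<le> e / 2" using near[OF 0, of "Suc 0" i] by (simp add: u_0)
    then show ?case using e by simp
  next
    case (Suc k)
    show ?case
    proof (cases "i \<in> I")
      case True
      have "cmod (u (Suc (Suc k)) i \<tau> - u (Suc k) i \<tau>) \<le> (C * (real n * (e * (1/2) ^ k))) * d"
      proof (rule primitive_bound[where c = "of_real t\<^sub>0" and P = "u (Suc (Suc k)) i" and Q = "u (Suc k) i"
            and h = "H (Suc k) i" and k = "H k i"])
        show "u (Suc (Suc k)) i (of_real t\<^sub>0) = u (Suc k) i (of_real t\<^sub>0)"
          using inv by metis
        fix \<sigma> assume "\<sigma> \<in> ball (complex_of_real t\<^sub>0) d"
        then have \<sigma>: "\<sigma> \<in> B" unfolding B_def .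
        have "cmod (H (Suc k) i \<sigma> - H k i \<sigma>) \<le> C * (\<Sum>j<n. cmod (u (Suc k) j \<sigma> - u k j \<sigma>))"
          unfolding H_def using \<sigma> B(4)
          by (intro complex_extension_lipschitz[OF G[OF True]] poly) auto
        also have "\<dots> \<le> C * (\<Sum>j<n. e * (1/2) ^ k)"
          using C by (intro mult_left_mono sum_mono Suc.IH[OF \<sigma>]) auto
        finally show "cmod (H (Suc k) i \<sigma> - H k i \<sigma>) \<le> C * (real n * (e * (1/2) ^ k))" by simp
      qed (use deriv[OF True] Suc.prems in \<open>auto simp: B_def\<close>)
      also have "\<dots> = (C * real n * d) * (e * (1/2) ^ k)" by simp
      also have "\<dots> \<le> (1/2) * (e * (1/2) ^ k)"
        using d(4) e by (intro mult_right_mono) auto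
      finally show ?thesis by simp
    qed (use e in \<open>simp add: u_out\<close>)
  qed
  have "\<exists>U. uniform_limit B (\<lambda>k. u k i) U sequentially" for i
    using geometric_differences_uniform_limit[of B "\<lambda>k. u k i" e] contr by metis
  then obtain U where U: "\<And>i. uniform_limit B (\<lambda>k. u k i) (U i) sequentially" by metis
  have lim: "(\<lambda>k. u k i \<tau>) \<longlonglongrightarrow> U i \<tau>" if "\<tau> \<in> B" for i \<tau>
    using tendsto_uniform_limitI[OF U that] .
  have U_poly: "(\<lambda>j. U j \<tau>) \<in> polydisc n x\<^sub>0 e" if "\<tau> \<in> B" for \<tau>
    unfolding polydisc_def
  proof clarify
    fix j
    have "(\<lambda>k. cmod (u k j \<tau> - of_real (x\<^sub>0 j))) \<longlonglongrightarrow> cmod (U j \<tau> - of_real (x\<^sub>0 j))"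
      by (intro tendsto_intros lim that)
    then have "cmod (U j \<tau> - of_real (x\<^sub>0 j)) \<le> e / 2"
      by (rule LIMSEQ_le_const2) (use near that in blast)
    then show "cmod (U j \<tau> - of_real (x\<^sub>0 j)) < e" using e by linarith
  qed
  show ?thesis
  proof (rule that[of d U])
    show "(U i has_field_derivative G i (\<lambda>j. U j \<tau>) \<tau>) (at \<tau>)"
      if i: "i \<in> I" and "\<tau> \<in> ball (of_real t\<^sub>0) d" for i \<tau>
    proof -
      have \<tau>: "\<tau> \<in> B" using that(2) unfolding B_def .
      have "\<exists>g'. \<forall>x\<in>B. (U i has_field_derivative g' x) (at x) \<and> (\<lambda>k. H k i x) \<longlonglongrightarrow> g' x"
      proof (rule has_complex_derivative_uniform_sequence[OF B(1)])
        show "(u (Suc k) i has_field_derivative H k i x) (at x)" if "x \<in> B" for k x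
          using deriv[OF i that] .
        fix x assume "x \<in> B"
        then obtain r where r: "r > 0" "cball x r \<subseteq> B" using B(1) open_contains_cball by blast
        have "uniform_limit B (\<lambda>k. u (Suc k) i) (U i) sequentially"
          using filterlim_compose[OF U filterlim_Suc] .
        then show "\<exists>r>0. cball x r \<subseteq> B \<and> uniform_limit (cball x r) (\<lambda>k. u (Suc k) i) (U i) sequentially"
          using r uniform_limit_on_subset by blast
      qed
      then obtain g' where g': "(U i has_field_derivative g') (at \<tau>)" "(\<lambda>k. H k i \<tau>) \<longlonglongrightarrow> g'"
        using \<tau> by blast
      have "(\<lambda>k. H k i \<tau>) \<longlonglongrightarrow> G i (\<lambda>j. U j \<tau>) \<tau>"
      proof (rule LIM_zero_cancel, rule Lim_null_comparison)
        have "(\<lambda>k. C * (\<Sum>j<n. cmod (u k j \<tau> - U j \<tau>))) \<longlonglongrightarrow> C * (\<Sum>j<n. cmod (U j \<tau> - U j \<tau>))"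
          by (intro tendsto_intros lim \<tau>)
        then show "(\<lambda>k. C * (\<Sum>j<n. cmod (u k j \<tau> - U j \<tau>))) \<longlonglongrightarrow> 0" by simp
        have "cmod (H k i \<tau> - G i (\<lambda>j. U j \<tau>) \<tau>) \<le> C * (\<Sum>j<n. cmod (u k j \<tau> - U j \<tau>))" for k
          unfolding H_def using \<tau> B(4)
          by (intro complex_extension_lipschitz[OF G[OF i]] poly U_poly) auto
        then show "\<forall>\<^sub>F k in sequentially. cmod (H k i \<tau> - G i (\<lambda>j. U j \<tau>) \<tau>) \<le> C * (\<Sum>j<n. cmod (u k j \<tau> - U j \<tau>))"
          by simp
      qed
      then show ?thesis using g' LIMSEQ_unique by metis
    qed
    show "U i \<tau> = 0" if "i \<notin> I" "\<tau> \<in> ball (of_real t\<^sub>0) d" for i \<tau>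
      using lim[of \<tau> i] that u_out[OF that(1)] unfolding B_def by (simp add: LIMSEQ_const_iff)
    show "U i (of_real t\<^sub>0) = of_real (x\<^sub>0 i)" for i
      using lim[OF B(3), of i] inv by (simp add: LIMSEQ_const_iff)
    show "(\<lambda>j. U j \<tau>) \<in> polydisc n x\<^sub>0 e" if "\<tau> \<in> ball (of_real t\<^sub>0) d" for \<tau>
      using U_poly that unfolding B_def .
    show "U i (of_real s) \<in> \<real>" if "\<bar>s - t\<^sub>0\<bar> < d" for i s
    proof (rule closed_sequentially[OF closed_complex_Reals])
      show "u k i (of_real s) \<in> \<real>" for k using inv that by blast
      show "(\<lambda>k. u k i (of_real s)) \<longlonglongrightarrow> U i (of_real s)" using lim that B_real by blast
    qed
  qed (use d in auto)
qed

section \<open>Locally analytic functions on an interval\<close>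

text \<open>
  The interior of the zero set is closed in \<open>K\<close>: if it comes close to a point, the holomorphic extension
  around that point has a non-isolated zero.
\<close>

lemma locally_analytic_identity:
  assumes K: "open K" "is_interval K" and g: "\<And>s. s \<in> K \<Longrightarrow> extends_holomorphically g s"
    and W: "open W" "W \<noteq> {}" "W \<subseteq> K" "\<And>s. s \<in> W \<Longrightarrow> g s = 0" and s: "s \<in> K"
  shows "g s = 0"
proof -
  define Z where "Z = interior {s \<in> K. g s = 0}"
  have "open (K - Z)"
    unfolding open_contains_ball
  proof
    fix s assume s: "s \<in> K - Z"
    then obtain e U where e: "0 < e" and U: "U holomorphic_on ball (of_real s) e"
      "\<And>r. \<bar>r - s\<bar> < e \<Longrightarrow> U (of_real r) = of_real (g r)"
      using g[of s] extends_holomorphicallyE by blast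
    obtain b where b: "0 < b" "ball s b \<subseteq> K" using s K(1) open_contains_ball by blast
    have "q \<notin> Z" if q: "q \<in> ball s (min b e)" for q
    proof
      assume "q \<in> Z"
      then obtain a where a: "0 < a" "ball q a \<subseteq> {s \<in> K. g s = 0}"
        unfolding Z_def mem_interior by blast
      define c where "c = min a (e - \<bar>q - s\<bar>)"
      have c: "0 < c" using a(1) q unfolding c_def by (simp add: dist_real_def abs_minus_commute)
      have near: "\<bar>r - q\<bar> < c \<Longrightarrow> \<bar>r - s\<bar> < e \<and> g r = 0" for r
        using a(2) unfolding c_def by (auto simp: subset_iff dist_real_def abs_minus_commute)
      let ?V = "complex_of_real ` {r. \<bar>r - q\<bar> < c}"
      have "of_real q islimpt ?V"
        unfolding islimpt_approachable
      proof (intro allI impI)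
        fix \<epsilon> :: real assume \<epsilon>: "0 < \<epsilon>"
        define r where "r = q + min c \<epsilon> / 2"
        have "\<bar>r - q\<bar> < c" "r \<noteq> q" "\<bar>r - q\<bar> < \<epsilon>" using c \<epsilon> unfolding r_def by auto
        then show "\<exists>x'\<in>?V. x' \<noteq> of_real q \<and> dist x' (complex_of_real q) < \<epsilon>"
          by (intro bexI[of _ "of_real r"]) (auto simp: dist_real_def)
      qed
      have ball: "complex_of_real r \<in> ball (of_real s) e \<longleftrightarrow> \<bar>r - s\<bar> < e" for r
        by (simp add: dist_real_def abs_minus_commute)
      have zero: "U w = 0" if "w \<in> ball (of_real s) e" for w
      proof (rule analytic_continuation[OF U(1), of ?V "of_real q"])
        show "?V \<subseteq> ball (of_real s) e" using near ball by blast
        show "complex_of_real q \<in> ball (of_real s) e" using near[of q] ball c by simp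
        show "U z = 0" if "z \<in> ?V" for z using that near U(2) by auto
      qed (use that \<open>of_real q islimpt ?V\<close> in auto)
      have "g r = 0" if "\<bar>r - s\<bar> < e" for r
        using zero[of "of_real r"] ball U(2)[OF that] that by simp
      then have "ball s (min b e) \<subseteq> {s \<in> K. g s = 0}"
        using b by (auto simp: subset_iff dist_real_def abs_minus_commute)
      then have "s \<in> Z" unfolding Z_def mem_interior using b(1) e by (intro exI[of _ "min b e"]) auto
      then show False using s by blast
    qed
    then have "ball s (min b e) \<subseteq> K - Z" using b(2) by auto
    then show "\<exists>e>0. ball s e \<subseteq> K - Z" using b(1) e by (intro exI[of _ "min b e"]) auto
  qed
  moreover have "open Z" unfolding Z_def by simp
  moreover have "Z \<subseteq> K" unfolding Z_def using interior_subset by blast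
  moreover have "Z \<noteq> {}"
  proof -
    have "W \<subseteq> Z" unfolding Z_def using W by (intro interior_maximal) auto
    then show ?thesis using W(2) by blast
  qed
  moreover have "connected K" using K(2) by (simp add: is_interval_connected_1)
  ultimately have "K - Z = {}"
    using connectedD[of K Z "K - Z"] by blast
  then show ?thesis using s interior_subset[of "{s \<in> K. g s = 0}"] unfolding Z_def by blast
qed

text \<open>
  By the identity principle no nonempty open set can consist of zeros of one of the functions, so the
  open set on which the functions treated so far are nonzero shrinks to a nonempty open set.
\<close>

lemma locally_analytic_common_nonzero:
  fixes g :: "'i \<Rightarrow> real \<Rightarrow> real"
  assumes K: "open K" "is_interval K" "K \<noteq> {}" and "finite I"
    and "\<And>i. i \<in> I \<Longrightarrow> continuous_on K (g i)"
    and "\<And>i s. i \<in> I \<Longrightarrow> s \<in> K \<Longrightarrow> extends_holomorphically (g i) s"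
    and "\<And>i. i \<in> I \<Longrightarrow> \<exists>s\<in>K. g i s \<noteq> 0"
  obtains W where "open W" "W \<noteq> {}" "W \<subseteq> K" "\<And>i s. i \<in> I \<Longrightarrow> s \<in> W \<Longrightarrow> g i s \<noteq> 0"
proof -
  have "\<exists>W. open W \<and> W \<noteq> {} \<and> W \<subseteq> K \<and> (\<forall>i\<in>I. \<forall>s\<in>W. g i s \<noteq> 0)"
    using assms(4-)
  proof (induction I rule: finite_induct)
    case empty
    then show ?case using K by blast
  next
    case (insert i I)
    then obtain W where W: "open W" "W \<noteq> {}" "W \<subseteq> K" "\<forall>i\<in>I. \<forall>s\<in>W. g i s \<noteq> 0" by auto
    define V where "V = {s \<in> W. g i s \<noteq> 0}"
    have "V \<noteq> {}"
    proof
      assume "V = {}"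
      then have "g i s = 0" if "s \<in> K" for s
        using locally_analytic_identity[OF K(1,2) insert.prems(2)[of i] W(1-3) _ that] unfolding V_def by blast
      then show False using insert.prems(3)[of i] by simp
    qed
    moreover have "open V"
    proof -
      have "continuous_on W (g i)" using insert.prems(1) W(3) continuous_on_subset by blast
      then have "open (W \<inter> g i -` (- {0}))"
        using continuous_on_open_vimage[OF W(1)] open_Compl[OF closed_singleton] by (metis Int_commute)
      moreover have "V = W \<inter> g i -` (- {0})" unfolding V_def by auto
      ultimately show ?thesis by simp
    qed
    ultimately show ?case using W unfolding V_def by (intro exI[of _ V]) (auto simp: V_def)
  qed
  then show ?thesis using that by blast
qed

section \<open>Equations with complexifiable right-hand sides\<close>

text \<open>
  The ambient dimension \<open>n\<close> stays fixed while \<open>I\<close> may be smaller, since the right-hand side of a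
  reduced equation is still a function of all \<open>n\<close> coordinates.
\<close>

locale complexifiable_ode =
  fixes n :: nat and I :: "nat set" and f :: rhs and A :: "(rvec \<times> real) set"
  assumes indeterminates: "I \<subseteq> {..<n}"
    and open_domain: "openin (top_of_set (coord_space I \<times> UNIV)) A"
    and complexifiable_rhs: "\<And>x t i. (x, t) \<in> A \<Longrightarrow> i \<in> I \<Longrightarrow> complexifiable n x t (\<lambda>x t. f x t i)"
begin

lemma finite_I: "finite I"
  using indeterminates finite_subset by blast

lemma common_extension:
  assumes "(x\<^sub>0, t\<^sub>0) \<in> A"
  obtains e C G where "0 < e" "1 \<le> C"
    "\<And>i. i \<in> I \<Longrightarrow> complex_extension n x\<^sub>0 t\<^sub>0 e C (\<lambda>x t. f x t i) (G i)"
    "coord_ball I x\<^sub>0 e \<times> {t\<^sub>0 - e<..<t\<^sub>0 + e} \<subseteq> A"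
proof -
  obtain a C G where a: "0 < a" "1 \<le> C"
    "\<And>i. i \<in> I \<Longrightarrow> complex_extension n x\<^sub>0 t\<^sub>0 a C (\<lambda>x t. f x t i) (G i)"
    using complexifiable_family[of I n x\<^sub>0 t\<^sub>0 "\<lambda>i x t. f x t i"] complexifiable_rhs[OF assms] finite_I by blast
  obtain b where b: "0 < b" "coord_ball I x\<^sub>0 b \<times> {t\<^sub>0 - b<..<t\<^sub>0 + b} \<subseteq> A"
    using open_domain assms unfolding openin_coord_space_time_iff[OF finite_I] by fast
  show ?thesis
  proof (rule that[of "min a b" C G])
    show "complex_extension n x\<^sub>0 t\<^sub>0 (min a b) C (\<lambda>x t. f x t i) (G i)" if "i \<in> I" for i
      by (rule complex_extension_mono[OF a(3)[OF that]]) auto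
    have "coord_ball I x\<^sub>0 (min a b) \<subseteq> coord_ball I x\<^sub>0 b" by (rule coord_ball_mono) simp
    moreover have "{t\<^sub>0 - min a b<..<t\<^sub>0 + min a b} \<subseteq> {t\<^sub>0 - b<..<t\<^sub>0 + b}" by auto
    ultimately show "coord_ball I x\<^sub>0 (min a b) \<times> {t\<^sub>0 - min a b<..<t\<^sub>0 + min a b} \<subseteq> A"
      using b(2) by blast
  qed (use a b in auto)
qed

sublocale lipschitz_ode I f A
proof
  show "finite I" by (rule finite_I)
  show sub: "A \<subseteq> coord_space I \<times> UNIV"
    using open_domain unfolding openin_coord_space_time_iff[OF finite_I] by blast
  fix x\<^sub>0 t\<^sub>0 assume xt: "(x\<^sub>0, t\<^sub>0) \<in> A"
  obtain e C G where e: "0 < e" "1 \<le> C" and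
    G: "\<And>i. i \<in> I \<Longrightarrow> complex_extension n x\<^sub>0 t\<^sub>0 e C (\<lambda>x t. f x t i) (G i)"
    using common_extension[OF xt] by metis
  have x0: "x\<^sub>0 \<in> coord_space I" using xt sub by blast
  have close: "\<bar>x j - x\<^sub>0 j\<bar> < e" if "x \<in> coord_ball I x\<^sub>0 e" for x j
    using that x0 e(1) unfolding coord_ball_def coord_space_def by (cases "j \<in> I") auto
  have poly: "(\<lambda>j. of_real (x j)) \<in> polydisc n x\<^sub>0 e" if "x \<in> coord_ball I x\<^sub>0 e" for x
    unfolding polydisc_def using close[OF that] by (simp flip: of_real_diff)
  have "\<bar>f x t i - f y t i\<bar> \<le> C * (\<Sum>j\<in>I. \<bar>x j - y j\<bar>)"
    if x: "x \<in> coord_ball I x\<^sub>0 e" and y: "y \<in> coord_ball I x\<^sub>0 e" and t: "t \<in> {t\<^sub>0-e<..<t\<^sub>0+e}" and i: "i \<in> I"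
    for x y t i
  proof -
    have t': "\<bar>t - t\<^sub>0\<bar> < e" using t by auto
    have "\<bar>f x t i - f y t i\<bar> = cmod (of_real (f x t i) - of_real (f y t i))"
      by (simp flip: of_real_diff)
    also have "\<dots> = cmod (G i (\<lambda>j. of_real (x j)) (of_real t) - G i (\<lambda>j. of_real (y j)) (of_real t))"
      using complex_extension_real[OF G[OF i] close[OF x] t'] complex_extension_real[OF G[OF i] close[OF y] t']
      by simp
    also have "\<dots> \<le> C * (\<Sum>j<n. cmod (of_real (x j) - of_real (y j)))"
      using t' by (intro complex_extension_lipschitz[OF G[OF i]] poly x y) (simp add: dist_real_def abs_minus_commute)
    also have "(\<Sum>j<n. cmod (of_real (x j) - of_real (y j))) = (\<Sum>j<n. \<bar>x j - y j\<bar>)"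
      by (simp flip: of_real_diff)
    also have "\<dots> = (\<Sum>j\<in>I. \<bar>x j - y j\<bar>)"
      using x y indeterminates unfolding coord_ball_def coord_space_def
      by (intro sum.mono_neutral_right) auto
    finally show ?thesis .
  qed
  then show "\<exists>e>0. \<exists>L. \<forall>x\<in>coord_ball I x\<^sub>0 e. \<forall>y\<in>coord_ball I x\<^sub>0 e.
      \<forall>t\<in>{t\<^sub>0-e<..<t\<^sub>0+e}. \<forall>i\<in>I. \<bar>f x t i - f y t i\<bar> \<le> L * (\<Sum>j\<in>I. \<bar>x j - y j\<bar>)"
    using e(1) by (intro exI[of _ e] conjI exI[of _ C] ballI)
qed

lemma local_analytic_solution:
  assumes xt: "(x\<^sub>0, t\<^sub>0) \<in> A"
  obtains d u where "0 < d" "ode_solution I f A u {t\<^sub>0 - d<..<t\<^sub>0 + d}" "u t\<^sub>0 = x\<^sub>0"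
    "\<And>i. i \<in> I \<Longrightarrow> extends_holomorphically (\<lambda>s. u s i) t\<^sub>0"
proof -
  obtain e C G where e: "0 < e" "1 \<le> C" and
    G: "\<And>i. i \<in> I \<Longrightarrow> complex_extension n x\<^sub>0 t\<^sub>0 e C (\<lambda>x t. f x t i) (G i)" and
    A: "coord_ball I x\<^sub>0 e \<times> {t\<^sub>0 - e<..<t\<^sub>0 + e} \<subseteq> A"
    using common_extension[OF xt] by blast
  have x0: "x\<^sub>0 \<in> coord_space I" using xt domain_in_space by blast
  obtain d U where d: "0 < d" "d \<le> e" and
    U': "\<And>i \<tau>. i \<in> I \<Longrightarrow> \<tau> \<in> ball (of_real t\<^sub>0) d \<Longrightarrow> (U i has_field_derivative G i (\<lambda>j. U j \<tau>) \<tau>) (at \<tau>)" and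
    U: "\<And>i \<tau>. i \<notin> I \<Longrightarrow> \<tau> \<in> ball (of_real t\<^sub>0) d \<Longrightarrow> U i \<tau> = 0"
    "\<And>i. U i (of_real t\<^sub>0) = of_real (x\<^sub>0 i)"
    "\<And>\<tau>. \<tau> \<in> ball (of_real t\<^sub>0) d \<Longrightarrow> (\<lambda>j. U j \<tau>) \<in> polydisc n x\<^sub>0 e"
    "\<And>i s. \<bar>s - t\<^sub>0\<bar> < d \<Longrightarrow> U i (of_real s) \<in> \<real>"
    using holomorphic_solution_exists[where f = f and G = G, OF indeterminates x0 e G] by blast
  define u where "u s = (\<lambda>i. Re (U i (of_real s)))" for s
  have ball: "complex_of_real s \<in> ball (of_real t\<^sub>0) d \<longleftrightarrow> \<bar>s - t\<^sub>0\<bar> < d" for s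
    by (simp add: dist_real_def abs_minus_commute)
  have u: "U i (of_real s) = of_real (u s i)" if "\<bar>s - t\<^sub>0\<bar> < d" for i s
    using U(4)[OF that] unfolding u_def by simp
  have near: "\<bar>u s j - x\<^sub>0 j\<bar> < e" if "\<bar>s - t\<^sub>0\<bar> < d" "j < n" for s j
  proof -
    have "cmod (of_real (u s j) - of_real (x\<^sub>0 j)) < e"
      using U(3)[of "of_real s"] ball that u[OF that(1)] unfolding polydisc_def by simp
    then show ?thesis by (simp flip: of_real_diff)
  qed
  show ?thesis
  proof (rule that[of d u])
    show "u t\<^sub>0 = x\<^sub>0" using U(2) unfolding u_def by simp
    show "extends_holomorphically (\<lambda>s. u s i) t\<^sub>0" if "i \<in> I" for i
    proof (rule extends_holomorphicallyI[OF d(1)])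
      show "U i holomorphic_on ball (of_real t\<^sub>0) d"
        using U'[OF that] holomorphic_on_open[OF open_ball] by blast
    qed (use u in auto)
    show "ode_solution I f A u {t\<^sub>0 - d<..<t\<^sub>0 + d}"
      unfolding ode_solution_def
    proof (intro conjI ballI)
      fix s assume "s \<in> {t\<^sub>0 - d<..<t\<^sub>0 + d}"
      then have s: "\<bar>s - t\<^sub>0\<bar> < d" by auto
      have "u s \<in> coord_ball I x\<^sub>0 e"
        using near[OF s] indeterminates U(1)[of _ "of_real s"] ball s
        unfolding coord_ball_def coord_space_def by (auto simp: u_def)
      moreover have "s \<in> {t\<^sub>0 - e<..<t\<^sub>0 + e}" using s d(2) by auto
      ultimately show "(u s, s) \<in> A" using A by blast
      fix i assume i: "i \<in> I"
      have "G i (\<lambda>j. U j (of_real s)) (of_real s) = of_real (f (u s) s i)"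
        unfolding u[OF s] using s d(2) by (intro complex_extension_real[OF G[OF i]] near) auto
      then have "(U i has_field_derivative of_real (f (u s) s i)) (at (of_real s))"
        using U'[OF i, of "of_real s"] ball s by simp
      from has_real_derivative_along_reals(1)[OF this]
      show "((\<lambda>r. u r i) has_real_derivative f (u s) s i) (at s)" unfolding u_def by simp
    qed (auto simp: is_interval_1)
  qed (rule d(1))
qed

lemma in_max_interval: "(x, t) \<in> A \<Longrightarrow> t \<in> max_interval I f A x t"
proof -
  assume "(x, t) \<in> A"
  then obtain d u where d: "0 < d" and u: "ode_solution I f A u {t - d<..<t + d}" "u t = x"
    by (rule local_analytic_solution) blast
  have "t \<in> {t - d<..<t + d}" using d by simp
  then show ?thesis using subset_max_interval[OF u(1) _ u(2)] by blast
qed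

lemma max_solution_analytic:
  assumes s: "s \<in> max_interval I f A x t" and i: "i \<in> I"
  shows "extends_holomorphically (\<lambda>r. max_solution I f A x t r i) s"
proof -
  define y where "y = max_solution I f A x t s"
  have "(y, s) \<in> A" unfolding y_def using ode_solution_in[OF max_solution_is_solution s] .
  then obtain d u where d: "0 < d" and u: "ode_solution I f A u {s - d<..<s + d}" "u s = y"
    "extends_holomorphically (\<lambda>r. u r i) s"
    using local_analytic_solution i by blast
  have eq: "max_solution I f A x t r = u r" if "\<bar>r - s\<bar> < d" for r
  proof -
    have r: "r \<in> {s - d<..<s + d}" "s \<in> {s - d<..<s + d}" using that d by auto
    have "{s - d<..<s + d} \<subseteq> max_interval I f A y s"
      using subset_max_interval[OF u(1) r(2) u(2)] .
    then have "r \<in> max_interval I f A x t"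
      using r(1) max_solution_restart(1)[OF s y_def] by blast
    then show ?thesis
      using max_solution_restart(2)[OF s y_def] max_solution_eq[OF u(1) r(2) u(2) r(1)] by simp
  qed
  obtain e g where e: "0 < e" and g: "g holomorphic_on ball (of_real s) e"
    "\<And>r. \<bar>r - s\<bar> < e \<Longrightarrow> g (of_real r) = of_real (u r i)"
    using u(3) by (rule extends_holomorphicallyE) blast
  show ?thesis
  proof (rule extends_holomorphicallyI)
    show "0 < min d e" using d e by simp
    show "g holomorphic_on ball (of_real s) (min d e)"
      using g(1) by (rule holomorphic_on_subset) auto
    show "g (of_real r) = of_real (max_solution I f A x t r i)" if "\<bar>r - s\<bar> < min d e" for r
      using g(2)[of r] eq[of r] that by simp
  qed
qed

end

section \<open>Real powers\<close>

lemma reduced_fraction_unique: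
  assumes "reduced_fraction p a b" "reduced_fraction p a' b'"
  shows "a = a'" "b = b'"
proof -
  have b: "0 < b" "0 < b'" and cop: "coprime a (int b)" "coprime a' (int b')"
    and "real_of_int a / real b = real_of_int a' / real b'"
    using assms unfolding reduced_fraction_def by auto
  then have "real_of_int (a * int b') = real_of_int (a' * int b)"
    by (simp add: field_simps)
  then have eq: "a * int b' = a' * int b" by linarith
  have "int b dvd a * int b'" "int b' dvd a' * int b" unfolding eq by (simp, simp flip: eq)
  then have "int b dvd int b'" "int b' dvd int b"
    using cop by (simp_all add: coprime_commute coprime_dvd_mult_right_iff)
  then show "b = b'" by (simp add: dvd_antisym)
  then show "a = a'" using eq b by simp
qed

lemma rpow_negative:
  assumes "z < 0" "reduced_fraction p a b" "odd b"
  shows "rpow z p = root b z powi a"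
proof (cases "p = 0")
  case True
  then have "a = 0" using assms(2) unfolding reduced_fraction_def by auto
  then show ?thesis using True by (simp add: rpow_def)
next
  case False
  have "(THE y. \<exists>a b. reduced_fraction p a b \<and> odd b \<and> y = root b z powi a) = root b z powi a"
    using assms reduced_fraction_unique by (intro the_equality) blast+
  then show ?thesis using False assms(1) by (simp add: rpow_def)
qed

lemma rpow_positive: "0 < z \<Longrightarrow> rpow z p = z powr p"
  by (simp add: rpow_def)

text \<open>On the negative axis a power with odd denominator is the power of the absolute value up to a
  sign that depends on the exponent only.\<close>

lemma rpow_negative_powr:
  assumes "reduced_fraction p a b" "odd b"
  obtains c where "c \<noteq> 0" "\<And>z. z < 0 \<Longrightarrow> rpow z p = c * (-z) powr p"
proof (rule that[of "(-1) powi a"])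
  show "(-1::real) powi a \<noteq> 0" by simp
  fix z :: real assume z: "z < 0"
  have b: "0 < b" and p: "p = real_of_int a / real b"
    using assms(1) unfolding reduced_fraction_def by auto
  have "root b z = (-1) * (-z) powr (1 / real b)"
    using z b real_root_minus[of b "-z"] root_powr_inverse[of b "-z"] by simp
  then have "root b z powi a = (-1) powi a * ((-z) powr (1 / real b)) powi a"
    by (simp only: power_int_mult_distrib)
  also have "((-z) powr (1 / real b)) powi a = ((-z) powr (1 / real b)) powr real_of_int a"
    using z by (intro powr_real_of_int'[symmetric]) auto
  also have "\<dots> = (-z) powr p" by (simp add: powr_powr p)
  finally show "rpow z p = (-1) powi a * (-z) powr p"
    using rpow_negative[OF z assms] by simp
qed

lemma rpow_of_nat: "rpow z (real k) = z ^ k"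
proof -
  consider "z > 0" | "z = 0" | "z < 0" by linarith
  then show ?thesis
  proof cases
    case 3
    have "reduced_fraction (real k) (int k) 1" unfolding reduced_fraction_def by simp
    from rpow_negative[OF 3 this] show ?thesis by simp
  qed (auto simp: rpow_def powr_realpow)
qed

text \<open>
  The pairs of base and exponent that may occur at points of the domain of a sigma-pi equation; for
  them the power extends holomorphically. At base 0 the definedness of the power
  only asks for a nonnegative exponent, but smoothness asks for a natural one.
\<close>

definition rpow_regular :: "real \<Rightarrow> real \<Rightarrow> bool" where
  "rpow_regular z p \<longleftrightarrow> (z = 0 \<and> p \<in> \<nat>) \<or> (z \<noteq> 0 \<and> rpow_defined z p)"

lemma rpow_nonzero_cases:
  assumes "z \<noteq> 0" "rpow_defined z p"
  obtains "z > 0" | a b where "z < 0" "reduced_fraction p a b" "odd b"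
proof -
  have "reduced_fraction 0 0 1" unfolding reduced_fraction_def by simp
  moreover have "odd (1::nat)" by simp
  ultimately show ?thesis using assms that unfolding rpow_defined_def by (metis not_less_iff_gr_or_eq)
qed

lemma rpow_nonzero:
  assumes "z \<noteq> 0" "rpow_defined z p"
  shows "rpow z p \<noteq> 0"
  using assms
proof (cases rule: rpow_nonzero_cases)
  case (2 a b)
  obtain c where "c \<noteq> 0" "\<And>z. z < 0 \<Longrightarrow> rpow z p = c * (-z) powr p"
    using rpow_negative_powr[OF 2(2,3)] by blast
  then show ?thesis using 2(1) by simp
qed (simp add: rpow_positive)

lemma DERIV_rpow:
  assumes "z \<noteq> 0" "rpow_defined z p"
  shows "((\<lambda>r. rpow r p) has_real_derivative p * rpow z p / z) (at z)"
  using assms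
proof (cases rule: rpow_nonzero_cases)
  case 1
  have "((\<lambda>r. r powr p) has_real_derivative p * z powr (p - 1)) (at z)"
    by (rule has_real_derivative_powr[OF 1])
  moreover have "p * z powr (p - 1) = p * rpow z p / z"
    using 1 by (simp add: rpow_positive powr_diff)
  ultimately have "((\<lambda>r. r powr p) has_real_derivative p * rpow z p / z) (at z)" by simp
  then show ?thesis
    by (rule has_field_derivative_transform_within_open[where S = "{0<..}"]) (use 1 in \<open>auto simp: rpow_positive\<close>)
next
  case (2 a b)
  obtain c where c: "\<And>z. z < 0 \<Longrightarrow> rpow z p = c * (-z) powr p"
    using rpow_negative_powr[OF 2(2,3)] by blast
  have "((\<lambda>r. (-r) powr p) has_real_derivative p * (-z) powr (p - 1) * (-1)) (at z)"
    using 2(1) by (intro DERIV_chain2[where f = "\<lambda>w. w powr p"] has_real_derivative_powr derivative_eq_intros) auto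
  from DERIV_cmult[OF this, of c]
  have "((\<lambda>r. c * (-r) powr p) has_real_derivative c * (p * (-z) powr (p - 1) * (-1))) (at z)" .
  moreover have "c * (p * (-z) powr (p - 1) * (-1)) = p * rpow z p / z"
    using 2(1) by (simp add: c powr_diff)
  ultimately have "((\<lambda>r. c * (-r) powr p) has_real_derivative p * rpow z p / z) (at z)" by simp
  then show ?thesis
    by (rule has_field_derivative_transform_within_open[where S = "{..<0}"]) (use 2(1) c in auto)
qed

lemma powr_holomorphic_right_half_plane:
  assumes "0 < x"
  shows "(\<lambda>w. w powr of_real p) holomorphic_on ball (complex_of_real x) x"
proof -
  have "w \<notin> \<real>\<^sub>\<le>\<^sub>0" if "w \<in> ball (complex_of_real x) x" for w
  proof -
    have "x - Re w \<le> cmod (of_real x - w)" using complex_Re_le_cmod[of "of_real x - w"] by simp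
    then have "Re w > 0" using that by (simp add: dist_norm)
    then show ?thesis by (auto simp: complex_nonpos_Reals_iff)
  qed
  then have "((\<lambda>w. w powr of_real p) has_field_derivative of_real p * w powr (of_real p - 1)) (at w)"
    if "w \<in> ball (complex_of_real x) x" for w
    using has_field_derivative_powr that by blast
  then show ?thesis using holomorphic_on_open[OF open_ball] by blast
qed

lemma rpow_extends_holomorphically:
  assumes "rpow_regular z p"
  shows "extends_holomorphically (\<lambda>r. rpow r p) z"
proof -
  consider (zero) "z = 0" "p \<in> \<nat>" | (nonzero) "z \<noteq> 0" "rpow_defined z p"
    using assms unfolding rpow_regular_def by blast
  then show ?thesis
  proof cases
    case zero
    then obtain k where p: "p = real k" by (auto elim: Nats_cases)
    show ?thesis unfolding p rpow_of_nat
      by (rule extends_holomorphicallyI[of 1 "\<lambda>w. w ^ k"]) (auto intro: holomorphic_intros)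
  next
    case nonzero
    then show ?thesis
    proof (cases rule: rpow_nonzero_cases)
      case 1
      show ?thesis
      proof (rule extends_holomorphicallyI[OF 1 powr_holomorphic_right_half_plane[OF 1]])
        fix r assume "\<bar>r - z\<bar> < z"
        then have "0 < r" by linarith
        then show "complex_of_real r powr of_real p = of_real (rpow r p)"
          by (simp add: rpow_positive powr_of_real)
      qed
    next
      case (2 a b)
      obtain c where c: "\<And>z. z < 0 \<Longrightarrow> rpow z p = c * (-z) powr p"
        using rpow_negative_powr[OF 2(2,3)] by blast
      show ?thesis
      proof (rule extends_holomorphicallyI[of "-z" "\<lambda>w. of_real c * (-w) powr of_real p"])
        have "(\<lambda>w. (-w) powr of_real p) holomorphic_on ball (of_real z) (-z)"
        proof (rule holomorphic_on_compose_gen[of uminus _ "\<lambda>w. w powr of_real p", unfolded o_def])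
          show "(\<lambda>w. w powr complex_of_real p) holomorphic_on ball (of_real (-z)) (-z)"
            using 2(1) by (intro powr_holomorphic_right_half_plane) simp
          show "uminus ` ball (complex_of_real z) (-z) \<subseteq> ball (of_real (-z)) (-z)"
            by (auto simp: dist_norm norm_minus_commute)
        qed (auto intro: holomorphic_intros)
        then show "(\<lambda>w. of_real c * (-w) powr of_real p) holomorphic_on ball (of_real z) (-z)"
          by (intro holomorphic_on_mult) auto
        fix r assume "\<bar>r - z\<bar> < - z"
        then have r: "r < 0" by linarith
        have "(- complex_of_real r) powr of_real p = of_real ((-r) powr p)"
          using powr_of_real[of "-r" p] r by simp
        then show "of_real c * (- complex_of_real r) powr of_real p = of_real (rpow r p)"
          using r c by simp
      qed (use 2(1) in simp)
    qed
  qed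
qed

section \<open>The domain of a sigma-pi equation\<close>

text \<open>
  Differentiating \<open>k\<close> times in the direction \<open>j\<close> along a ray: the resulting function is continuous on
  all of \<open>U\<close>, in particular at the end of the ray, where the power on the right may be unbounded.
\<close>

lemma Ck_on_restricted_to_power:
  assumes "Ck_on I k g U" "j \<in> I"
    and "\<And>r. r \<in> {0<..<e} \<Longrightarrow> y(j := r) \<in> U" "\<And>r. r \<in> {0<..<e} \<Longrightarrow> g (y(j := r)) = c * r powr q"
  obtains h where "continuous_on U h"
    "\<And>r. r \<in> {0<..<e} \<Longrightarrow> h (y(j := r)) = c * (\<Prod>i<k. q - real i) * r powr (q - real k)"
proof -
  have "\<exists>h. continuous_on U h \<and>
    (\<forall>r\<in>{0<..<e}. h (y(j := r)) = c * (\<Prod>i<k. q - real i) * r powr (q - real k))"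
    using assms(1,4)
  proof (induction k arbitrary: g c q)
    case 0
    then show ?case by (intro exI[of _ g]) simp
  next
    case (Suc k)
    obtain h where h: "\<forall>x\<in>U. ((\<lambda>r. g (x(j := r))) has_real_derivative h x) (at (x j))"
      "Ck_on I k h U"
      using Suc.prems(1) assms(2) unfolding Ck_on.simps by blast
    have "h (y(j := r)) = (c * q) * r powr (q - 1)" if r: "r \<in> {0<..<e}" for r
    proof -
      have 1: "((\<lambda>s. g (y(j := s))) has_real_derivative h (y(j := r))) (at r)"
        using bspec[OF h(1) assms(3)[OF r]] by simp
      have "((\<lambda>s. c * s powr q) has_real_derivative c * (q * r powr (q - 1))) (at r)"
        using r by (intro DERIV_cmult has_real_derivative_powr) simp
      then have "((\<lambda>s. g (y(j := s))) has_real_derivative c * (q * r powr (q - 1))) (at r)"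
        by (rule has_field_derivative_transform_within_open[where S = "{0<..<e}"])
          (use r in \<open>simp_all add: Suc.prems(2)\<close>)
      from DERIV_unique[OF 1 this] show ?thesis by simp
    qed
    from Suc.IH[OF h(2) this] obtain h' where h': "continuous_on U h'"
      "\<And>r. r \<in> {0<..<e} \<Longrightarrow> h' (y(j := r)) = (c * q) * (\<Prod>i<k. (q - 1) - real i) * r powr ((q - 1) - real k)"
      by blast
    have eq: "(\<Prod>i<Suc k. q - real i) = q * (\<Prod>i<k. (q - 1) - real i)"
      unfolding prod.lessThan_Suc_shift by (simp add: algebra_simps)
    have ex: "(q - 1) - real k = q - real (Suc k)" by simp
    show ?case
    proof (intro exI[of _ h'] conjI ballI)
      show "h' (y(j := r)) = c * (\<Prod>i<Suc k. q - real i) * r powr (q - real (Suc k))"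
        if "r \<in> {0<..<e}" for r
        using h'(2)[OF that] unfolding ex eq by (simp only: mult.assoc)
    qed (rule h'(1))
  qed
  then show ?thesis using that by blast
qed

text \<open>
  If \<open>q\<close> is not a natural number, then no factor \<open>q - i\<close> vanishes. So for \<open>k > q\<close> the \<open>k\<close>-th derivative
  is a nonzero multiple of a power with negative exponent and cannot be continuous at 0.
\<close>

lemma smooth_power_exponent_natural:
  assumes U: "smooth_on I g U" "j \<in> I" and y: "y(j := 0) \<in> U" and e: "0 < e" and c: "c \<noteq> 0"
    and ray: "\<And>r. r \<in> {0<..<e} \<Longrightarrow> y(j := r) \<in> U" "\<And>r. r \<in> {0<..<e} \<Longrightarrow> g (y(j := r)) = c * r powr q"
  shows "q \<in> \<nat>"
proof (rule ccontr)
  assume q: "q \<notin> \<nat>"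
  obtain k where k: "q < real k" using reals_Archimedean2 by blast
  obtain h where h: "continuous_on U h"
    "\<And>r. r \<in> {0<..<e} \<Longrightarrow> h (y(j := r)) = c * (\<Prod>i<k. q - real i) * r powr (q - real k)"
    using Ck_on_restricted_to_power[OF _ U(2) ray, of k] U(1) unfolding smooth_on_def by blast
  define C where "C = c * (\<Prod>i<k. q - real i)"
  have C: "C \<noteq> 0" using c q unfolding C_def by auto
  have "continuous_on {0..e/2} (\<lambda>r. h (y(j := r)))"
  proof (rule continuous_on_compose2[OF h(1)])
    show "continuous_on {0..e/2} (\<lambda>r. y(j := r))"
    proof (rule continuous_on_coordinatewise_then_product)
      show "continuous_on {0..e/2} (\<lambda>r. (y(j := r)) i)" for i
        by (cases "i = j") (simp_all add: continuous_on_id)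
    qed
    show "(\<lambda>r. y(j := r)) ` {0..e/2} \<subseteq> U"
    proof
      fix z assume "z \<in> (\<lambda>r. y(j := r)) ` {0..e/2}"
      then obtain r where "r \<in> {0..e/2}" "z = y(j := r)" by blast
      then show "z \<in> U" using y ray(1)[of r] e by (cases "r = 0") auto
    qed
  qed
  then have "((\<lambda>r. h (y(j := r))) \<longlongrightarrow> h (y(j := 0))) (at_right 0)"
    by (rule continuous_on_Icc_at_rightD) (use e in simp)
  moreover have "((\<lambda>r. r powr (real k - q)) \<longlongrightarrow> 0) (at_right 0)"
  proof (rule tendsto_zero_powrI[OF tendsto_ident_at tendsto_const])
    show "\<forall>\<^sub>F r in at_right 0. 0 \<le> (r :: real)"
      by (rule eventually_mono[OF eventually_at_right_less]) simp
  qed (use k in simp)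
  ultimately have "((\<lambda>r. r powr (real k - q) * h (y(j := r))) \<longlongrightarrow> 0 * h (y(j := 0))) (at_right 0)"
    by (intro tendsto_mult)
  moreover have "eventually (\<lambda>r. r powr (real k - q) * h (y(j := r)) = C) (at_right 0)"
  proof (rule eventually_mono[OF eventually_at_right_real[OF e]])
    fix r assume r: "r \<in> {0<..<e}"
    have "r powr (real k - q) * r powr (q - real k) = 1"
      using r by (simp flip: powr_add)
    then show "r powr (real k - q) * h (y(j := r)) = C"
      using h(2)[OF r] unfolding C_def by simp
  qed
  ultimately have "((\<lambda>_. C) \<longlongrightarrow> 0) (at_right (0::real))"
    by (simp add: tendsto_cong)
  then show False using C by (simp add: tendsto_const_iff)
qed

lemma sigma_pi_dom_open: "openin (top_of_set (coord_space {..<n})) (sigma_pi_dom n \<nu> p)"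
  unfolding sigma_pi_dom_def by (rule openin_Union) blast

lemma sigma_pi_dom_regular:
  assumes x: "x \<in> sigma_pi_dom n \<nu> p" and il: "i < n" "l < \<nu> i" and j: "j < n"
  shows "rpow_regular (x j) (p i l j)"
proof -
  obtain U where U: "openin (top_of_set (coord_space {..<n})) U" "x \<in> U"
    "\<And>x j. x \<in> U \<Longrightarrow> j < n \<Longrightarrow> rpow_defined (x j) (p i l j)"
    "smooth_on {..<n} (monomial_fun n (p i l)) U"
    using x il unfolding sigma_pi_dom_def by blast
  show ?thesis
  proof (cases "x j = 0")
    case True
    obtain e where e: "0 < e" "coord_ball {..<n} x e \<subseteq> U"
      using openin_coord_space_contains_coord_ball[OF U(1,2)] by blast
    have x: "x \<in> coord_space {..<n}" using U(1,2) openin_imp_subset by blast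
    \<comment> \<open>Move to a nearby point of the hyperplane at which all other coordinates are nonzero: there
      the monomial is a nonzero multiple of the power of the j-th coordinate.\<close>
    define y where "y = (\<lambda>k. if k < n \<and> k \<noteq> j \<and> x k = 0 then e / 2 else x k)"
    have ray: "y(j := r) \<in> U" if "\<bar>r\<bar> < e" for r
    proof -
      have "y(j := r) \<in> coord_ball {..<n} x e"
        using x True that e(1) j unfolding coord_ball_def coord_space_def y_def by auto
      then show ?thesis using e(2) by blast
    qed
    define c where "c = (\<Prod>k\<in>{..<n}-{j}. rpow (y k) (p i l k))"
    have "rpow (y k) (p i l k) \<noteq> 0" if "k < n" "k \<noteq> j" for k
    proof (rule rpow_nonzero)
      show "y k \<noteq> 0" using that e(1) unfolding y_def by auto
      show "rpow_defined (y k) (p i l k)"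
        using U(3)[OF ray[of 0], of k] that e(1) by simp
    qed
    then have c: "c \<noteq> 0" unfolding c_def by simp
    have "monomial_fun n (p i l) (y(j := r)) = c * r powr (p i l j)" if "r \<in> {0<..<e}" for r
    proof -
      have "monomial_fun n (p i l) (y(j := r)) = rpow r (p i l j) * c"
        unfolding monomial_fun_def c_def using j by (subst prod.remove[of _ j]) auto
      then show ?thesis using that by (simp add: rpow_positive)
    qed
    then have "p i l j \<in> \<nat>"
      using smooth_power_exponent_natural[OF U(4), of j y e c "p i l j"] j ray e(1) c by auto
    then show ?thesis using True unfolding rpow_regular_def by blast
  next
    case False
    then show ?thesis using U(2,3) j unfolding rpow_regular_def by blast
  qed
qed

text \<open>
  The power series converges on the complex disc over its real interval of convergence.
\<close>

lemma real_analytic_extends_holomorphically: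
  assumes "real_analytic_on v T" "t \<in> T"
  shows "extends_holomorphically v t"
proof -
  obtain a e where e: "0 < e" and a: "\<And>s. \<bar>s - t\<bar> < e \<Longrightarrow> (\<lambda>k. a k * (s - t) ^ k) sums v s"
    using assms unfolding real_analytic_on_def by blast
  define g where "g w = (\<Sum>k. complex_of_real (a k) * (w - of_real t) ^ k)" for w
  have sums: "(\<lambda>k. complex_of_real (a k) * (w - of_real t) ^ k) sums g w"
    if w: "w \<in> ball (of_real t) e" for w
  proof -
    obtain \<rho> where \<rho>: "cmod (w - of_real t) < \<rho>" "\<rho> < e"
      using dense w by (metis dist_commute dist_norm mem_ball)
    have "0 \<le> \<rho>" using \<rho>(1) norm_ge_zero[of "w - of_real t"] by linarith
    have "summable (\<lambda>k. a k * \<rho> ^ k)"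
      using sums_summable[OF a[of "t + \<rho>"]] \<rho>(2) \<open>0 \<le> \<rho>\<close> by simp
    then have "summable (\<lambda>k. complex_of_real (a k) * of_real \<rho> ^ k)"
      using summable_of_real[of "\<lambda>k. a k * \<rho> ^ k", where 'a = complex] by simp
    from powser_inside[OF this, of "w - of_real t"] show ?thesis
      using \<rho>(1) \<open>0 \<le> \<rho>\<close> unfolding g_def by (simp add: summable_sums)
  qed
  show ?thesis
  proof (rule extends_holomorphicallyI[OF e])
    show "g holomorphic_on ball (of_real t) e"
      by (rule power_series_holomorphic) (rule sums)
    fix s assume s: "\<bar>s - t\<bar> < e"
    have "(\<lambda>k. complex_of_real (a k) * (of_real s - of_real t) ^ k) sums of_real (v s)"
      using sums_of_real[OF a[OF s], where 'a = complex] by simp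
    then show "g (of_real s) = of_real (v s)" unfolding g_def by (rule sums_unique[symmetric])
  qed
qed

lemma extends_holomorphically_local_lipschitz:
  assumes "\<And>t. t \<in> T \<Longrightarrow> extends_holomorphically v t"
  shows "local_lipschitz (UNIV :: real set) T (\<lambda>_. v)"
proof (rule local_lipschitzI)
  fix s t :: real assume "t \<in> T"
  then obtain e g where e: "0 < e" and g: "g holomorphic_on ball (of_real t) e"
    and h: "\<And>r. \<bar>r - t\<bar> < e \<Longrightarrow> g (of_real r) = of_real (v r)"
    using assms extends_holomorphicallyE by blast
  obtain d C where d: "0 < d" "d \<le> e" and C: "0 \<le> C"
    "\<And>z w. z \<in> ball (of_real t) d \<Longrightarrow> w \<in> ball (of_real t) d \<Longrightarrow> cmod (g z - g w) \<le> C * cmod (z - w)"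
    using holomorphic_lipschitz_near[OF g e] by metis
  have "C-lipschitz_on (cball t (d/2) \<inter> T) v"
  proof (rule lipschitz_onI[OF _ C(1)])
    fix r q assume "r \<in> cball t (d/2) \<inter> T" "q \<in> cball t (d/2) \<inter> T"
    then have *: "\<bar>r - t\<bar> < d" "\<bar>q - t\<bar> < d" using d(1) by (auto simp: dist_real_def abs_minus_commute)
    have "\<bar>v r - v q\<bar> = cmod (of_real (v r) - of_real (v q))" by (simp flip: of_real_diff)
    also have "\<dots> = cmod (g (of_real r) - g (of_real q))" using h[of r] h[of q] * d(2) by simp
    also have "\<dots> \<le> C * cmod (of_real r - of_real q)"
      using * by (intro C(2)) (auto simp: dist_real_def abs_minus_commute)
    also have "\<dots> = C * \<bar>r - q\<bar>" by (simp flip: of_real_diff)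
    finally show "dist (v r) (v q) \<le> C * dist r q" by (simp add: dist_real_def)
  qed
  then show "\<exists>u>0. \<exists>L. \<forall>s\<in>cball s u \<inter> UNIV. L-lipschitz_on (cball t u \<inter> T) v"
    using d(1) by (intro exI[of _ "d/2"]) auto
qed

lemma sigma_pi_complexifiable:
  assumes x: "x \<in> sigma_pi_dom n \<nu> p" and i: "i < n"
    and v: "\<And>l. l < \<nu> i \<Longrightarrow> extends_holomorphically (v i l) t"
  shows "complexifiable n x t (\<lambda>x t. sigma_pi_rhs n \<nu> v p x t i)"
  unfolding sigma_pi_rhs_def
proof (rule complexifiable_sum)
  fix l assume l: "l \<in> {..<\<nu> i}"
  have "complexifiable n x t (\<lambda>x t. \<Prod>j<n. rpow (x j) (p i l j))"
  proof (rule complexifiable_prod)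
    fix j assume j: "j \<in> {..<n}"
    have "extends_holomorphically (\<lambda>r. rpow r (p i l j)) (x j)"
      using l j by (intro rpow_extends_holomorphically sigma_pi_dom_regular[OF x i]) auto
    from complexifiable_coordinate[where h = "\<lambda>r. rpow r (p i l j)" and x\<^sub>0 = x and j = j, OF this, of n t]
    show "complexifiable n x t (\<lambda>x t. rpow (x j) (p i l j))" using j by simp
  qed simp
  then have "complexifiable n x t (\<lambda>x t. monomial_fun n (p i l) x)"
    unfolding monomial_fun_def .
  moreover have "complexifiable n x t (\<lambda>x t. v i l t)"
    using l v by (intro complexifiable_time) simp
  ultimately show "complexifiable n x t (\<lambda>x t. v i l t * monomial_fun n (p i l) x)"
    by (rule complexifiable_mult[rotated])
qed simp

text \<open>
  For \<open>J = {}\<close> this is the given equation on its whole domain.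
\<close>

lemma sigma_pi_reduced_ode:
  assumes T: "open T" and v: "\<And>i l t. i < n \<Longrightarrow> l < \<nu> i \<Longrightarrow> t \<in> T \<Longrightarrow> extends_holomorphically (v i l) t"
    and J: "J \<subseteq> {..<n}"
  shows "complexifiable_ode n ({..<n} - J) (sigma_pi_rhs n \<nu> v p)
    {(x, t) \<in> sigma_pi_dom n \<nu> p \<times> T. \<forall>j\<in>J. x j = 0}"
proof
  let ?I = "{..<n} - J" and ?A = "{(x, t) \<in> sigma_pi_dom n \<nu> p \<times> T. \<forall>j\<in>J. x j = 0}"
  show "?I \<subseteq> {..<n}" by blast
  show "openin (top_of_set (coord_space ?I \<times> UNIV)) ?A"
    unfolding openin_coord_space_time_iff[OF finite_Diff[OF finite_lessThan]]
  proof (intro conjI)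
    have D: "sigma_pi_dom n \<nu> p \<subseteq> coord_space {..<n}" using sigma_pi_dom_open openin_imp_subset by blast
    then show "?A \<subseteq> coord_space ?I \<times> UNIV" unfolding coord_space_def by auto
    show "\<forall>(x, t)\<in>?A. \<exists>e>0. coord_ball ?I x e \<times> {t - e<..<t + e} \<subseteq> ?A"
    proof clarify
      fix x t assume x: "x \<in> sigma_pi_dom n \<nu> p" "\<forall>j\<in>J. x j = 0" and t: "t \<in> T"
      obtain a where a: "0 < a" "coord_ball {..<n} x a \<subseteq> sigma_pi_dom n \<nu> p"
        using openin_coord_space_contains_coord_ball[OF sigma_pi_dom_open x(1)] by blast
      obtain b where b: "0 < b" "ball t b \<subseteq> T" using T t open_contains_ball by blast
      define e where "e = min a b"
      have e: "0 < e" "e \<le> a" "e \<le> b" using a b unfolding e_def by auto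
      have "coord_ball ?I x e \<subseteq> coord_ball {..<n} x a"
        using e x(2) unfolding coord_ball_def coord_space_def by force
      moreover have "\<forall>j\<in>J. y j = 0" if "y \<in> coord_ball ?I x e" for y
        using that unfolding coord_ball_def coord_space_def by blast
      moreover have "{t - e<..<t + e} \<subseteq> T"
        using b(2) e(3) subset_ball[OF e(3), of t] unfolding ball_eq_greaterThanLessThan by blast
      ultimately have "coord_ball ?I x e \<times> {t - e<..<t + e} \<subseteq> ?A" using a(2) by auto
      then show "\<exists>e>0. coord_ball ?I x e \<times> {t - e<..<t + e} \<subseteq> ?A" using e(1) by blast
    qed
  qed
  show "complexifiable n x t (\<lambda>x t. sigma_pi_rhs n \<nu> v p x t i)" if "(x, t) \<in> ?A" "i \<in> ?I" for x t i
    using that v by (intro sigma_pi_complexifiable) auto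
qed

section \<open>Quadratic equations\<close>

text \<open>
  This gives uniqueness of solutions of the quadratic equation; existence comes from lifting solutions
  of the given equation.
\<close>

lemma quadratic_rhs_lipschitz:
  assumes T: "open T" and w: "\<And>i j. i < m \<Longrightarrow> j < m \<Longrightarrow> continuous_on T (w i j)"
  shows "lipschitz_ode {..<m} (quadratic_rhs m w) (coord_space {..<m} \<times> T)"
proof
  show "finite {..<m}" by simp
  show "coord_space {..<m} \<times> T \<subseteq> coord_space {..<m} \<times> UNIV" by blast
  fix z\<^sub>0 t\<^sub>0 assume "(z\<^sub>0, t\<^sub>0) \<in> coord_space {..<m} \<times> T"
  then obtain r where r: "0 < r" "cball t\<^sub>0 r \<subseteq> T"
    using T open_contains_cball by (metis SigmaD2)
  have "\<exists>B. \<forall>t\<in>cball t\<^sub>0 r. \<bar>w i j t\<bar> \<le> B" if "i < m" "j < m" for i j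
  proof -
    have "bounded (w i j ` cball t\<^sub>0 r)"
      using w[OF that] r(2) by (intro compact_imp_bounded compact_continuous_image) (auto intro: continuous_on_subset)
    then show ?thesis unfolding bounded_iff by auto
  qed
  then obtain B where B: "\<And>i j t. i < m \<Longrightarrow> j < m \<Longrightarrow> t \<in> cball t\<^sub>0 r \<Longrightarrow> \<bar>w i j t\<bar> \<le> B i j"
    by metis
  define M where "M = 1 + (\<Sum>i<m. \<bar>z\<^sub>0 i\<bar>)"
  define b where "b = (\<Sum>i<m. \<Sum>j<m. \<bar>B i j\<bar>)"
  define e where "e = min 1 r"
  have M: "0 \<le> M" unfolding M_def by (simp add: add_nonneg_nonneg sum_nonneg)
  have xM: "\<bar>x i\<bar> \<le> M" if "x \<in> coord_ball {..<m} z\<^sub>0 e" "i < m" for x i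
  proof -
    have "\<bar>x i - z\<^sub>0 i\<bar> < e" using that unfolding coord_ball_def by blast
    moreover have "e \<le> 1" unfolding e_def by simp
    moreover have "\<bar>z\<^sub>0 i\<bar> \<le> (\<Sum>i<m. \<bar>z\<^sub>0 i\<bar>)" using that(2) by (intro member_le_sum) auto
    ultimately show ?thesis unfolding M_def by linarith
  qed
  have wb: "\<bar>w i j t\<bar> \<le> b" if "i < m" "j < m" "t \<in> {t\<^sub>0 - e<..<t\<^sub>0 + e}" for i j t
  proof -
    have "t \<in> cball t\<^sub>0 r" using that(3) unfolding e_def by (auto simp: dist_real_def)
    then have "\<bar>w i j t\<bar> \<le> \<bar>B i j\<bar>" using B[OF that(1,2)] by force
    also have "\<dots> \<le> (\<Sum>j<m. \<bar>B i j\<bar>)" using that(2) by (intro member_le_sum) auto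
    also have "\<dots> \<le> b" unfolding b_def
      using that(1) by (intro member_le_sum[where f = "\<lambda>i. \<Sum>j<m. \<bar>B i j\<bar>"]) (auto intro: sum_nonneg)
    finally show ?thesis .
  qed
  have b: "0 \<le> b" unfolding b_def by (intro sum_nonneg) auto
  have "\<bar>quadratic_rhs m w x t i - quadratic_rhs m w y t i\<bar> \<le> real m * (b * (2 * M)) * (\<Sum>j<m. \<bar>x j - y j\<bar>)"
    if x: "x \<in> coord_ball {..<m} z\<^sub>0 e" and y: "y \<in> coord_ball {..<m} z\<^sub>0 e"
      and t: "t \<in> {t\<^sub>0 - e<..<t\<^sub>0 + e}" and i: "i \<in> {..<m}" for x y t i
  proof -
    let ?S = "\<Sum>j<m. \<bar>x j - y j\<bar>"
    have S: "\<bar>x j - y j\<bar> \<le> ?S" if "j < m" for j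
      using that by (intro member_le_sum) auto
    have "\<bar>quadratic_rhs m w x t i - quadratic_rhs m w y t i\<bar>
        = \<bar>\<Sum>j<m. w i j t * (x i * (x j - y j) + (x i - y i) * y j)\<bar>"
      unfolding quadratic_rhs_def by (simp add: algebra_simps flip: sum_subtractf)
    also have "\<dots> \<le> (\<Sum>j<m. \<bar>w i j t * (x i * (x j - y j) + (x i - y i) * y j)\<bar>)" by (rule sum_abs)
    also have "\<dots> \<le> (\<Sum>j<m. b * (2 * M * ?S))"
    proof (rule sum_mono)
      fix j assume j: "j \<in> {..<m}"
      have "\<bar>x i * (x j - y j) + (x i - y i) * y j\<bar> \<le> \<bar>x i\<bar> * \<bar>x j - y j\<bar> + \<bar>x i - y i\<bar> * \<bar>y j\<bar>"
        by (metis abs_mult abs_triangle_ineq)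
      also have "\<dots> \<le> M * ?S + ?S * M"
        using i j M by (intro add_mono mult_mono xM[OF x] xM[OF y] S) (auto intro: sum_nonneg)
      finally have "\<bar>x i * (x j - y j) + (x i - y i) * y j\<bar> \<le> 2 * M * ?S" by (simp add: algebra_simps)
      then show "\<bar>w i j t * (x i * (x j - y j) + (x i - y i) * y j)\<bar> \<le> b * (2 * M * ?S)"
        unfolding abs_mult using i j t wb b by (intro mult_mono) auto
    qed
    finally show ?thesis by (simp add: algebra_simps)
  qed
  then show "\<exists>e>0. \<exists>L. \<forall>x\<in>coord_ball {..<m} z\<^sub>0 e. \<forall>y\<in>coord_ball {..<m} z\<^sub>0 e. \<forall>t\<in>{t\<^sub>0 - e<..<t\<^sub>0 + e}.
      \<forall>i\<in>{..<m}. \<bar>quadratic_rhs m w x t i - quadratic_rhs m w y t i\<bar> \<le> L * (\<Sum>j\<in>{..<m}. \<bar>x j - y j\<bar>)"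
    using r(1) unfolding e_def by (intro exI[of _ "min 1 r"] conjI exI[of _ "real m * (b * (2 * M))"] ballI) auto
qed

section \<open>The Lotka-Volterra lift\<close>

text \<open>
  The lift stores the coordinates first and then, for each equation \<open>a\<close>, a block of \<open>N\<close> ratios.
\<close>

lemma sum_blocks:
  fixes F :: "nat \<Rightarrow> real"
  shows "(\<Sum>q<n + n * N. F q) = (\<Sum>q<n. F q) + (\<Sum>a<n. \<Sum>l<N. F (n + (a * N + l)))"
proof -
  have "(\<Sum>q<n + n * N. F q) = (\<Sum>q<n. F q) + (\<Sum>q\<in>{n..<n + n * N}. F q)"
    using sum.atLeastLessThan_concat[of 0 n "n + n * N" F] by (simp add: lessThan_atLeast0)
  also have "(\<Sum>q\<in>{n..<n + n * N}. F q) = (\<Sum>q<n * N. F (n + q))"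
    using sum.shift_bounds_nat_ivl[of F 0 n "n * N"] by (simp add: lessThan_atLeast0 add.commute)
  also have "\<dots> = (\<Sum>a<n. sum (\<lambda>q. F (n + q)) {a * N..<a * N + N})"
    by (rule sum.nat_group[symmetric])
  also have "\<dots> = (\<Sum>a<n. \<Sum>l<N. F (n + (a * N + l)))"
  proof (rule sum.cong[OF refl])
    fix a
    show "sum (\<lambda>q. F (n + q)) {a * N..<a * N + N} = (\<Sum>l<N. F (n + (a * N + l)))"
      using sum.shift_bounds_nat_ivl[of "\<lambda>q. F (n + q)" 0 "a * N" N]
      by (simp add: lessThan_atLeast0 add.commute)
  qed
  finally show ?thesis .
qed

lemma DERIV_prod_logarithmic:
  fixes g d :: "'k \<Rightarrow> real \<Rightarrow> real"
  assumes "finite K" "\<And>k. k \<in> K \<Longrightarrow> (g k has_real_derivative g k s * d k s) (at s)"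
  shows "((\<lambda>r. \<Prod>k\<in>K. g k r) has_real_derivative (\<Prod>k\<in>K. g k s) * (\<Sum>k\<in>K. d k s)) (at s)"
  using assms
proof (induction K rule: finite_induct)
  case (insert k K)
  have "((\<lambda>r. g k r * (\<Prod>k\<in>K. g k r)) has_real_derivative
      (g k s * d k s) * (\<Prod>k\<in>K. g k s) + ((\<Prod>k\<in>K. g k s) * (\<Sum>k\<in>K. d k s)) * g k s) (at s)"
    using insert by (intro DERIV_mult) auto
  moreover have "(g k s * d k s) * (\<Prod>k\<in>K. g k s) + ((\<Prod>k\<in>K. g k s) * (\<Sum>k\<in>K. d k s)) * g k s
      = (\<Prod>k\<in>insert k K. g k s) * (\<Sum>k\<in>insert k K. d k s)"
    using insert(1,2) by (simp add: algebra_simps)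
  ultimately show ?case using insert(1,2) by simp
qed simp

locale sigma_pi_ode =
  fixes n :: nat and \<nu> :: "nat \<Rightarrow> nat"
    and v :: "nat \<Rightarrow> nat \<Rightarrow> real \<Rightarrow> real" and p :: "nat \<Rightarrow> nat \<Rightarrow> nat \<Rightarrow> real" and T :: "real set"
  assumes open_T: "open T"
    and analytic_coefficients: "\<And>i l t. i < n \<Longrightarrow> l < \<nu> i \<Longrightarrow> t \<in> T \<Longrightarrow> extends_holomorphically (v i l) t"
begin

abbreviation f :: rhs where "f \<equiv> sigma_pi_rhs n \<nu> v p"

abbreviation \<S> :: "(rvec \<times> real) set" where "\<S> \<equiv> sigma_pi_dom n \<nu> p \<times> T"

text \<open>
  All blocks get the same length, so that division with remainder decodes an index. This length has to
  bound every \<open>\<nu> a\<close>; the remaining places are filled with zeros.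
\<close>

definition width :: nat where "width = (\<Sum>i<n. \<nu> i)"

definition lift_dim :: nat where "lift_dim = n + n * width"

text \<open>
  The division by \<open>x a\<close> is meant literally when \<open>x a \<noteq> 0\<close>; for \<open>x a = 0\<close> the value is 0, which is what
  the lift needs for a component that vanishes identically.
\<close>

definition ratio :: "nat \<Rightarrow> nat \<Rightarrow> rvec \<Rightarrow> real" where
  "ratio a l x = (if l < \<nu> a then monomial_fun n (p a l) x / x a else 0)"

definition lift :: "rvec \<times> real \<Rightarrow> rvec" where
  "lift = (\<lambda>(x, t) q. if q < n then x q
     else if q < lift_dim then ratio ((q - n) div width) ((q - n) mod width) x else 0)"

text \<open>
  Where no coordinate vanishes, the \<open>q\<close>-th component of the lift is the product of the powers of the \<open>x k\<close> with exponents
  \<open>exponent q k\<close>.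
\<close>

definition exponent :: "nat \<Rightarrow> nat \<Rightarrow> real" where
  "exponent q k = (if q < n then of_bool (k = q)
     else p ((q - n) div width) ((q - n) mod width) k - of_bool (k = (q - n) div width))"

text \<open>
  In the logarithmic derivative of the \<open>q\<close>-th component of the lift, the factor of the ratio that is
  stored at \<open>q'\<close>. Coordinates do not enter, so their columns are zero.
\<close>

definition lift_coeff :: "nat \<Rightarrow> nat \<Rightarrow> real \<Rightarrow> real" where
  "lift_coeff q q' t = (let a = (q' - n) div width; l = (q' - n) mod width in
     if q' < n \<or> \<nu> a \<le> l then 0 else exponent q a * v a l t)"

text \<open>
  The logarithmic derivative of the \<open>k\<close>-th component of a solution.
\<close>

definition rate :: "rvec \<Rightarrow> real \<Rightarrow> nat \<Rightarrow> real" where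
  "rate x t k = (\<Sum>l<\<nu> k. v k l t * ratio k l x)"

lemma nu_le_width: "a < n \<Longrightarrow> \<nu> a \<le> width"
  unfolding width_def by (intro member_le_sum) auto

lemma block_index:
  assumes "a < n" "l < width"
  shows "n + (a * width + l) < lift_dim"
    "(n + (a * width + l) - n) div width = a" "(n + (a * width + l) - n) mod width = l"
proof -
  have "a * width + l < Suc a * width" using assms(2) by simp
  also have "\<dots> \<le> n * width" using assms(1) by (intro mult_right_mono) auto
  finally show "n + (a * width + l) < lift_dim" unfolding lift_dim_def by simp
qed (use assms(2) in auto)

lemma index_cases:
  assumes "q < lift_dim"
  obtains "q < n" | a l where "a < n" "l < width" "q = n + (a * width + l)"
proof (cases "q < n")
  case False
  have "q - n < n * width" using assms False unfolding lift_dim_def by simp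
  moreover have "0 < width" using calculation by (cases width) auto
  ultimately have "(q - n) div width < n" "(q - n) mod width < width" "q = n + ((q - n) div width * width + (q - n) mod width)"
    using False div_mult_mod_eq[of "q - n" width] by (simp_all add: less_mult_imp_div_less)
  then show ?thesis using that by blast
qed (use that in blast)

lemma quadratic_rhs_lift:
  "quadratic_rhs lift_dim lift_coeff (lift (x, t)) t q = lift (x, t) q * (\<Sum>k<n. exponent q k * rate x t k)"
proof -
  let ?z = "lift (x, t)"
  have "quadratic_rhs lift_dim lift_coeff ?z t q = (\<Sum>a<n. \<Sum>l<width. lift_coeff q (n + (a * width + l)) t * ?z q * ?z (n + (a * width + l)))"
    unfolding quadratic_rhs_def lift_dim_def sum_blocks by (simp add: lift_coeff_def)
  also have "\<dots> = (\<Sum>a<n. ?z q * (exponent q a * rate x t a))"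
  proof (rule sum.cong[OF refl])
    fix a assume "a \<in> {..<n}"
    then have a: "a < n" by simp
    have "(\<Sum>l<width. lift_coeff q (n + (a * width + l)) t * ?z q * ?z (n + (a * width + l)))
        = (\<Sum>l<width. ?z q * exponent q a * (if l < \<nu> a then v a l t * ratio a l x else 0))"
    proof (rule sum.cong[OF refl])
      fix l assume "l \<in> {..<width}"
      then have l: "l < width" by simp
      show "lift_coeff q (n + (a * width + l)) t * ?z q * ?z (n + (a * width + l))
          = ?z q * exponent q a * (if l < \<nu> a then v a l t * ratio a l x else 0)"
        using block_index[OF a l] unfolding lift_coeff_def lift_def Let_def by simp
    qed
    also have "\<dots> = ?z q * exponent q a * (\<Sum>l<width. if l < \<nu> a then v a l t * ratio a l x else 0)"
      by (simp add: sum_distrib_left)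
    also have "(\<Sum>l<width. if l < \<nu> a then v a l t * ratio a l x else 0) = rate x t a"
      unfolding rate_def using nu_le_width[OF a]
      by (intro sum.mono_neutral_cong_right) auto
    finally show "(\<Sum>l<width. lift_coeff q (n + (a * width + l)) t * ?z q * ?z (n + (a * width + l))) = ?z q * (exponent q a * rate x t a)"
      by (simp add: mult.assoc)
  qed
  finally show ?thesis by (simp add: sum_distrib_left)
qed

definition reduced_domain :: "nat set \<Rightarrow> (rvec \<times> real) set" where
  "reduced_domain J = {(x, t) \<in> \<S>. \<forall>j\<in>J. x j = 0}"

text \<open>
  The domain of the lift for the solutions whose identically vanishing components are those in \<open>J\<close>.
\<close>

definition regular_part :: "nat set \<Rightarrow> (rvec \<times> real) set" where
  "regular_part J = {(x, t) \<in> reduced_domain J. \<forall>i\<in>{..<n} - J. x i \<noteq> 0}"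

lemma reduced: "J \<subseteq> {..<n} \<Longrightarrow> complexifiable_ode n ({..<n} - J) f (reduced_domain J)"
  unfolding reduced_domain_def by (rule sigma_pi_reduced_ode[OF open_T analytic_coefficients])

lemma coefficients_local_lipschitz:
  "q' < lift_dim \<Longrightarrow> local_lipschitz (UNIV :: real set) T (\<lambda>_. lift_coeff q q')"
proof (rule extends_holomorphically_local_lipschitz)
  fix t assume q': "q' < lift_dim" and t: "t \<in> T"
  have const: "extends_holomorphically (\<lambda>_. 0) t"
    by (rule extends_holomorphicallyI[of 1 "\<lambda>_. 0"]) auto
  show "extends_holomorphically (lift_coeff q q') t"
    using q'
  proof (cases rule: index_cases)
    case 1
    then show ?thesis using const unfolding lift_coeff_def by simp
  next
    case (2 a l)
    show ?thesis
    proof (cases "l < \<nu> a")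
      case True
      obtain e g where e: "0 < e" and g: "g holomorphic_on ball (of_real t) e"
        "\<And>r. \<bar>r - t\<bar> < e \<Longrightarrow> g (of_real r) = of_real (v a l r)"
        using analytic_coefficients[OF 2(1) True t] by (rule extends_holomorphicallyE) blast
      have "extends_holomorphically (\<lambda>t. exponent q a * v a l t) t"
        by (rule extends_holomorphicallyI[OF e, of "\<lambda>\<tau>. of_real (exponent q a) * g \<tau>"])
          (use g in \<open>auto intro!: holomorphic_on_mult\<close>)
      moreover have "lift_coeff q q' = (\<lambda>t. exponent q a * v a l t)"
        using 2 True block_index[OF 2(1,2)] unfolding lift_coeff_def Let_def by (intro ext) simp
      ultimately show ?thesis by simp
    next
      case False
      then have "lift_coeff q q' = (\<lambda>_. 0)"
        using 2 block_index[OF 2(1,2)] unfolding lift_coeff_def Let_def by (intro ext) simp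
      then show ?thesis using const by simp
    qed
  qed
qed

lemma quadratic_lipschitz_ode: "lipschitz_ode {..<lift_dim} (quadratic_rhs lift_dim lift_coeff) (coord_space {..<lift_dim} \<times> T)"
proof (rule quadratic_rhs_lipschitz[OF open_T])
  show "continuous_on T (lift_coeff i j)" if "j < lift_dim" for i j
    using local_lipschitz_continuous_on[OF coefficients_local_lipschitz[OF that, of i], of 0] by simp
qed

text \<open>
  Logarithmic differentiation. Components in \<open>J\<close> need no separate treatment in the formulas: their
  powers are constant in time and their rate is 0 because of the division by 0, and so are their own
  ratios.
\<close>

lemma lift_is_solution:
  assumes J: "J \<subseteq> {..<n}" and u: "ode_solution ({..<n} - J) f (reduced_domain J) u K"
    and regular_part: "\<And>s. s \<in> K \<Longrightarrow> (u s, s) \<in> regular_part J"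
  shows "ode_solution {..<lift_dim} (quadratic_rhs lift_dim lift_coeff) (coord_space {..<lift_dim} \<times> T) (\<lambda>s. lift (u s, s)) K"
  unfolding ode_solution_def
proof (intro conjI ballI)
  show K: "open K" and "is_interval K" using u unfolding ode_solution_def by auto
  fix s assume s: "s \<in> K"
  have "s \<in> T" using ode_solution_in[OF u s] unfolding reduced_domain_def by auto
  then show "(lift (u s, s), s) \<in> coord_space {..<lift_dim} \<times> T"
    unfolding lift_def coord_space_def lift_dim_def by auto
  have zero: "u r j = 0" if "j \<in> J" "r \<in> K" for j r
    using regular_part[OF that(2)] that(1) unfolding regular_part_def reduced_domain_def by auto
  have nonzero: "u s i \<noteq> 0" if "i < n" "i \<notin> J" for i
    using regular_part[OF s] that unfolding regular_part_def by auto
  have rate_zero: "rate (u s) s j = 0" if "j \<in> J" for j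
    unfolding rate_def ratio_def using zero[OF that s] by simp
  have const: "(h has_real_derivative 0) (at s)" if "\<And>r. r \<in> K \<Longrightarrow> h r = (c::real)" for h c
    by (rule has_field_derivative_transform_within_open[OF DERIV_const[of c] K s]) (use that in auto)
  have u': "((\<lambda>r. u r k) has_real_derivative u s k * rate (u s) s k) (at s)" if k: "k < n" for k
  proof (cases "k \<in> J")
    case True
    then show ?thesis using const[of "\<lambda>r. u r k" 0] zero rate_zero by simp
  next
    case False
    have "f (u s) s k = u s k * rate (u s) s k"
      unfolding sigma_pi_rhs_def rate_def ratio_def sum_distrib_left
      using nonzero[OF k False] by (intro sum.cong) auto
    then show ?thesis using ode_solution_deriv[OF u s, of k] k False by simp
  qed
  have rpow': "((\<lambda>r. rpow (u r k) (p a l k)) has_real_derivative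
      rpow (u s k) (p a l k) * (p a l k * rate (u s) s k)) (at s)"
    if a: "a < n" "l < \<nu> a" and k: "k < n" for a l k
  proof (cases "k \<in> J")
    case True
    then show ?thesis using const[of "\<lambda>r. rpow (u r k) (p a l k)" "rpow 0 (p a l k)"] zero rate_zero by simp
  next
    case False
    have "u s \<in> sigma_pi_dom n \<nu> p" using ode_solution_in[OF u s] unfolding reduced_domain_def by auto
    then have "rpow_defined (u s k) (p a l k)"
      using sigma_pi_dom_regular[where p = p and \<nu> = \<nu>, OF _ a k] nonzero[OF k False] unfolding rpow_regular_def by blast
    from DERIV_chain2[OF DERIV_rpow[OF nonzero[OF k False] this] u'[OF k]]
    show ?thesis using nonzero[OF k False] by (simp add: field_simps)
  qed
  have ratio': "((\<lambda>r. ratio a l (u r)) has_real_derivative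
      ratio a l (u s) * (\<Sum>k<n. (p a l k - of_bool (k = a)) * rate (u s) s k)) (at s)" if a: "a < n" for a l
  proof (cases "l < \<nu> a \<and> a \<notin> J")
    case True
    have "((\<lambda>r. monomial_fun n (p a l) (u r)) has_real_derivative
        monomial_fun n (p a l) (u s) * (\<Sum>k<n. p a l k * rate (u s) s k)) (at s)"
      unfolding monomial_fun_def using a True
      by (intro DERIV_prod_logarithmic[where d = "\<lambda>k s. p a l k * rate (u s) s k"] rpow') auto
    from DERIV_divide[OF this u'[OF a] nonzero[OF a]]
    have "((\<lambda>r. ratio a l (u r)) has_real_derivative
        (monomial_fun n (p a l) (u s) * (\<Sum>k<n. p a l k * rate (u s) s k) * u s a
          - monomial_fun n (p a l) (u s) * (u s a * rate (u s) s a)) / (u s a * u s a)) (at s)"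
      using True unfolding ratio_def by simp
    moreover have "(monomial_fun n (p a l) (u s) * (\<Sum>k<n. p a l k * rate (u s) s k) * u s a
          - monomial_fun n (p a l) (u s) * (u s a * rate (u s) s a)) / (u s a * u s a)
        = ratio a l (u s) * ((\<Sum>k<n. p a l k * rate (u s) s k) - rate (u s) s a)"
    proof -
      have "(F * P * c - F * (c * R)) / (c * c) = F / c * (P - R)" if "c \<noteq> 0" for F P R c :: real
        using that by (simp add: field_simps)
      then show ?thesis using True nonzero[OF a] unfolding ratio_def by simp
    qed
    moreover have "(\<Sum>k<n. (p a l k - of_bool (k = a)) * rate (u s) s k)
        = (\<Sum>k<n. p a l k * rate (u s) s k) - rate (u s) s a"
    proof -
      have "(\<Sum>k<n. of_bool (k = a) * rate (u s) s k) = rate (u s) s a"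
        using a by (subst sum.remove[of _ a]) auto
      then show ?thesis by (simp add: left_diff_distrib sum_subtractf)
    qed
    ultimately show ?thesis by simp
  next
    case False
    then have "ratio a l (u r) = 0" if "r \<in> K" for r
      unfolding ratio_def using zero[of a r] that by auto
    then show ?thesis using const[of "\<lambda>r. ratio a l (u r)" 0] s by simp
  qed
  fix q assume "q \<in> {..<lift_dim}"
  then have "q < lift_dim" by simp
  then show "((\<lambda>r. lift (u r, r) q) has_real_derivative quadratic_rhs lift_dim lift_coeff (lift (u s, s)) s q) (at s)"
    unfolding quadratic_rhs_lift
  proof (cases rule: index_cases)
    case 1
    have "(\<Sum>k<n. exponent q k * rate (u s) s k) = rate (u s) s q"
      using 1 unfolding exponent_def by (subst sum.remove[of _ q]) auto
    then show "((\<lambda>r. lift (u r, r) q) has_real_derivative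
        lift (u s, s) q * (\<Sum>k<n. exponent q k * rate (u s) s k)) (at s)"
      using u'[OF 1] 1 unfolding lift_def by simp
  next
    case (2 a l)
    have "exponent q k = p a l k - of_bool (k = a)" for k
      using 2 block_index[OF 2(1,2)] unfolding exponent_def by simp
    moreover have "lift (u r, r) q = ratio a l (u r)" for r
      using 2 block_index[OF 2(1,2)] unfolding lift_def by simp
    ultimately show "((\<lambda>r. lift (u r, r) q) has_real_derivative
        lift (u s, s) q * (\<Sum>k<n. exponent q k * rate (u s) s k)) (at s)"
      using ratio'[OF 2(1)] by simp
  qed
qed

lemma reduced_domain_empty: "reduced_domain {} = \<S>"
  unfolding reduced_domain_def by auto

lemma regular_part_open:
  assumes J: "J \<subseteq> {..<n}"
  shows "openin (top_of_set (coord_space ({..<n} - J) \<times> UNIV)) (regular_part J)"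
proof -
  interpret complexifiable_ode n "{..<n} - J" f "reduced_domain J" by (rule reduced[OF J])
  have "open {y :: rvec \<times> real. fst y i \<noteq> 0}" for i
  proof (intro open_Collect_neq continuous_on_const)
    show "continuous_on UNIV (\<lambda>y :: rvec \<times> real. fst y i)"
      by (rule continuous_on_compose2[OF continuous_on_product_coordinates continuous_on_fst[OF continuous_on_id]]) simp
  qed
  then have "open (\<Inter>i\<in>{..<n} - J. {y :: rvec \<times> real. fst y i \<noteq> 0})" by blast
  from openin_Int_open[OF open_domain this]
  have "openin (top_of_set (coord_space ({..<n} - J) \<times> UNIV)) (reduced_domain J \<inter> (\<Inter>i\<in>{..<n} - J. {y. fst y i \<noteq> 0}))" .
  moreover have "regular_part J = reduced_domain J \<inter> (\<Inter>i\<in>{..<n} - J. {y. fst y i \<noteq> 0})"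
    unfolding regular_part_def by auto
  ultimately show ?thesis by simp
qed

text \<open>
  A solution through a point of the regular part may leave it and come back later, when its lift need
  not belong to the same solution of the quadratic equation any more. The neighbourhood is therefore
  restricted to times so close that the solution has not left the regular part.
\<close>

lemma lift_locally_compatible:
  assumes J: "J \<subseteq> {..<n}"
  shows "locally_compatible ({..<n} - J) f (reduced_domain J) {..<lift_dim} (quadratic_rhs lift_dim lift_coeff) (coord_space {..<lift_dim} \<times> T) (regular_part J) lift"
  unfolding locally_compatible_def
proof clarify
  let ?I = "{..<n} - J" and ?B = "coord_space {..<lift_dim} \<times> T"
  interpret red: complexifiable_ode n ?I f "reduced_domain J" by (rule reduced[OF J])
  interpret quad: lipschitz_ode "{..<lift_dim}" "quadratic_rhs lift_dim lift_coeff" ?B by (rule quadratic_lipschitz_ode)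
  fix x t assume xt: "(x, t) \<in> regular_part J"
  define u where "u = max_solution ?I f (reduced_domain J) x t"
  define K where "K = max_interval ?I f (reduced_domain J) x t"
  have t: "t \<in> K" unfolding K_def using xt red.in_max_interval unfolding regular_part_def by blast
  have ut: "u t = x" unfolding u_def using red.max_solution_start(2) t K_def by blast
  have u: "ode_solution ?I f (reduced_domain J) u K" unfolding u_def K_def by (rule red.max_solution_is_solution)
  obtain e where e: "0 < e" "coord_ball ?I x e \<times> {t-e<..<t+e} \<subseteq> regular_part J"
    using regular_part_open[OF J] xt unfolding openin_coord_space_time_iff[OF red.finite_I] by fast
  obtain d where d: "0 < d" "{t-d<..<t+d} \<subseteq> K" "\<And>r. r \<in> {t-d<..<t+d} \<Longrightarrow> u r \<in> coord_ball ?I x e"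
    using ode_solution_stays_in_coord_ball[OF u red.finite_I red.domain_in_space t e(1)] ut by metis
  define c where "c = min d e"
  let ?C = "{t-c<..<t+c}"
  have c: "0 < c" "?C \<subseteq> {t-d<..<t+d}" "?C \<subseteq> {t-e<..<t+e}" using d(1) e(1) unfolding c_def by auto
  have z: "ode_solution {..<lift_dim} (quadratic_rhs lift_dim lift_coeff) ?B (\<lambda>s. lift (u s, s)) ?C"
  proof (rule lift_is_solution[OF J])
    show "ode_solution ?I f (reduced_domain J) u ?C"
      using c(2) d(2) by (intro ode_solution_subset[OF u]) (auto simp: is_interval_1)
    show "(u s, s) \<in> regular_part J" if "s \<in> ?C" for s
      using d(3)[of s] e(2) c that by blast
  qed
  have tC: "t \<in> ?C" using c(1) by simp
  let ?U = "regular_part J \<inter> (UNIV \<times> ?C)"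
  show "\<exists>U. openin (top_of_set (coord_space ?I \<times> UNIV)) U \<and> (x, t) \<in> U \<and> U \<subseteq> regular_part J \<and>
    (\<forall>(x', t')\<in>U. (x', t') \<in> solution_graph ?I f (reduced_domain J) x t \<longrightarrow>
       (lift (x', t'), t') \<in> solution_graph {..<lift_dim} (quadratic_rhs lift_dim lift_coeff) ?B (lift (x, t)) t)"
  proof (intro exI[of _ ?U] conjI)
    show "openin (top_of_set (coord_space ?I \<times> UNIV)) ?U"
      by (intro openin_Int_open regular_part_open J open_Times) auto
    show "\<forall>(x', t')\<in>?U. (x', t') \<in> solution_graph ?I f (reduced_domain J) x t \<longrightarrow>
       (lift (x', t'), t') \<in> solution_graph {..<lift_dim} (quadratic_rhs lift_dim lift_coeff) ?B (lift (x, t)) t"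
    proof (clarsimp simp only: Int_iff mem_Times_iff prod.sel)
      fix x' t' assume t': "t' \<in> ?C" and g: "(x', t') \<in> solution_graph ?I f (reduced_domain J) x t"
      have x': "x' = u t'" using g unfolding solution_graph_def u_def by auto
      have start: "lift (u t, t) = lift (x, t)" unfolding ut ..
      have "t' \<in> max_interval {..<lift_dim} (quadratic_rhs lift_dim lift_coeff) ?B (lift (x, t)) t"
        using quad.subset_max_interval[OF z tC start] t' by blast
      moreover have "max_solution {..<lift_dim} (quadratic_rhs lift_dim lift_coeff) ?B (lift (x, t)) t t' = lift (x', t')"
        using quad.max_solution_eq[OF z tC start t'] x' by simp
      ultimately show "(lift (x', t'), t') \<in> solution_graph {..<lift_dim} (quadratic_rhs lift_dim lift_coeff) ?B (lift (x, t)) t"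
        unfolding solution_graph_def by (metis (no_types, lifting) image_eqI)
    qed
  qed (use xt tC in auto)
qed

definition zero_components :: "rvec \<times> real \<Rightarrow> nat set" where
  "zero_components = (\<lambda>(x, t). {j\<in>{..<n}. \<forall>s\<in>max_interval {..<n} f \<S> x t. max_solution {..<n} f \<S> x t s j = 0})"

definition sub_system :: "nat set \<Rightarrow> (rvec \<times> real) set" where
  "sub_system J = {y \<in> \<S>. zero_components y = J}"

lemma full: "complexifiable_ode n {..<n} f \<S>"
  using reduced[of "{}"] reduced_domain_empty by simp

lemma solution_graph_same_zero_components:
  assumes "(x, t) \<in> \<S>" "(y, s) \<in> solution_graph {..<n} f \<S> x t"
  shows "(y, s) \<in> \<S>" "zero_components (y, s) = zero_components (x, t)"
proof -
  interpret full: complexifiable_ode n "{..<n}" f \<S> by (rule full)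
  have s: "s \<in> max_interval {..<n} f \<S> x t" and y: "y = max_solution {..<n} f \<S> x t s"
    using assms(2) unfolding solution_graph_def by auto
  show "(y, s) \<in> \<S>"
    unfolding y by (rule ode_solution_in[OF full.max_solution_is_solution s])
  show "zero_components (y, s) = zero_components (x, t)"
    unfolding zero_components_def prod.case full.max_solution_restart(1)[OF s y]
    using full.max_solution_restart(2)[OF s y] by simp
qed

lemma sub_system_invariant: "ode_domain {..<n} f \<S> (sub_system J)"
  unfolding ode_domain_def
proof (intro conjI)
  show "sub_system J \<subseteq> \<S>" unfolding sub_system_def by blast
  show "\<forall>(x, t)\<in>sub_system J. solution_graph {..<n} f \<S> x t \<subseteq> sub_system J"
  proof clarify
    fix x t y s assume xt: "(x, t) \<in> sub_system J" and ys: "(y, s) \<in> solution_graph {..<n} f \<S> x t"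
    have "(x, t) \<in> \<S>" "zero_components (x, t) = J"
      using xt unfolding sub_system_def by blast+
    then show "(y, s) \<in> sub_system J"
      using solution_graph_same_zero_components[OF _ ys] unfolding sub_system_def by blast
  qed
qed

lemma sub_system_regular_interval:
  assumes xt: "(x, t) \<in> sub_system J" and J: "J \<subseteq> {..<n}"
  obtains W where "open W" "is_interval W" "W \<noteq> {}" "W \<subseteq> max_interval {..<n} f \<S> x t"
    "\<And>s. s \<in> W \<Longrightarrow> (max_solution {..<n} f \<S> x t s, s) \<in> regular_part J"
proof -
  interpret full: complexifiable_ode n "{..<n}" f \<S> by (rule full)
  define u where "u = max_solution {..<n} f \<S> x t"
  define K where "K = max_interval {..<n} f \<S> x t"
  have S: "(x, t) \<in> \<S>" and Z: "zero_components (x, t) = J" using xt unfolding sub_system_def by auto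
  have u: "ode_solution {..<n} f \<S> u K" unfolding u_def K_def by (rule full.max_solution_is_solution)
  have "t \<in> K" unfolding K_def by (rule full.in_max_interval[OF S])
  then have "K \<noteq> {}" by blast
  obtain V where V: "open V" "V \<noteq> {}" "V \<subseteq> K" "\<And>i s. i \<in> {..<n} - J \<Longrightarrow> s \<in> V \<Longrightarrow> u s i \<noteq> 0"
  proof (rule locally_analytic_common_nonzero[of K "{..<n} - J" "\<lambda>i s. u s i"])
    show "open K" "is_interval K" using ode_solution_open[OF u] ode_solution_interval[OF u] by auto
    show "K \<noteq> {}" by fact
    show "finite ({..<n} - J)" by simp
    show "continuous_on K (\<lambda>s. u s i)" if "i \<in> {..<n} - J" for i
      using ode_solution_continuous[OF u] that by blast
    show "extends_holomorphically (\<lambda>s. u s i) s" if "i \<in> {..<n} - J" "s \<in> K" for i s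
      using full.max_solution_analytic[of s x t i] that unfolding u_def K_def by blast
    show "\<exists>s\<in>K. u s i \<noteq> 0" if "i \<in> {..<n} - J" for i
      using that Z unfolding zero_components_def u_def K_def by auto
  qed (use that in blast)
  obtain s e where s: "0 < e" "ball s e \<subseteq> V" using V(1,2) open_contains_ball by blast
  show ?thesis
  proof (rule that[of "ball s e"])
    show "is_interval (ball s e)" by (simp add: is_interval_ball_real)
    show "ball s e \<subseteq> max_interval {..<n} f \<S> x t" using s(2) V(3) unfolding K_def by blast
    show "ball s e \<noteq> {}" using s(1) by simp
    fix r assume "r \<in> ball s e"
    then have r: "r \<in> V" "r \<in> K" using s(2) V(3) by auto
    have "(u r, r) \<in> \<S>" using ode_solution_in[OF u r(2)] .
    moreover have "u r j = 0" if "j \<in> J" for j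
      using that Z r(2) unfolding zero_components_def u_def K_def by auto
    ultimately have "(u r, r) \<in> regular_part J" using V(4)[OF _ r(1)] unfolding regular_part_def reduced_domain_def by auto
    then show "(max_solution {..<n} f \<S> x t r, r) \<in> regular_part J" unfolding u_def .
  qed simp
qed

lemma sub_system_meets_regular_part:
  assumes "J \<subseteq> {..<n}" "sub_system J \<noteq> {}"
  shows "regular_part J \<inter> sub_system J \<noteq> {}"
proof -
  obtain x t where xt: "(x, t) \<in> sub_system J" using assms(2) by auto
  obtain W where W: "W \<noteq> {}" "W \<subseteq> max_interval {..<n} f \<S> x t"
    "\<And>s. s \<in> W \<Longrightarrow> (max_solution {..<n} f \<S> x t s, s) \<in> regular_part J"
    using sub_system_regular_interval[OF xt assms(1)] by metis
  then obtain s where s: "s \<in> W" by blast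
  have "(max_solution {..<n} f \<S> x t s, s) \<in> solution_graph {..<n} f \<S> x t"
    using s W(2) unfolding solution_graph_def by blast
  then have "(max_solution {..<n} f \<S> x t s, s) \<in> sub_system J"
    using sub_system_invariant xt unfolding ode_domain_def by blast
  then show ?thesis using W(3)[OF s] by blast
qed

text \<open>
  A solution in the class of \<open>J\<close> is also a solution of the reduced equation. On an interval where its
  other components are nonzero, it is recovered from its own lift as the leading components.
\<close>

lemma sub_system_is_local_sub_solution:
  assumes J: "J \<subseteq> {..<n}" and xt: "(x, t) \<in> sub_system J"
  obtains x' t' where "(x', t') \<in> regular_part J" "local_sub_solution ({..<n} - J) f (reduced_domain J) x t
    {..<lift_dim} (quadratic_rhs lift_dim lift_coeff) (coord_space {..<lift_dim} \<times> T) (lift (x', t')) t'"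
proof -
  let ?I = "{..<n} - J" and ?B = "coord_space {..<lift_dim} \<times> T"
  interpret full: complexifiable_ode n "{..<n}" f \<S> by (rule full)
  interpret red: complexifiable_ode n ?I f "reduced_domain J" by (rule reduced[OF J])
  interpret quad: lipschitz_ode "{..<lift_dim}" "quadratic_rhs lift_dim lift_coeff" ?B by (rule quadratic_lipschitz_ode)
  define u where "u = max_solution {..<n} f \<S> x t"
  define K where "K = max_interval {..<n} f \<S> x t"
  have S: "(x, t) \<in> \<S>" and Z: "zero_components (x, t) = J" using xt unfolding sub_system_def by auto
  have u: "ode_solution {..<n} f \<S> u K" unfolding u_def K_def by (rule full.max_solution_is_solution)
  have t: "t \<in> K" unfolding K_def by (rule full.in_max_interval[OF S])
  have ut: "u t = x" unfolding u_def using full.max_solution_start(2) t K_def by blast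
  have u_red: "ode_solution ?I f (reduced_domain J) u K"
    using u Z unfolding ode_solution_def reduced_domain_def zero_components_def u_def K_def by auto
  obtain W where W: "open W" "is_interval W" "W \<noteq> {}" "W \<subseteq> K" "\<And>s. s \<in> W \<Longrightarrow> (u s, s) \<in> regular_part J"
    using sub_system_regular_interval[OF xt J] unfolding u_def K_def by metis
  have z: "ode_solution {..<lift_dim} (quadratic_rhs lift_dim lift_coeff) ?B (\<lambda>s. lift (u s, s)) W"
    by (rule lift_is_solution[OF J ode_solution_subset[OF u_red W(1,2,4)] W(5)])
  obtain s where s: "s \<in> W" using W(3) by blast
  show ?thesis
  proof (rule that[of "u s" s])
    show "(u s, s) \<in> regular_part J" by (rule W(5)[OF s])
    show "local_sub_solution ?I f (reduced_domain J) x t {..<lift_dim} (quadratic_rhs lift_dim lift_coeff) ?B (lift (u s, s)) s"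
      unfolding local_sub_solution_def
    proof (intro exI[of _ W] exI[of _ "\<lambda>i. i"] conjI ballI)
      show "W \<subseteq> max_interval ?I f (reduced_domain J) x t"
        using red.subset_max_interval[OF u_red t ut] W(4) by blast
      show "W \<subseteq> max_interval {..<lift_dim} (quadratic_rhs lift_dim lift_coeff) ?B (lift (u s, s)) s"
        using quad.subset_max_interval[OF z s refl] .
      show "(\<lambda>i. i) ` ?I \<subseteq> {..<lift_dim}" unfolding lift_dim_def by auto
      fix r i assume r: "r \<in> W" and i: "i \<in> ?I"
      have "max_solution ?I f (reduced_domain J) x t r = u r"
        using red.max_solution_eq[OF u_red t ut] r W(4) by blast
      moreover have "max_solution {..<lift_dim} (quadratic_rhs lift_dim lift_coeff) ?B (lift (u s, s)) s r = lift (u r, r)"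
        using quad.max_solution_eq[OF z s refl r] .
      ultimately show "max_solution ?I f (reduced_domain J) x t r i
          = max_solution {..<lift_dim} (quadratic_rhs lift_dim lift_coeff) ?B (lift (u s, s)) s r i"
        using i unfolding lift_def by simp
    qed (use W in auto)
  qed
qed

lemma sub_system_is_quadratizable:
  assumes J: "J \<subseteq> {..<n}"
  shows "sub_system_quadratizable n f \<S> T (sub_system J) (regular_part J) lift"
  unfolding sub_system_quadratizable_def
proof (intro exI[of _ J] conjI J)
  show "\<forall>(x, t)\<in>sub_system J. \<forall>s\<in>max_interval {..<n} f \<S> x t. \<forall>j\<in>J. max_solution {..<n} f \<S> x t s j = 0"
    unfolding sub_system_def zero_components_def by auto
  have "quadratizable ({..<n} - J) f (reduced_domain J) T (sub_system J) (regular_part J) lift"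
    unfolding quadratizable_def
  proof (intro conjI exI[of _ lift_dim] exI[of _ lift_coeff])
    show "openin (top_of_set (coord_space ({..<n} - J) \<times> UNIV)) (regular_part J)" by (rule regular_part_open[OF J])
    show "regular_part J \<subseteq> reduced_domain J" unfolding regular_part_def by blast
    show "\<forall>i<lift_dim. \<forall>j<lift_dim. local_lipschitz (UNIV :: real set) T (\<lambda>_. lift_coeff i j)"
      using coefficients_local_lipschitz by blast
    show "lift ` regular_part J \<subseteq> coord_space {..<lift_dim}"
      unfolding lift_def coord_space_def lift_dim_def by auto
    show "locally_compatible ({..<n} - J) f (reduced_domain J) {..<lift_dim} (quadratic_rhs lift_dim lift_coeff) (coord_space {..<lift_dim} \<times> T) (regular_part J) lift"
      by (rule lift_locally_compatible[OF J])
    show "\<forall>(x, t)\<in>sub_system J. \<exists>(x', t')\<in>regular_part J. local_sub_solution ({..<n} - J) f (reduced_domain J) x t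
        {..<lift_dim} (quadratic_rhs lift_dim lift_coeff) (coord_space {..<lift_dim} \<times> T) (lift (x', t')) t'"
    proof clarify
      fix x t assume "(x, t) \<in> sub_system J"
      from sub_system_is_local_sub_solution[OF J this] obtain x' t' where "(x', t') \<in> regular_part J"
        "local_sub_solution ({..<n} - J) f (reduced_domain J) x t
          {..<lift_dim} (quadratic_rhs lift_dim lift_coeff) (coord_space {..<lift_dim} \<times> T) (lift (x', t')) t'" .
      then show "\<exists>(x', t')\<in>regular_part J. local_sub_solution ({..<n} - J) f (reduced_domain J) x t
        {..<lift_dim} (quadratic_rhs lift_dim lift_coeff) (coord_space {..<lift_dim} \<times> T) (lift (x', t')) t'"
        by (intro bexI[of _ "(x', t')"]) simp_all
    qed
  qed
  then show "quadratizable ({..<n} - J) f {(x, t) \<in> \<S>. \<forall>j\<in>J. x j = 0} T (sub_system J) (regular_part J) lift"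
    unfolding reduced_domain_def .
qed

lemma sub_systems_cover: "(\<Union>J\<in>{J. J \<subseteq> {..<n} \<and> sub_system J \<noteq> {}}. sub_system J) = \<S>"
proof
  show "(\<Union>J\<in>{J. J \<subseteq> {..<n} \<and> sub_system J \<noteq> {}}. sub_system J) \<subseteq> \<S>"
    unfolding sub_system_def by blast
  show "\<S> \<subseteq> (\<Union>J\<in>{J. J \<subseteq> {..<n} \<and> sub_system J \<noteq> {}}. sub_system J)"
  proof
    fix y assume "y \<in> \<S>"
    then have "y \<in> sub_system (zero_components y)" unfolding sub_system_def by simp
    moreover have "zero_components y \<subseteq> {..<n}" unfolding zero_components_def by (cases y) auto
    ultimately show "y \<in> (\<Union>J\<in>{J. J \<subseteq> {..<n} \<and> sub_system J \<noteq> {}}. sub_system J)" by blast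
  qed
qed

lemma sub_systems_disjoint: "J \<noteq> J' \<Longrightarrow> sub_system J \<inter> sub_system J' = {}"
  unfolding sub_system_def by blast

end

theorem theorem2p12:
  fixes n :: nat and \<nu> :: "nat \<Rightarrow> nat"
    and v :: "nat \<Rightarrow> nat \<Rightarrow> real \<Rightarrow> real" and p :: "nat \<Rightarrow> nat \<Rightarrow> nat \<Rightarrow> real"
    and T :: "real set"
  assumes "open T" and "is_interval T" and "T \<noteq> {}"
    and "\<And>i l. i < n \<Longrightarrow> l < \<nu> i \<Longrightarrow> real_analytic_on (v i l) T"
  defines "f \<equiv> sigma_pi_rhs n \<nu> v p" and "\<S> \<equiv> sigma_pi_dom n \<nu> p \<times> T"
  shows "\<exists>(L :: nat) (S :: nat \<Rightarrow> (rvec \<times> real) set) (Dom :: nat \<Rightarrow> (rvec \<times> real) set)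
            (\<Phi> :: nat \<Rightarrow> rvec \<times> real \<Rightarrow> rvec).
           (\<Union>k<L. S k) = \<S> \<and> disjoint_family_on S {..<L} \<and>
           (\<forall>k<L. ode_domain {..<n} f \<S> (S k) \<and> Dom k \<inter> S k \<noteq> {} \<and>
              sub_system_quadratizable n f \<S> T (S k) (Dom k) (\<Phi> k))"
proof -
  interpret sigma_pi_ode n \<nu> v p T
    using assms(1,4) by unfold_locales (auto intro: real_analytic_extends_holomorphically)
  define \<J> where "\<J> = {J. J \<subseteq> {..<n} \<and> sub_system J \<noteq> {}}"
  have "finite \<J>" unfolding \<J>_def by simp
  then obtain h where h: "bij_betw h {..<card \<J>} \<J>"
    using ex_bij_betw_nat_finite[of \<J>] by (auto simp: lessThan_atLeast0)
  have h_in: "h k \<subseteq> {..<n}" "sub_system (h k) \<noteq> {}" if "k < card \<J>" for k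
    using bij_betwE[OF h] that unfolding \<J>_def by auto
  have "(\<Union>k<card \<J>. sub_system (h k)) = (\<Union>J\<in>h ` {..<card \<J>}. sub_system J)" by simp
  also have "\<dots> = (\<Union>J\<in>\<J>. sub_system J)" by (simp only: bij_betw_imp_surj_on[OF h])
  also have "\<dots> = \<S>"
    unfolding \<J>_def \<S>_def by (rule sub_systems_cover)
  finally have cover: "(\<Union>k<card \<J>. sub_system (h k)) = \<S>" .
  have disj: "disjoint_family_on (\<lambda>k. sub_system (h k)) {..<card \<J>}"
    unfolding disjoint_family_on_def
  proof (intro ballI impI)
    fix k k' assume "k \<in> {..<card \<J>}" "k' \<in> {..<card \<J>}" "k \<noteq> k'"
    then have "h k \<noteq> h k'" using inj_onD[OF bij_betw_imp_inj_on[OF h]] by blast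
    then show "sub_system (h k) \<inter> sub_system (h k') = {}" by (rule sub_systems_disjoint)
  qed
  show ?thesis
  proof (intro exI conjI allI impI)
    show "(\<Union>k<card \<J>. sub_system (h k)) = \<S>" by (rule cover)
    show "disjoint_family_on (\<lambda>k. sub_system (h k)) {..<card \<J>}" by (rule disj)
    fix k assume k: "k < card \<J>"
    show "ode_domain {..<n} f \<S> (sub_system (h k))"
      unfolding f_def \<S>_def by (rule sub_system_invariant)
    show "regular_part (h k) \<inter> sub_system (h k) \<noteq> {}" by (rule sub_system_meets_regular_part[OF h_in[OF k]])
    show "sub_system_quadratizable n f \<S> T (sub_system (h k)) (regular_part (h k)) lift"
      unfolding f_def \<S>_def by (rule sub_system_is_quadratizable[OF h_in(1)[OF k]])
  qed
qed

end
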